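(* Let $(X,\sigma)$ be a connected Klein surface, let $x\in X$, and let $p:(\widetilde X,\tilde x)\to(X,x)$ be a universal cover of $X$. The category $\mathrm{Cov}^{\mathbb R}_{(X,\sigma)}$ of real covering spaces of $(X,\sigma)$ is equivalent to the category of discrete left $\pi_1^{\mathbb R}((X,\sigma);x)$-sets. An explicit pair of quasi-inverse functors is provided by the fibre-at-$x$ functor $$\mathrm{Fib}_x:\mathrm{Cov}^{\mathbb R}_{(X,\sigma)}\to\pi_1^{\mathbb R}((X,\sigma);x)\text{-}\mathrm{Sets},\qquad\big(q:(Y,\tau)\to(X,\sigma)\big)\mapsto q^{-1}(\{x\}),$$ and the functor $$Q:\pi_1^{\mathbb R}((X,\sigma);x)\text{-}\mathrm{Sets}\to\mathrm{Cov}^{\mathbb R}_{(X,\sigma)},\qquad F\mapsto\big(\widetilde X\times_{\pi_1(X;x)}F,\ \pi_1^{\mathbb R}((X,\sigma);x)/\pi_1(X;x)\big),$$ where the second entry indicates that the real structure on $\widetilde X\times_{\pi_1(X;x)}F$ is given by the induced action of the quotient group $\pi_1^{\mathbb R}((X,\sigma);x)/\pi_1(X;x)\simeq\mathbb Z/2\mathbb Z$.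
   Context: A Klein surface $(X,\sigma)$ is a Riemann surface $X$ (without boundary) together with an anti-holomorphic involution $\sigma$. A real cover (real covering space) of $(X,\sigma)$ is a holomorphic map $q:Y\to X$ which is also a topological covering map, where $Y$ is a Hausdorff one-dimensional complex manifold (not required to be connected, non-empty or second countable) with an anti-holomorphic involution $\tau$, such that $q\circ\tau=\sigma\circ q$. A homomorphism of real covers from $q:(Y,\tau)\to(X,\sigma)$ to $q':(Y',\tau')\to(X,\sigma)$ is a holomorphic map $\phi:Y\to Y'$ with $\phi\circ\tau=\tau'\circ\phi$ and $q'\circ\phi=q$. A universal cover $p:(\widetilde X,\tilde x)\to(X,x)$ is a simply connected (connected) pointed topological covering, with the unique complex structure on $\widetilde X$ making $p$ holomorphic. The fundamental group of $(X,\sigma)$ is $$\pi_1^{\mathbb R}((X,\sigma);x):=\{f:\widetilde X\to\widetilde X\text{ self-diffeomorphism}\mid\exists\,\sigma_f\in\{\mathrm{Id}_X,\sigma\},\ p\circ f=\sigma_f\circ p\}$$ with group law $f\cdot g:=g\circ f$ (the opposite of composition), and $\pi_1(X;x):=\mathrm{Aut}(\widetilde X/X)^{\mathrm{op}}$ is the normal subgroup of index two of elements with $p\circ f=p$. The group $\pi_1^{\mathbb R}((X,\sigma);x)$ acts on $\widetilde X$ on the right by $y\cdot f:=f(y)$. Action on fibres: for a real cover $q:(Y,\tau)\to(X,\sigma)$ and $y\in q^{-1}(\{x\})$, let $t_y:\widetilde X\to Y$ be the unique continuous map with $q\circ t_y=p$ and $t_y(\tilde x)=y$. The left action of $\pi_1^{\mathbb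 R}((X,\sigma);x)$ on $q^{-1}(\{x\})$ is $f\curvearrowright y:=(\tau_f^{-1}\circ t_y\circ f)(\tilde x)$, where $\tau_f=\mathrm{Id}_Y$ if $\sigma_f=\mathrm{Id}_X$ and $\tau_f=\tau$ if $\sigma_f=\sigma$. On morphisms, $\mathrm{Fib}_x$ is restriction to fibres. The functor $Q$: for a left $\pi_1^{\mathbb R}((X,\sigma);x)$-set $F$ (with the discrete topology), $\widetilde X\times_{\pi_1(X;x)}F$ is the quotient of $\widetilde X\times F$ by the left $\pi_1(X;x)$-action $f\cdot(y,v)=(y\cdot f^{-1},f\cdot v)$, with covering map to $X$ induced by $(y,v)\mapsto p(y)$ and the unique complex structure making this covering map holomorphic; the real structure is $[(y,v)]\mapsto[(y\cdot h^{-1},h\cdot v)]$ for any $h\in\pi_1^{\mathbb R}((X,\sigma);x)\setminus\pi_1(X;x)$ (independent of the choice of $h$). On morphisms, an equivariant map $u:F\to F'$ is sent to $[(y,v)]\mapsto[(y,u(v))]$. *)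

theory Defs
  imports
    "HOL-Analysis.Analysis"
    "HOL-Algebra.Group_Action"
    "HOL-Algebra.Elementary_Groups"
begin

section \<open>Categories, functors, equivalences\<close>

text \<open>
  Hom-sets of different pairs of objects may overlap, so composition, and the action of a
  functor on morphisms, take the objects involved as arguments:
  \<open>Comp C a b c g f\<close> is \<open>g\<close> after \<open>f\<close> for \<open>f : a \<rightarrow> b\<close> and \<open>g : b \<rightarrow> c\<close>.
\<close>

record ('o, 'm) cat =
  Obj :: "'o set"
  Hom :: "'o \<Rightarrow> 'o \<Rightarrow> 'm set"
  Ident :: "'o \<Rightarrow> 'm"
  Comp :: "'o \<Rightarrow> 'o \<Rightarrow> 'o \<Rightarrow> 'm \<Rightarrow> 'm \<Rightarrow> 'm"

definition is_category :: "('o, 'm) cat \<Rightarrow> bool" where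
  "is_category C \<longleftrightarrow>
     (\<forall>a\<in>Obj C. Ident C a \<in> Hom C a a) \<and>
     (\<forall>a\<in>Obj C. \<forall>b\<in>Obj C. \<forall>c\<in>Obj C. \<forall>f\<in>Hom C a b. \<forall>g\<in>Hom C b c.
        Comp C a b c g f \<in> Hom C a c) \<and>
     (\<forall>a\<in>Obj C. \<forall>b\<in>Obj C. \<forall>f\<in>Hom C a b.
        Comp C a a b f (Ident C a) = f \<and> Comp C a b b (Ident C b) f = f) \<and>
     (\<forall>a\<in>Obj C. \<forall>b\<in>Obj C. \<forall>c\<in>Obj C. \<forall>d\<in>Obj C.
        \<forall>f\<in>Hom C a b. \<forall>g\<in>Hom C b c. \<forall>h\<in>Hom C c d.
        Comp C a b d (Comp C b c d h g) f = Comp C a c d h (Comp C a b c g f))"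

record ('o, 'm, 'p, 'n) cat_functor =
  on_obj :: "'o \<Rightarrow> 'p"
  on_hom :: "'o \<Rightarrow> 'o \<Rightarrow> 'm \<Rightarrow> 'n"

definition is_functor :: "('o, 'm) cat \<Rightarrow> ('p, 'n) cat \<Rightarrow> ('o, 'm, 'p, 'n) cat_functor \<Rightarrow> bool" where
  "is_functor C D F \<longleftrightarrow>
     (\<forall>a\<in>Obj C. on_obj F a \<in> Obj D) \<and>
     (\<forall>a\<in>Obj C. \<forall>b\<in>Obj C. \<forall>f\<in>Hom C a b.
        on_hom F a b f \<in> Hom D (on_obj F a) (on_obj F b)) \<and>
     (\<forall>a\<in>Obj C. on_hom F a a (Ident C a) = Ident D (on_obj F a)) \<and>
     (\<forall>a\<in>Obj C. \<forall>b\<in>Obj C. \<forall>c\<in>Obj C. \<forall>f\<in>Hom C a b. \<forall>g\<in>Hom C b c.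
        on_hom F a c (Comp C a b c g f) =
        Comp D (on_obj F a) (on_obj F b) (on_obj F c) (on_hom F b c g) (on_hom F a b f))"

definition id_functor :: "('o, 'm, 'o, 'm) cat_functor" where
  "id_functor = \<lparr>on_obj = (\<lambda>a. a), on_hom = (\<lambda>a b f. f)\<rparr>"

definition comp_functor ::
  "('p, 'n, 'q, 'k) cat_functor \<Rightarrow> ('o, 'm, 'p, 'n) cat_functor \<Rightarrow> ('o, 'm, 'q, 'k) cat_functor" where
  "comp_functor G F =
     \<lparr>on_obj = (\<lambda>a. on_obj G (on_obj F a)),
      on_hom = (\<lambda>a b f. on_hom G (on_obj F a) (on_obj F b) (on_hom F a b f))\<rparr>"

definition is_iso_in :: "('o, 'm) cat \<Rightarrow> 'o \<Rightarrow> 'o \<Rightarrow> 'm \<Rightarrow> bool" where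
  "is_iso_in C a b f \<longleftrightarrow> f \<in> Hom C a b \<and>
     (\<exists>g\<in>Hom C b a. Comp C a b a g f = Ident C a \<and> Comp C b a b f g = Ident C b)"

definition naturally_isomorphic ::
  "('o, 'm) cat \<Rightarrow> ('p, 'n) cat \<Rightarrow> ('o, 'm, 'p, 'n) cat_functor \<Rightarrow> ('o, 'm, 'p, 'n) cat_functor \<Rightarrow> bool" where
  "naturally_isomorphic C D F G \<longleftrightarrow>
     (\<exists>\<eta>. (\<forall>a\<in>Obj C. is_iso_in D (on_obj F a) (on_obj G a) (\<eta> a)) \<and>
          (\<forall>a\<in>Obj C. \<forall>b\<in>Obj C. \<forall>f\<in>Hom C a b.
             Comp D (on_obj F a) (on_obj F b) (on_obj G b) (\<eta> b) (on_hom F a b f) =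
             Comp D (on_obj F a) (on_obj G a) (on_obj G b) (on_hom G a b f) (\<eta> a)))"

definition quasi_inverse_functors ::
  "('o, 'm) cat \<Rightarrow> ('p, 'n) cat \<Rightarrow> ('o, 'm, 'p, 'n) cat_functor \<Rightarrow> ('p, 'n, 'o, 'm) cat_functor \<Rightarrow> bool" where
  "quasi_inverse_functors C D F G \<longleftrightarrow>
     is_functor C D F \<and> is_functor D C G \<and>
     naturally_isomorphic C C (comp_functor G F) id_functor \<and>
     naturally_isomorphic D D (comp_functor F G) id_functor"

definition equivalent_categories :: "('o, 'm) cat \<Rightarrow> ('p, 'n) cat \<Rightarrow> bool" where
  "equivalent_categories C D \<longleftrightarrow> is_category C \<and> is_category D \<and>
     (\<exists>F G. quasi_inverse_functors C D F G)"


section \<open>Riemann surfaces\<close>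

text \<open>
  A surface is a topology together with a set of charts \<open>(U, \<phi>)\<close>; only the values of \<open>\<phi>\<close>
  on \<open>U\<close> are meaningful.  A complex structure is a maximal holomorphic atlas.  Neither
  connectedness nor second countability is part of the notion of a Riemann surface here.
\<close>

record 'a surface =
  surf_top :: "'a topology"
  surf_charts :: "('a set \<times> ('a \<Rightarrow> complex)) set"

abbreviation points :: "'a surface \<Rightarrow> 'a set" where
  "points S \<equiv> topspace (surf_top S)"

definition is_chart :: "'a topology \<Rightarrow> 'a set \<times> ('a \<Rightarrow> complex) \<Rightarrow> bool" where
  "is_chart T = (\<lambda>(U, \<phi>). openin T U \<and> open (\<phi> ` U) \<and>
     homeomorphic_map (subtopology T U) (top_of_set (\<phi> ` U)) \<phi>)"

definition holo_transition ::
  "'a set \<times> ('a \<Rightarrow> complex) \<Rightarrow> 'a set \<times> ('a \<Rightarrow> complex) \<Rightarrow> bool" where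
  "holo_transition = (\<lambda>(U, \<phi>) (V, \<psi>). (\<psi> \<circ> inv_into U \<phi>) holomorphic_on \<phi> ` (U \<inter> V))"

definition complex_structure :: "'a topology \<Rightarrow> ('a set \<times> ('a \<Rightarrow> complex)) set \<Rightarrow> bool" where
  "complex_structure T A \<longleftrightarrow>
     (\<forall>c\<in>A. is_chart T c) \<and>
     (\<Union>(U, \<phi>)\<in>A. U) = topspace T \<and>
     (\<forall>c\<in>A. \<forall>d\<in>A. holo_transition c d) \<and>
     (\<forall>c. is_chart T c \<and> (\<forall>d\<in>A. holo_transition c d \<and> holo_transition d c) \<longrightarrow> c \<in> A)"

definition riemann_surface :: "'a surface \<Rightarrow> bool" where
  "riemann_surface S \<longleftrightarrow>
     Hausdorff_space (surf_top S) \<and> complex_structure (surf_top S) (surf_charts S)"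

text \<open>\<open>P g D\<close> is a regularity condition on the local representatives \<open>g\<close>, on their domain \<open>D\<close>.\<close>

definition map_in_charts ::
  "((complex \<Rightarrow> complex) \<Rightarrow> complex set \<Rightarrow> bool) \<Rightarrow> 'a surface \<Rightarrow> 'b surface \<Rightarrow> ('a \<Rightarrow> 'b) \<Rightarrow> bool" where
  "map_in_charts P S S' f \<longleftrightarrow> continuous_map (surf_top S) (surf_top S') f \<and>
     (\<forall>(U, \<phi>)\<in>surf_charts S. \<forall>(V, \<psi>)\<in>surf_charts S'.
        P (\<psi> \<circ> f \<circ> inv_into U \<phi>) (\<phi> ` {y\<in>U. f y \<in> V}))"

definition holomorphic_map :: "'a surface \<Rightarrow> 'b surface \<Rightarrow> ('a \<Rightarrow> 'b) \<Rightarrow> bool" where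
  "holomorphic_map = map_in_charts (\<lambda>g D. g holomorphic_on D)"

definition antiholomorphic_map :: "'a surface \<Rightarrow> 'b surface \<Rightarrow> ('a \<Rightarrow> 'b) \<Rightarrow> bool" where
  "antiholomorphic_map = map_in_charts (\<lambda>g D. (cnj \<circ> g) holomorphic_on D)"

text \<open>Real differentiability classes, for maps on open subsets of the plane.\<close>

primrec Ck_on :: "nat \<Rightarrow> (complex \<Rightarrow> complex) \<Rightarrow> complex set \<Rightarrow> bool" where
  "Ck_on 0 g D \<longleftrightarrow> continuous_on D g"
| "Ck_on (Suc k) g D \<longleftrightarrow> (\<forall>z\<in>D. g differentiable (at z)) \<and>
     (\<forall>v. Ck_on k (\<lambda>z. frechet_derivative g (at z) v) D)"

definition smooth_map :: "'a surface \<Rightarrow> 'b surface \<Rightarrow> ('a \<Rightarrow> 'b) \<Rightarrow> bool" where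
  "smooth_map = map_in_charts (\<lambda>g D. \<forall>k. Ck_on k g D)"

definition diffeomorphism :: "'a surface \<Rightarrow> 'b surface \<Rightarrow> ('a \<Rightarrow> 'b) \<Rightarrow> bool" where
  "diffeomorphism S S' f \<longleftrightarrow> bij_betw f (points S) (points S') \<and>
     smooth_map S S' f \<and> smooth_map S' S (inv_into (points S) f)"

definition klein_surface :: "'a surface \<Rightarrow> ('a \<Rightarrow> 'a) \<Rightarrow> bool" where
  "klein_surface X \<sigma> \<longleftrightarrow> riemann_surface X \<and> antiholomorphic_map X X \<sigma> \<and>
     (\<forall>x\<in>points X. \<sigma> (\<sigma> x) = x)"


section \<open>Coverings\<close>

text \<open>Coverings need not be surjective: the empty space covers everything.\<close>

definition covering_map :: "'a topology \<Rightarrow> 'b topology \<Rightarrow> ('a \<Rightarrow> 'b) \<Rightarrow> bool" where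
  "covering_map T T' p \<longleftrightarrow> continuous_map T T' p \<and>
     (\<forall>x\<in>topspace T'. \<exists>U. openin T' U \<and> x \<in> U \<and>
        (\<exists>\<V>. \<Union>\<V> = {y\<in>topspace T. p y \<in> U} \<and> (\<forall>V\<in>\<V>. openin T V) \<and> pairwise disjnt \<V> \<and>
             (\<forall>V\<in>\<V>. homeomorphic_map (subtopology T V) (subtopology T' U) p)))"

definition simply_connected_space :: "'a topology \<Rightarrow> bool" where
  "simply_connected_space T \<longleftrightarrow> path_connected_space T \<and>
     (\<forall>g. pathin T g \<and> g 0 = g 1 \<longrightarrow>
        homotopic_with (\<lambda>h. h 0 = g 0 \<and> h 1 = g 0) (top_of_set {0..1}) T g (\<lambda>_. g 0))"

definition universal_cover :: "'b topology \<Rightarrow> 'b \<Rightarrow> 'a topology \<Rightarrow> 'a \<Rightarrow> ('a \<Rightarrow> 'b) \<Rightarrow> bool" where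
  "universal_cover T x T' x' p \<longleftrightarrow> covering_map T' T p \<and> simply_connected_space T' \<and>
     x' \<in> topspace T' \<and> p x' = x"

definition induced_surface :: "'b surface \<Rightarrow> 'a topology \<Rightarrow> ('a \<Rightarrow> 'b) \<Rightarrow> 'a surface" where
  "induced_surface X T p =
     \<lparr>surf_top = T,
      surf_charts = (THE A. complex_structure T A \<and>
        holomorphic_map \<lparr>surf_top = T, surf_charts = A\<rparr> X p)\<rparr>"

record ('y, 'x) real_cover =
  cov_surf :: "'y surface"
  cov_inv :: "'y \<Rightarrow> 'y"
  cov_map :: "'y \<Rightarrow> 'x"

abbreviation cov_points :: "('y, 'x) real_cover \<Rightarrow> 'y set" where
  "cov_points c \<equiv> points (cov_surf c)"

definition is_real_cover :: "'x surface \<Rightarrow> ('x \<Rightarrow> 'x) \<Rightarrow> ('y, 'x) real_cover \<Rightarrow> bool" where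
  "is_real_cover X \<sigma> c \<longleftrightarrow>
     klein_surface (cov_surf c) (cov_inv c) \<and>
     holomorphic_map (cov_surf c) X (cov_map c) \<and>
     covering_map (surf_top (cov_surf c)) (surf_top X) (cov_map c) \<and>
     (\<forall>y\<in>cov_points c. cov_map c (cov_inv c y) = \<sigma> (cov_map c y))"

definition RealCov :: "'x surface \<Rightarrow> ('x \<Rightarrow> 'x) \<Rightarrow> (('y, 'x) real_cover, 'y \<Rightarrow> 'y) cat" where
  "RealCov X \<sigma> =
     \<lparr>Obj = {c. is_real_cover X \<sigma> c},
      Hom = (\<lambda>c d. {\<phi> \<in> extensional (cov_points c).
        holomorphic_map (cov_surf c) (cov_surf d) \<phi> \<and>
        (\<forall>y\<in>cov_points c. \<phi> (cov_inv c y) = cov_inv d (\<phi> y)) \<and>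
        (\<forall>y\<in>cov_points c. cov_map d (\<phi> y) = cov_map c y)}),
      Ident = (\<lambda>c. \<lambda>y\<in>cov_points c. y),
      Comp = (\<lambda>a b c g f. compose (cov_points a) g f)\<rparr>"


section \<open>The fundamental group and its sets\<close>

text \<open>The group law is the opposite of composition: \<open>f \<cdot> g = g \<circ> f\<close>.\<close>

definition piR ::
  "'x surface \<Rightarrow> ('x \<Rightarrow> 'x) \<Rightarrow> 't topology \<Rightarrow> ('t \<Rightarrow> 'x) \<Rightarrow> ('t \<Rightarrow> 't) monoid" where
  "piR X \<sigma> T p =
     \<lparr>carrier = {f \<in> extensional (topspace T).
        diffeomorphism (induced_surface X T p) (induced_surface X T p) f \<and>
        (\<exists>s\<in>{id, \<sigma>}. \<forall>z\<in>topspace T. p (f z) = s (p z))},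
      mult = (\<lambda>f g. compose (topspace T) g f),
      one = (\<lambda>z\<in>topspace T. z)\<rparr>"

definition pi1 ::
  "'x surface \<Rightarrow> ('x \<Rightarrow> 'x) \<Rightarrow> 't topology \<Rightarrow> ('t \<Rightarrow> 'x) \<Rightarrow> ('t \<Rightarrow> 't) set" where
  "pi1 X \<sigma> T p = {f \<in> carrier (piR X \<sigma> T p). \<forall>z\<in>topspace T. p (f z) = p z}"

type_synonym ('g, 'f) gset = "'f set \<times> ('g \<Rightarrow> 'f \<Rightarrow> 'f)"

definition GSets :: "'g monoid \<Rightarrow> (('g, 'f) gset, 'f \<Rightarrow> 'f) cat" where
  "GSets G =
     \<lparr>Obj = {(E, \<rho>). group_action G E \<rho>},
      Hom = (\<lambda>(E, \<rho>) (E', \<rho>'). {u \<in> E \<rightarrow>\<^sub>E E'.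
        \<forall>g\<in>carrier G. \<forall>v\<in>E. u (\<rho> g v) = \<rho>' g (u v)}),
      Ident = (\<lambda>(E, \<rho>). \<lambda>v\<in>E. v),
      Comp = (\<lambda>(E, \<rho>) b c g f. compose E g f)\<rparr>"


section \<open>The fibre functor\<close>

definition fibre :: "('y, 'x) real_cover \<Rightarrow> 'x \<Rightarrow> 'y set" where
  "fibre c x = {y\<in>cov_points c. cov_map c y = x}"

definition lift_at :: "'t topology \<Rightarrow> 't \<Rightarrow> ('t \<Rightarrow> 'x) \<Rightarrow> ('y, 'x) real_cover \<Rightarrow> 'y \<Rightarrow> 't \<Rightarrow> 'y" where
  "lift_at T x' p c y = (THE t. t \<in> extensional (topspace T) \<and>
     continuous_map T (surf_top (cov_surf c)) t \<and>
     (\<forall>z\<in>topspace T. cov_map c (t z) = p z) \<and> t x' = y)"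

text \<open>
  Since \<open>\<sigma>\<close> is not the identity (\<open>X\<close> being non-empty), \<open>f\<close> lies over the identity
  precisely when it lies in \<open>pi1\<close>.
\<close>

definition tau_of ::
  "'x surface \<Rightarrow> ('x \<Rightarrow> 'x) \<Rightarrow> 't topology \<Rightarrow> ('t \<Rightarrow> 'x) \<Rightarrow> ('y, 'x) real_cover \<Rightarrow>
   ('t \<Rightarrow> 't) \<Rightarrow> 'y \<Rightarrow> 'y" where
  "tau_of X \<sigma> T p c f = (if f \<in> pi1 X \<sigma> T p then id else cov_inv c)"

definition Fib ::
  "'x surface \<Rightarrow> ('x \<Rightarrow> 'x) \<Rightarrow> 't topology \<Rightarrow> 't \<Rightarrow> ('t \<Rightarrow> 'x) \<Rightarrow> 'x \<Rightarrow>
   (('y, 'x) real_cover, 'y \<Rightarrow> 'y, ('t \<Rightarrow> 't, 'y) gset, 'y \<Rightarrow> 'y) cat_functor" where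
  "Fib X \<sigma> T x' p x =
     \<lparr>on_obj = (\<lambda>c. (fibre c x, \<lambda>f. \<lambda>y\<in>fibre c x.
        inv_into (cov_points c) (tau_of X \<sigma> T p c f) (lift_at T x' p c y (f x')))),
      on_hom = (\<lambda>c d \<phi>. restrict \<phi> (fibre c x))\<rparr>"


section \<open>The functor Q\<close>

text \<open>The action \<open>f \<cdot> (y, v) = (f\<inverse>(y), f \<cdot> v)\<close>; recall that \<open>y \<cdot> f = f(y)\<close>.\<close>

definition diag_act ::
  "('t \<Rightarrow> 't) monoid \<Rightarrow> (('t \<Rightarrow> 't) \<Rightarrow> 'f \<Rightarrow> 'f) \<Rightarrow> ('t \<Rightarrow> 't) \<Rightarrow> 't \<times> 'f \<Rightarrow> 't \<times> 'f" where
  "diag_act G \<rho> f = (\<lambda>(y, v). ((inv\<^bsub>G\<^esub> f) y, \<rho> f v))"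

text \<open>
  The points of the quotient are the orbits \<open>[(y, v)]\<close> of the action of \<open>pi1\<close>, or rather their
  names under a map \<open>code\<close> which is injective on the orbits; \<open>code = id\<close> gives the
  literal quotient set.  Names are needed because the functor \<open>Q\<close> and the fibre functor
  go back and forth between two categories, so that the underlying sets of covers and of group
  sets have to be subsets of one fixed type \<open>'u\<close> (a universe), whereas the literal quotient
  is a set over the larger type \<open>('t \<times> 'u) set\<close>.
\<close>

definition cls ::
  "(('t \<times> 'f) set \<Rightarrow> 'c) \<Rightarrow> 'x surface \<Rightarrow> ('x \<Rightarrow> 'x) \<Rightarrow> 't topology \<Rightarrow> ('t \<Rightarrow> 'x) \<Rightarrow>
   ('t \<Rightarrow> 't, 'f) gset \<Rightarrow> 't \<times> 'f \<Rightarrow> 'c" where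
  "cls code X \<sigma> T p F z =
     code (orbit ((piR X \<sigma> T p)\<lparr>carrier := pi1 X \<sigma> T p\<rparr>) (diag_act (piR X \<sigma> T p) (snd F)) z)"

definition quotient_topology :: "'a topology \<Rightarrow> ('a \<Rightarrow> 'b) \<Rightarrow> 'b topology" where
  "quotient_topology T k =
     topology (\<lambda>U. U \<subseteq> k ` topspace T \<and> openin T {z\<in>topspace T. k z \<in> U})"

definition Q_top where
  "Q_top code X \<sigma> T p F =
     quotient_topology (prod_topology T (discrete_topology (fst F))) (cls code X \<sigma> T p F)"

text \<open>
  The description operators below express that the maps are induced from maps on
  representatives; in \<open>Q_inv\<close> also that the result does not depend on the choice of \<open>h\<close>.
\<close>

definition Q_map where
  "Q_map code X \<sigma> T p F = (\<lambda>b\<in>topspace (Q_top code X \<sigma> T p F).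
     THE a. \<forall>y\<in>topspace T. \<forall>v\<in>fst F. cls code X \<sigma> T p F (y, v) = b \<longrightarrow> a = p y)"

definition Q_inv where
  "Q_inv code X \<sigma> T p F = (\<lambda>b\<in>topspace (Q_top code X \<sigma> T p F).
     THE b'. \<forall>h\<in>carrier (piR X \<sigma> T p) - pi1 X \<sigma> T p. \<forall>y\<in>topspace T. \<forall>v\<in>fst F.
       cls code X \<sigma> T p F (y, v) = b \<longrightarrow>
       b' = cls code X \<sigma> T p F (diag_act (piR X \<sigma> T p) (snd F) h (y, v)))"

definition Q ::
  "(('t \<times> 'f) set \<Rightarrow> 'c) \<Rightarrow> 'x surface \<Rightarrow> ('x \<Rightarrow> 'x) \<Rightarrow> 't topology \<Rightarrow> ('t \<Rightarrow> 'x) \<Rightarrow>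
   (('t \<Rightarrow> 't, 'f) gset, 'f \<Rightarrow> 'f, ('c, 'x) real_cover, 'c \<Rightarrow> 'c) cat_functor" where
  "Q code X \<sigma> T p =
     \<lparr>on_obj = (\<lambda>F.
        \<lparr>cov_surf = induced_surface X (Q_top code X \<sigma> T p F) (Q_map code X \<sigma> T p F),
         cov_inv = Q_inv code X \<sigma> T p F,
         cov_map = Q_map code X \<sigma> T p F\<rparr>),
      on_hom = (\<lambda>F F' u. \<lambda>b\<in>topspace (Q_top code X \<sigma> T p F).
        THE b'. \<forall>y\<in>topspace T. \<forall>v\<in>fst F.
          cls code X \<sigma> T p F (y, v) = b \<longrightarrow> b' = cls code X \<sigma> T p F' (y, u v))\<rparr>"

text \<open>
  A naming of the orbits by elements of \<open>'u\<close>, through representatives.  An injection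
  \<open>enc\<close> as below exists as soon as \<open>'u\<close> is infinite and at least as large as \<open>'t\<close>.
\<close>

definition rep_code :: "('t \<times> 'u \<Rightarrow> 'u) \<Rightarrow> ('t \<times> 'u) set \<Rightarrow> 'u" where
  "rep_code enc A = enc (SOME z. z \<in> A)"

end

theory Submission
  imports Defs "HOL-Complex_Analysis.Conformal_Mappings"
begin

text \<open>
  Everything happens on the level of topology. A continuous map between real covers that lies over
  the identity (over \<open>\<sigma>\<close>) is automatically holomorphic (antiholomorphic), because the covering
  maps are holomorphic local homeomorphisms and hence have holomorphic local inverses. So
  \<open>\<pi>\<^sub>1\<^sup>R\<close> consists of all homeomorphisms of the universal cover lying over
  \<open>id\<close> or \<open>\<sigma>\<close>; unique lifting makes \<open>\<pi>\<^sub>1\<close> act simply transitively on the fibres of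
  \<open>p\<close> and provides lifts of \<open>\<sigma>\<close>, which is not the identity since \<open>cnj\<close> is not holomorphic.
  With \<open>t\<^sub>v\<close> the lift of \<open>p\<close> through \<open>v\<close>, the natural isomorphism from the quotient of the
  fibre back to a cover is \<open>[(y, v)] \<mapsto> t\<^sub>v(y)\<close>, and the one from the fibre of the quotient
  back to a group set \<open>E\<close> is inverse to \<open>v \<mapsto> [(x', v)]\<close>, where \<open>x'\<close> is the base point of
  the universal cover.
\<close>

section \<open>Coverings and lifts\<close>

text \<open>Lifting is developed from the bare definitions. The contraction of loops is used once,
  to see that the image of a loop of the universal cover has closed lifts; the lift of a map is then
  cut out as a path component of a fibre product, so no group of homotopy classes is formed. Maps
  over the identity and maps over \<open>\<sigma>\<close> are treated together, with
  \<open>s \<in> {id, \<sigma>}\<close>; this works because \<open>s\<close> undoes itself on the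
  points of \<open>X\<close>. Anti-holomorphic maps become holomorphic ones by conjugating the
  charts of the target. The obstacle in the quotient is that its points are names of orbits and
  every map on it is a description operator. Orbits and names are confined to two facts,
  \<open>cls_eqI\<close> and \<open>cls_eqD\<close>, that say when two pairs have the same name;
  each operator is then computed on representatives. The law
  \<open>f \<cdot> g = g \<circ> f\<close> is what turns both the diagonal action and the action on
  fibres into left actions. Both natural isomorphisms are found as bijective morphisms, whose
  inverses are morphisms automatically.\<close>

lemma homeomorphic_map_section:
  assumes "homeomorphic_map (subtopology E V) (subtopology X U) q"
    and "V \<subseteq> topspace E" "U \<subseteq> topspace X"
  shows "q ` V = U" "inj_on q V" "continuous_map (subtopology X U) (subtopology E V) (inv_into V q)"
proof -
  have tE: "topspace (subtopology E V) = V" and tX: "topspace (subtopology X U) = U"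
    using assms by auto
  show im: "q ` V = U" and inj: "inj_on q V"
    using assms(1) tE tX by (auto simp: homeomorphic_eq_everything_map)
  obtain g where g: "homeomorphic_maps (subtopology E V) (subtopology X U) q g"
    using assms(1) homeomorphic_map_maps by blast
  then have gc: "continuous_map (subtopology X U) (subtopology E V) g"
    and gl: "\<And>u. u \<in> V \<Longrightarrow> g (q u) = u"
    using tE by (auto simp: homeomorphic_maps_def)
  have "g u = inv_into V q u" if "u \<in> U" for u
    using that im inj gl by (metis f_inv_into_f inv_into_into)
  then show "continuous_map (subtopology X U) (subtopology E V) (inv_into V q)"
    using continuous_map_eq[OF gc] tX by auto
qed

section \<open>Local homeomorphisms\<close>

text \<open>The part of a covering on which complex structures and holomorphy depend; evenly covered
  sets matter only for lifting.\<close>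

definition local_homeo :: "'e topology \<Rightarrow> 'x topology \<Rightarrow> ('e \<Rightarrow> 'x) \<Rightarrow> bool" where
  "local_homeo E X q \<longleftrightarrow> continuous_map E X q \<and>
     (\<forall>e\<in>topspace E. \<exists>V. openin E V \<and> e \<in> V \<and> openin X (q ` V) \<and>
        homeomorphic_map (subtopology E V) (subtopology X (q ` V)) q)"

lemma local_homeo_open_map:
  assumes "local_homeo E X q"
  shows "open_map E X q"
  unfolding open_map_def
proof (intro allI impI)
  fix W assume W: "openin E W"
  show "openin X (q ` W)"
  proof (subst openin_subopen, intro ballI)
    fix b assume "b \<in> q ` W"
    then obtain e where e: "e \<in> W" "b = q e" by blast
    with W have "e \<in> topspace E" using openin_subset by blast
    then obtain V where V: "openin E V" "e \<in> V" "openin X (q ` V)"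
      "homeomorphic_map (subtopology E V) (subtopology X (q ` V)) q"
      using assms unfolding local_homeo_def by blast
    have "open_map (subtopology E V) (subtopology X (q ` V)) q"
      using V(4) homeomorphic_imp_open_map by blast
    moreover have "openin (subtopology E V) (W \<inter> V)"
      using W by (auto simp: openin_subtopology)
    ultimately have "openin (subtopology X (q ` V)) (q ` (W \<inter> V))"
      unfolding open_map_def by blast
    then have "openin X (q ` (W \<inter> V))"
      using V(3) openin_trans_full by blast
    then show "\<exists>T. openin X T \<and> b \<in> T \<and> T \<subseteq> q ` W"
      using e V(2) by (intro exI[of _ "q ` (W \<inter> V)"]) auto
  qed
qed

lemma local_homeo_small:
  assumes "local_homeo E X q" "openin E W" "e \<in> W"
  obtains V where "openin E V" "e \<in> V" "V \<subseteq> W" "openin X (q ` V)"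
    "homeomorphic_map (subtopology E V) (subtopology X (q ` V)) q"
proof -
  have "e \<in> topspace E" using assms openin_subset by blast
  then obtain V where V: "openin E V" "e \<in> V" "openin X (q ` V)"
      "homeomorphic_map (subtopology E V) (subtopology X (q ` V)) q"
    using assms unfolding local_homeo_def by blast
  let ?V = "V \<inter> W"
  have o: "openin E ?V" using V assms by blast
  then have oq: "openin X (q ` ?V)"
    using local_homeo_open_map[OF assms(1)] unfolding open_map_def by blast
  have "inj_on q V"
    by (rule homeomorphic_map_section(2)[OF V(4) openin_subset[OF V(1)] openin_subset[OF V(3)]])
  then have *: "q ` (topspace (subtopology E V) \<inter> ?V) = topspace (subtopology X (q ` V)) \<inter> q ` ?V"
    using openin_subset[OF V(1)] openin_subset[OF V(3)] by auto
  have "homeomorphic_map (subtopology (subtopology E V) ?V) (subtopology (subtopology X (q ` V)) (q ` ?V)) q"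
    by (rule homeomorphic_map_subtopologies[OF V(4) *])
  then have "homeomorphic_map (subtopology E ?V) (subtopology X (q ` ?V)) q"
    by (simp add: subtopology_subtopology Int_absorb2 image_mono Int_absorb1)
  then show ?thesis using o oq V(2) assms(3) that[of ?V] by blast
qed

text \<open>Near each point \<open>f\<close> is a local inverse of \<open>q'\<close> after the open
  map \<open>q\<close>. This later gives the continuity of the inverse of a bijective morphism of
  covers.\<close>

lemma open_map_over:
  assumes q: "local_homeo E X q" and q': "local_homeo E' X q'"
    and f: "continuous_map E E' f" and fq: "\<And>e. e \<in> topspace E \<Longrightarrow> q' (f e) = q e"
  shows "open_map E E' f"
  unfolding open_map_def
proof (intro allI impI)
  fix W assume W: "openin E W"
  show "openin E' (f ` W)"
  proof (subst openin_subopen, intro ballI)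
    fix b assume "b \<in> f ` W"
    then obtain e where e: "e \<in> W" "b = f e" by blast
    have eE: "e \<in> topspace E" using W e openin_subset by blast
    then have "f e \<in> topspace E'" using f by (auto simp: continuous_map_def)
    then obtain V where V: "openin E' V" "f e \<in> V" "openin X (q' ` V)"
      "homeomorphic_map (subtopology E' V) (subtopology X (q' ` V)) q'"
      using q' unfolding local_homeo_def by blast
    have inj: "inj_on q' V"
      by (rule homeomorphic_map_section(2)[OF V(4) openin_subset[OF V(1)] openin_subset[OF V(3)]])
    \<comment> \<open>\<open>W\<close> is shrunk so that \<open>f\<close> stays in one set
      \<open>V\<close> on which \<open>q'\<close> is injective; a point of \<open>V\<close> over the
      image of \<open>W'\<close> is then forced to be a value of \<open>f\<close>.\<close>
    define W' where "W' = {u \<in> topspace E. f u \<in> V} \<inter> W"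
    have W': "openin E W'"
      unfolding W'_def using f V(1) W by (simp add: continuous_map_def openin_Int)
    then have oW: "openin X (q ` W')"
      using local_homeo_open_map[OF q] open_map_def by blast
    have "openin E' ({u \<in> topspace E'. q' u \<in> q ` W'} \<inter> V)"
      using q' oW V(1) unfolding local_homeo_def continuous_map_def by blast
    moreover have "b \<in> {u \<in> topspace E'. q' u \<in> q ` W'} \<inter> V"
      using e eE fq V(2) \<open>f e \<in> topspace E'\<close> by (auto simp: W'_def)
    moreover have "{u \<in> topspace E'. q' u \<in> q ` W'} \<inter> V \<subseteq> f ` W"
    proof
      fix u assume u: "u \<in> {u \<in> topspace E'. q' u \<in> q ` W'} \<inter> V"
      then obtain w where w: "w \<in> W'" "q' u = q w" by blast
      then have "q' (f w) = q' u" "f w \<in> V" using fq by (auto simp: W'_def)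
      then have "f w = u" using inj u by (auto dest: inj_onD)
      then show "u \<in> f ` W" using w by (auto simp: W'_def)
    qed
    ultimately show "\<exists>T. openin E' T \<and> b \<in> T \<and> T \<subseteq> f ` W" by blast
  qed
qed

section \<open>Evenly covered sets and their sheets\<close>

text \<open>The inner condition of \<open>covering_map\<close> with the family of sheets as an
  argument, so that the sheet through a point can be named. The family may be empty, since coverings
  need not be surjective.\<close>

definition evenly_covered :: "'e topology \<Rightarrow> 'x topology \<Rightarrow> ('e \<Rightarrow> 'x) \<Rightarrow> 'x set \<Rightarrow> 'e set set \<Rightarrow> bool" where
  "evenly_covered E X q U \<V> \<longleftrightarrow> openin X U \<and> \<Union>\<V> = {e \<in> topspace E. q e \<in> U} \<and>
     (\<forall>V\<in>\<V>. openin E V) \<and> pairwise disjnt \<V> \<and>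
     (\<forall>V\<in>\<V>. homeomorphic_map (subtopology E V) (subtopology X U) q)"

lemma covering_map_evenly:
  assumes "covering_map E X q" "x \<in> topspace X"
  obtains U \<V> where "x \<in> U" "evenly_covered E X q U \<V>"
proof -
  have "\<exists>U. openin X U \<and> x \<in> U \<and>
        (\<exists>\<V>. \<Union>\<V> = {y \<in> topspace E. q y \<in> U} \<and> (\<forall>V\<in>\<V>. openin E V) \<and> pairwise disjnt \<V> \<and>
             (\<forall>V\<in>\<V>. homeomorphic_map (subtopology E V) (subtopology X U) q))"
    using assms by (simp add: covering_map_def)
  then show ?thesis
    by (elim exE conjE) (rule that, simp_all add: evenly_covered_def)
qed

lemma covering_mapI:
  assumes "continuous_map E X q"
    and ev: "\<And>x. x \<in> topspace X \<Longrightarrow> \<exists>U \<V>. x \<in> U \<and> evenly_covered E X q U \<V>"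
  shows "covering_map E X q"
  unfolding covering_map_def
proof (intro conjI ballI)
  fix x assume "x \<in> topspace X"
  then obtain U \<V> where U: "x \<in> U" "evenly_covered E X q U \<V>" using ev by metis
  show "\<exists>U. openin X U \<and> x \<in> U \<and>
        (\<exists>\<V>. \<Union>\<V> = {y \<in> topspace E. q y \<in> U} \<and> (\<forall>V\<in>\<V>. openin E V) \<and> pairwise disjnt \<V> \<and>
             (\<forall>V\<in>\<V>. homeomorphic_map (subtopology E V) (subtopology X U) q))"
    using U by (intro exI[of _ U] conjI exI[of _ \<V>]) (simp_all add: evenly_covered_def)
qed fact

lemma covering_map_continuous: "covering_map E X q \<Longrightarrow> continuous_map E X q"
  by (simp add: covering_map_def)

lemma continuous_map_in: "continuous_map E X q \<Longrightarrow> e \<in> topspace E \<Longrightarrow> q e \<in> topspace X"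
  by (auto simp: continuous_map_def)

lemma evenly_covered_sheet:
  assumes "evenly_covered E X q U \<V>" "V \<in> \<V>"
  shows "openin X U" "openin E V" "q ` V = U" "inj_on q V"
    "continuous_map (subtopology X U) E (inv_into V q)"
proof -
  show o: "openin X U" "openin E V" using assms by (auto simp: evenly_covered_def)
  have h: "homeomorphic_map (subtopology E V) (subtopology X U) q"
    using assms by (auto simp: evenly_covered_def)
  note * = homeomorphic_map_section[OF h openin_subset[OF o(2)] openin_subset[OF o(1)]]
  show "q ` V = U" "inj_on q V" using * by auto
  show "continuous_map (subtopology X U) E (inv_into V q)"
    by (rule continuous_map_into_fulltopology[OF *(3)])
qed

lemma evenly_covered_in_sheet:
  assumes "evenly_covered E X q U \<V>" "e \<in> topspace E" "q e \<in> U"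
  obtains V where "V \<in> \<V>" "e \<in> V"
proof -
  have "e \<in> \<Union>\<V>" using assms by (simp add: evenly_covered_def)
  then show ?thesis using that by blast
qed

lemma evenly_covered_unique:
  assumes "evenly_covered E X q U \<V>" "V \<in> \<V>" "V' \<in> \<V>" "e \<in> V" "e \<in> V'"
  shows "V = V'"
proof (rule ccontr)
  assume "V \<noteq> V'"
  then have "disjnt V V'" using assms(1-3) by (auto simp: evenly_covered_def dest: pairwiseD)
  then show False using assms(4,5) by (auto simp: disjnt_def)
qed

lemma covering_map_local_homeo:
  assumes "covering_map E X q"
  shows "local_homeo E X q"
  unfolding local_homeo_def
proof (intro conjI ballI)
  show c: "continuous_map E X q" using assms by (rule covering_map_continuous)
  fix e assume e: "e \<in> topspace E"
  then obtain U \<V> where U: "q e \<in> U" "evenly_covered E X q U \<V>"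
    using covering_map_evenly[OF assms] continuous_map_in[OF c] by metis
  then obtain V where V: "V \<in> \<V>" "e \<in> V" using evenly_covered_in_sheet e by metis
  note * = evenly_covered_sheet[OF U(2) V(1)]
  show "\<exists>V. openin E V \<and> e \<in> V \<and> openin X (q ` V) \<and>
        homeomorphic_map (subtopology E V) (subtopology X (q ` V)) q"
    using * V U unfolding evenly_covered_def by (intro exI[of _ V]) auto
qed

lemma openin_preimage: "continuous_map X Y f \<Longrightarrow> openin Y U \<Longrightarrow> openin X {x \<in> topspace X. f x \<in> U}"
  by (simp add: continuous_map_def)

lemma connected_space_clopenD:
  assumes "connected_space Z" "openin Z S" "openin Z (topspace Z - S)" "w \<in> S" "z \<in> topspace Z"
  shows "z \<in> S"
proof -
  have "closedin Z S" using assms openin_subset by (simp add: closedin_def)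
  then show ?thesis using assms by (auto simp: connected_space_clopen_in)
qed

text \<open>The set where a map into \<open>E\<close> meets a given sheet is clopen.\<close>
lemma connected_in_sheet:
  assumes ev: "evenly_covered E X q U \<V>" and V: "V \<in> \<V>"
    and Z: "connected_space Z" and h: "continuous_map Z E h"
    and U: "\<And>z. z \<in> topspace Z \<Longrightarrow> q (h z) \<in> U"
    and z0: "z0 \<in> topspace Z" "h z0 \<in> V" and z: "z \<in> topspace Z"
  shows "h z \<in> V"
proof -
  let ?S = "{z \<in> topspace Z. h z \<in> V}"
  have o: "openin Z ?S" using openin_preimage[OF h] evenly_covered_sheet(2)[OF ev V] by blast
  have o2: "openin E (\<Union>(\<V> - {V}))" using evenly_covered_sheet(2)[OF ev] by (intro openin_Union) auto
  have "topspace Z - ?S = {z \<in> topspace Z. h z \<in> \<Union>(\<V> - {V})}"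
  proof (intro equalityI subsetI)
    fix w assume w: "w \<in> topspace Z - ?S"
    then obtain V' where "V' \<in> \<V>" "h w \<in> V'"
      using evenly_covered_in_sheet[OF ev] U continuous_map_in[OF h] by (metis DiffD1)
    then show "w \<in> {z \<in> topspace Z. h z \<in> \<Union>(\<V> - {V})}" using w by auto
  next
    fix w assume "w \<in> {z \<in> topspace Z. h z \<in> \<Union>(\<V> - {V})}"
    then show "w \<in> topspace Z - ?S" using evenly_covered_unique[OF ev V] by auto
  qed
  then have "openin Z (topspace Z - ?S)" using openin_preimage[OF h o2] by simp
  from connected_space_clopenD[OF Z o this] show ?thesis using z0 z by blast
qed

section \<open>Uniqueness of lifts\<close>

text \<open>The coincidence set is clopen. Where the two values agree they share a sheet, on which
  \<open>q\<close> is injective; where they differ they lie in different, hence disjoint, sheets,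
  because they have the same image under \<open>q\<close>.\<close>

lemma unique_lift:
  assumes q: "covering_map E X q" and Z: "connected_space Z"
    and h: "continuous_map Z E h" and k: "continuous_map Z E k"
    and hk: "\<And>z. z \<in> topspace Z \<Longrightarrow> q (h z) = q (k z)"
    and w: "w \<in> topspace Z" "h w = k w" and z: "z \<in> topspace Z"
  shows "h z = k z"
proof -
  let ?S = "{z \<in> topspace Z. h z = k z}"
  \<comment> \<open>One dichotomy serves both halves: equal sheets give openness of the coincidence
    set, disjoint sheets openness of its complement.\<close>
  have *: "\<exists>V V'. openin E V \<and> openin E V' \<and> h v \<in> V \<and> k v \<in> V' \<and> inj_on q V \<and>
      (V = V' \<or> (V \<inter> V' = {} \<and> h v \<noteq> k v))" if v: "v \<in> topspace Z" for v
  proof -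
    have hw: "h v \<in> topspace E" "k v \<in> topspace E"
      using v continuous_map_in[OF h] continuous_map_in[OF k] by auto
    obtain U \<V> where U: "q (h v) \<in> U" "evenly_covered E X q U \<V>"
      using covering_map_evenly[OF q] continuous_map_in[OF covering_map_continuous[OF q] hw(1)] by metis
    obtain V where V: "V \<in> \<V>" "h v \<in> V" using evenly_covered_in_sheet[OF U(2) hw(1) U(1)] by metis
    obtain V' where V': "V' \<in> \<V>" "k v \<in> V'"
      using evenly_covered_in_sheet[OF U(2) hw(2)] U(1) hk[OF v] by metis
    show ?thesis
      using V V' evenly_covered_sheet[OF U(2) V(1)] evenly_covered_sheet[OF U(2) V'(1)]
        evenly_covered_unique[OF U(2) V(1) V'(1)] by (metis disjoint_iff)
  qed
  have "openin Z ?S"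
  proof (subst openin_subopen, intro ballI)
    fix v assume v: "v \<in> ?S"
    then obtain V where V: "openin E V" "h v \<in> V" "inj_on q V" "k v \<in> V"
      using *[of v] by auto
    have "openin Z ({z \<in> topspace Z. h z \<in> V} \<inter> {z \<in> topspace Z. k z \<in> V})"
      using openin_preimage[OF h V(1)] openin_preimage[OF k V(1)] by blast
    moreover have "{z \<in> topspace Z. h z \<in> V} \<inter> {z \<in> topspace Z. k z \<in> V} \<subseteq> ?S"
      using V(3) hk by (auto dest: inj_onD)
    ultimately show "\<exists>T. openin Z T \<and> v \<in> T \<and> T \<subseteq> ?S" using v V by blast
  qed
  moreover have "openin Z (topspace Z - ?S)"
  proof (subst openin_subopen, intro ballI)
    fix v assume v: "v \<in> topspace Z - ?S"
    then obtain V V' where V: "openin E V" "openin E V'" "h v \<in> V" "k v \<in> V'" "V \<inter> V' = {}"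
      using *[of v] hk[of v] by (auto dest: inj_onD)
    have "openin Z ({z \<in> topspace Z. h z \<in> V} \<inter> {z \<in> topspace Z. k z \<in> V'})"
      using openin_preimage[OF h V(1)] openin_preimage[OF k V(2)] by blast
    moreover have "{z \<in> topspace Z. h z \<in> V} \<inter> {z \<in> topspace Z. k z \<in> V'} \<subseteq> topspace Z - ?S"
      using V(5) by auto
    ultimately show "\<exists>T. openin Z T \<and> v \<in> T \<and> T \<subseteq> topspace Z - ?S" using v V by blast
  qed
  ultimately show ?thesis using connected_space_clopenD[OF Z, of ?S w z] w z by blast
qed

section \<open>Lifting paths and homotopies\<close>

lemma connected_space_interval: "connected_space (top_of_set {a..b::real})"
  by (simp add: connected_space_subtopology connectedin_iff_connected)

lemma interval_nhd:
  fixes t :: real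
  assumes "openin (top_of_set {0..1}) S" "t \<in> S"
  obtains e where "e > 0" "{0..1} \<inter> ball t e \<subseteq> S"
proof -
  obtain O' where O': "open O'" "S = {0..1} \<inter> O'" using assms(1) by (auto simp: openin_open)
  then obtain e where "e > 0" "ball t e \<subseteq> O'" using assms(2) open_contains_ball by blast
  then show ?thesis using that O' by blast
qed

text \<open>Connectedness of the unit interval takes the place of a subdivision with a Lebesgue
  number: liftability up to \<open>t\<close> is a property that passes between any two times whose
  images lie near each other in one evenly covered set.\<close>

lemma path_lifting:
  assumes q: "covering_map E X q" and g: "continuous_map (top_of_set {0..1::real}) X g"
    and e: "e \<in> topspace E" "q e = g 0"
  obtains h where "continuous_map (top_of_set {0..1::real}) E h" "h 0 = e"
    "\<And>t. t \<in> {0..1} \<Longrightarrow> q (h t) = g t"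
proof -
  define P where "P t \<longleftrightarrow> (\<exists>h. continuous_map (top_of_set {0..t::real}) E h \<and> h 0 = e \<and>
      (\<forall>s\<in>{0..t}. q (h s) = g s))" for t
  have "P 1"
  proof (rule connected_induction_simple[of "{0..1::real}" 0 1 P])
    show "connected {0..1::real}" "0 \<in> {0..1::real}" "1 \<in> {0..1::real}" by auto
    have "continuous_map (top_of_set {0..0::real}) E (\<lambda>_. e)" using e by auto
    then show "P 0" unfolding P_def using e by (intro exI[of _ "\<lambda>_. e"]) auto
    fix t :: real assume t: "t \<in> {0..1}"
    then have "g t \<in> topspace X" using continuous_map_in[OF g] by auto
    then obtain U \<V> where U: "g t \<in> U" "evenly_covered E X q U \<V>"
      using covering_map_evenly[OF q] by metis
    then have "openin X U" by (simp add: evenly_covered_def)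
    then have "openin (top_of_set {0..1}) {t \<in> {0..1}. g t \<in> U}"
      using openin_preimage[OF g] by simp
    then obtain r where r: "r > 0" "{0..1} \<inter> ball t r \<subseteq> {t \<in> {0..1}. g t \<in> U}"
      using interval_nhd[of _ t] t U(1) by (metis (no_types, lifting) mem_Collect_eq)
    \<comment> \<open>Downwards the lift is restricted; upwards it is prolonged by the section of
      the sheet that it has reached at time \<open>a\<close>.\<close>
    have step: "P b" if a: "a \<in> {0..1} \<inter> ball t r" and b: "b \<in> {0..1} \<inter> ball t r" and Pa: "P a" for a b
    proof -
      obtain h where h: "continuous_map (top_of_set {0..a}) E h" "h 0 = e" "\<forall>s\<in>{0..a}. q (h s) = g s"
        using Pa P_def by blast
      show "P b"
      proof (cases "b \<le> a")
        case True
        then have "{0..b} \<subseteq> {0..a}" by auto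
        then have "continuous_map (top_of_set {0..b}) E h"
          using continuous_map_from_subtopology_mono[OF h(1)] by simp
        then show ?thesis unfolding P_def using h \<open>{0..b} \<subseteq> {0..a}\<close> by blast
      next
        case False
        have seg: "{a..b} \<subseteq> {0..1} \<inter> ball t r"
          using a b by (auto simp: dist_real_def)
        have ha: "h a \<in> topspace E" using h(1) a continuous_map_in by fastforce
        have qa: "q (h a) = g a" using h(3) a by auto
        then have "q (h a) \<in> U" using a r(2) by auto
        then obtain V where V: "V \<in> \<V>" "h a \<in> V" using evenly_covered_in_sheet[OF U(2) ha] by metis
        note sh = evenly_covered_sheet[OF U(2) V(1)]
        \<comment> \<open>The two pieces agree at \<open>a\<close> because \<open>h a\<close> lies
          in \<open>V\<close>, where the section inverts \<open>q\<close>.\<close>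
        define k where "k = (\<lambda>s. if s \<le> a then h s else inv_into V q (g s))"
        have gU: "g s \<in> U" if "s \<in> {a..b}" for s using seg r(2) that by blast
        have "continuous_map (top_of_set {a..b}) X g"
          using continuous_map_from_subtopology_mono[OF g] seg by auto
        then have "continuous_map (top_of_set {a..b}) (subtopology X U) g"
          using gU by (simp add: continuous_map_in_subtopology)
        from continuous_map_compose[OF this sh(5)] have c2: "continuous_map (top_of_set {a..b}) E (\<lambda>s. inv_into V q (g s))"
          by (simp add: o_def)
        have "continuous_map (top_of_set {0..b}) E k"
          unfolding k_def
        proof (rule continuous_map_cases_le)
          show "continuous_map (top_of_set {0..b}) euclideanreal (\<lambda>s. s)"
            "continuous_map (top_of_set {0..b}) euclideanreal (\<lambda>s. a)"
            by auto
          have "{0..b} \<inter> {x \<in> topspace (top_of_set {0..b}). x \<le> a} = {0..a}"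
            "{0..b} \<inter> {x \<in> topspace (top_of_set {0..b}). a \<le> x} = {a..b}"
            using False a by auto
          then show "continuous_map (subtopology (top_of_set {0..b}) {x \<in> topspace (top_of_set {0..b}). x \<le> a}) E h"
            "continuous_map (subtopology (top_of_set {0..b}) {x \<in> topspace (top_of_set {0..b}). a \<le> x}) E
              (\<lambda>s. inv_into V q (g s))"
            using h(1) c2 by (simp_all add: subtopology_subtopology)
          show "h s = inv_into V q (g s)" if "s = a" for s
            using that qa V(2) sh(4) by (metis inv_into_f_f)
        qed
        moreover have "k 0 = e" using a h(2) by (simp add: k_def)
        moreover have "q (k s) = g s" if "s \<in> {0..b}" for s
          using that h(3) sh(3) gU[of s] by (auto simp: k_def f_inv_into_f)
        ultimately show ?thesis unfolding P_def by blast
      qed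
    qed
    show "\<exists>T. openin (top_of_set {0..1}) T \<and> t \<in> T \<and> (\<forall>x\<in>T. \<forall>y\<in>T. P x \<longrightarrow> P y)"
    proof (intro exI conjI ballI impI)
      show "openin (top_of_set {0..1}) ({0..1} \<inter> ball t r)" by (rule openin_open_Int) simp
      show "t \<in> {0..1} \<inter> ball t r" using t r(1) by simp
    qed (rule step)
  qed
  then show ?thesis using that unfolding P_def by blast
qed

text \<open>Continuity of the lifted family spreads along each path inside one sheet at a time.\<close>
lemma lift_family_continuous:
  assumes q: "covering_map E X q"
    and H: "continuous_map (prod_topology Z (top_of_set {0..1::real})) X (\<lambda>(z, t). H z t)"
    and h: "\<And>z. z \<in> topspace Z \<Longrightarrow> continuous_map (top_of_set {0..1::real}) E (h z)"
    and qh: "\<And>z t. z \<in> topspace Z \<Longrightarrow> t \<in> {0..1} \<Longrightarrow> q (h z t) = H z t"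
    and h0: "continuous_map Z E (\<lambda>z. h z 0)"
    and b: "b \<in> {0..1}"
  shows "continuous_map Z E (\<lambda>z. h z b)"
proof -
  \<comment> \<open>Continuity at the single point \<open>z0\<close>, at the single time
    \<open>t\<close>. With \<open>z0\<close> fixed this is a property of \<open>t\<close> alone, so
    connected induction along the path applies, and the neighbourhood of \<open>z0\<close> may
    shrink at each step.\<close>
  define C where "C z0 t \<longleftrightarrow> (\<forall>W. openin E W \<and> h z0 t \<in> W \<longrightarrow>
      (\<exists>N. openin Z N \<and> z0 \<in> N \<and> (\<forall>z\<in>N. h z t \<in> W)))" for z0 t
  have all: "C z0 b" if z0: "z0 \<in> topspace Z" for z0
  proof (rule connected_induction_simple[of "{0..1::real}" 0 b "C z0"])
    show "connected {0..1::real}" "0 \<in> {0..1::real}" "b \<in> {0..1::real}" using b by auto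
    show "C z0 0" unfolding C_def
    proof (intro allI impI)
      fix W assume "openin E W \<and> h z0 0 \<in> W"
      then show "\<exists>N. openin Z N \<and> z0 \<in> N \<and> (\<forall>z\<in>N. h z 0 \<in> W)"
        using openin_preimage[OF h0, of W] z0
        by (intro exI[of _ "{z \<in> topspace Z. h z 0 \<in> W}"]) auto
    qed
    fix t :: real assume t: "t \<in> {0..1}"
    have "H z0 t \<in> topspace X"
      using continuous_map_in[OF H, of "(z0, t)"] z0 t by simp
    then obtain U \<V> where U: "H z0 t \<in> U" "evenly_covered E X q U \<V>"
      using covering_map_evenly[OF q] by metis
    then have "openin X U" by (simp add: evenly_covered_def)
    then have "openin (prod_topology Z (top_of_set {0..1::real}))
        {w \<in> topspace (prod_topology Z (top_of_set {0..1})). (\<lambda>(z, t). H z t) w \<in> U}"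
      using openin_preimage[OF H] by blast
    moreover have "(z0, t) \<in> {w \<in> topspace (prod_topology Z (top_of_set {0..1})). (\<lambda>(z, t). H z t) w \<in> U}"
      using U(1) z0 t by simp
    ultimately have "\<exists>N S. openin Z N \<and> openin (top_of_set {0..1}) S \<and> z0 \<in> N \<and> t \<in> S \<and>
      N \<times> S \<subseteq> {w \<in> topspace (prod_topology Z (top_of_set {0..1})). (\<lambda>(z, t). H z t) w \<in> U}"
      unfolding openin_prod_topology_alt by blast
    then obtain N S where NS: "openin Z N" "openin (top_of_set {0..1}) S" "z0 \<in> N" "t \<in> S"
      "N \<times> S \<subseteq> {w \<in> topspace (prod_topology Z (top_of_set {0..1})). (\<lambda>(z, t). H z t) w \<in> U}"
      by (elim exE conjE)
    obtain r where r: "r > 0" "{0..1} \<inter> ball t r \<subseteq> S"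
      using interval_nhd[OF NS(2,4)] .
    let ?J = "{0..1} \<inter> ball t r"
    have NZ: "N \<subseteq> topspace Z" using openin_subset[OF NS(1)] .
    have HU: "H z s \<in> U" if "z \<in> N" "s \<in> ?J" for z s
    proof -
      have "s \<in> S" by (rule subsetD[OF r(2) that(2)])
      with that(1) have "(z, s) \<in> N \<times> S" by (rule SigmaI)
      from subsetD[OF NS(5) this] show ?thesis by simp
    qed
    have J: "connected_space (top_of_set ?J)"
    proof -
      have "connected ?J" by (intro convex_connected convex_Int) auto
      then show ?thesis by (intro connected_space_subtopology) (simp only: connectedin_iff_connected)
    qed
    have hJ: "continuous_map (top_of_set ?J) E (h z)" if "z \<in> N" for z
      using continuous_map_from_subtopology_mono[OF h] that NZ by blast
    have step: "C z0 s'" if s: "s \<in> ?J" and s': "s' \<in> ?J" and Cs: "C z0 s" for s s'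
      unfolding C_def
    proof (intro allI impI)
      fix W assume W: "openin E W \<and> h z0 s' \<in> W"
      have "h z0 s \<in> topspace E" using continuous_map_in[OF hJ[OF NS(3)]] s by auto
      moreover have "q (h z0 s) \<in> U" using qh[OF z0] HU[OF NS(3) s] s by auto
      ultimately obtain V where V: "V \<in> \<V>" "h z0 s \<in> V" using evenly_covered_in_sheet[OF U(2)] by metis
      note sh = evenly_covered_sheet[OF U(2) V(1)]
      obtain N' where N': "openin Z N'" "z0 \<in> N'" "\<forall>z\<in>N'. h z s \<in> V"
        using Cs V(2) sh(2) unfolding C_def by blast
      \<comment> \<open>A neighbouring path that is in \<open>V\<close> at time \<open>s\<close>
        stays in \<open>V\<close> over the whole interval, since its image stays in
        \<open>U\<close>. At time \<open>s'\<close> it is therefore given by the section of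
        \<open>V\<close>, which is continuous in \<open>z\<close>.\<close>
      have inV: "h z s' \<in> V" if "z \<in> N \<inter> N'" for z
      proof (rule connected_in_sheet[OF U(2) V(1) J hJ, of z])
        show "z \<in> N" using that by blast
        show "q (h z w) \<in> U" if "w \<in> topspace (top_of_set ?J)" for w
          using that HU qh[of z w] NZ \<open>z \<in> N\<close> by auto
        show "s \<in> topspace (top_of_set ?J)" "s' \<in> topspace (top_of_set ?J)" using s s' by auto
        show "h z s \<in> V" using N' \<open>z \<in> N \<inter> N'\<close> by blast
      qed
      have form: "h z s' = inv_into V q (H z s')" if "z \<in> N \<inter> N'" for z
        using inV[OF that] qh[of z s'] NZ that s' sh(4)
        by (metis IntE in_mono inv_into_f_f)
      have "continuous_map (subtopology Z N) (prod_topology Z (top_of_set {0..1::real})) (\<lambda>z. (z, s'))"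
        using s' by (intro continuous_map_pairedI)
           (auto simp: continuous_map_from_subtopology)
      from continuous_map_compose[OF this H] have "continuous_map (subtopology Z N) X (\<lambda>z. H z s')"
        by (simp add: o_def)
      then have "continuous_map (subtopology Z N) (subtopology X U) (\<lambda>z. H z s')"
        using HU s' by (auto simp: continuous_map_in_subtopology)
      from continuous_map_compose[OF this sh(5)] have c: "continuous_map (subtopology Z N) E (\<lambda>z. inv_into V q (H z s'))"
        by (simp add: o_def)
      let ?N = "{z \<in> N. inv_into V q (H z s') \<in> W} \<inter> N'"
      have "openin (subtopology Z N) {z \<in> N. inv_into V q (H z s') \<in> W}"
        using openin_preimage[OF c, of W] W NZ by (simp add: Int_absorb1)
      then have "openin Z ?N" using NS(1) N'(1) openin_trans_full by blast
      moreover have "z0 \<in> ?N" using NS(3) N'(2) W form[of z0] by auto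
      moreover have "\<forall>z\<in>?N. h z s' \<in> W" using form by auto
      ultimately show "\<exists>N. openin Z N \<and> z0 \<in> N \<and> (\<forall>z\<in>N. h z s' \<in> W)" by blast
    qed
    show "\<exists>T. openin (top_of_set {0..1}) T \<and> t \<in> T \<and> (\<forall>x\<in>T. \<forall>y\<in>T. C z0 x \<longrightarrow> C z0 y)"
    proof (intro exI conjI ballI impI)
      show "openin (top_of_set {0..1}) ?J" by (rule openin_open_Int) simp
      show "t \<in> ?J" using t r(1) by simp
    qed (rule step)
  qed
  show ?thesis
    unfolding continuous_map_def
  proof (intro conjI allI impI)
    show "(\<lambda>z. h z b) \<in> topspace Z \<rightarrow> topspace E" using continuous_map_in[OF h] b by auto
    fix W assume W: "openin E W"
    show "openin Z {z \<in> topspace Z. h z b \<in> W}"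
    proof (subst openin_subopen, intro ballI)
      fix z0 assume z0: "z0 \<in> {z \<in> topspace Z. h z b \<in> W}"
      then obtain N where "openin Z N" "z0 \<in> N" "\<forall>z\<in>N. h z b \<in> W"
        using all[of z0] W unfolding C_def by blast
      then show "\<exists>T. openin Z T \<and> z0 \<in> T \<and> T \<subseteq> {z \<in> topspace Z. h z b \<in> W}"
        using openin_subset by blast
    qed
  qed
qed

text \<open>The null-homotopy of \<open>g\<close>, pushed to \<open>X\<close> by \<open>f\<close>,
  is lifted one row at a time, always from \<open>d 0\<close>. The ends of the rows form a lift of a
  constant path, so they coincide; the row at time 0 is \<open>d\<close> and the row at time 1 is
  constant.\<close>

lemma loop_lift_closed:
  assumes q: "covering_map E X q" and T: "simply_connected_space T" and f: "continuous_map T X f"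
    and g: "pathin T g" "g 0 = g 1" and d: "pathin E d" "\<And>t. t \<in> {0..1} \<Longrightarrow> q (d t) = f (g t)"
  shows "d 0 = d 1"
proof -
  obtain H where H: "continuous_map (prod_topology (top_of_set {0..1::real}) (top_of_set {0..1::real})) T H"
    "\<And>t. H (0, t) = g t" "\<And>t. H (1, t) = g 0"
    "\<And>s. s \<in> {0..1} \<Longrightarrow> H (s, 0) = g 0 \<and> H (s, 1) = g 0"
    using T g unfolding simply_connected_space_def homotopic_with_def by metis
  let ?I = "top_of_set {0..1::real}"
  have dc: "continuous_map ?I E d" using d(1) by (simp add: pathin_def)
  have fH: "continuous_map (prod_topology ?I ?I) X (\<lambda>(s, t). f (H (s, t)))"
    using continuous_map_compose[OF H(1) f] by (simp add: o_def case_prod_unfold)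
  have d0: "d 0 \<in> topspace E" "q (d 0) = f (g 0)" using continuous_map_in[OF dc] d(2) by auto
  have "\<exists>k. continuous_map ?I E k \<and> k 0 = d 0 \<and> (\<forall>t\<in>{0..1}. q (k t) = f (H (s, t)))"
    if s: "s \<in> {0..1}" for s
  proof -
    have "continuous_map ?I (prod_topology ?I ?I) (\<lambda>t. (s, t))"
      using s by (intro continuous_map_pairedI) auto
    from continuous_map_compose[OF this fH] have "continuous_map ?I X (\<lambda>t. f (H (s, t)))"
      by (simp add: o_def)
    then show ?thesis
      using path_lifting[OF q _ d0(1)] H(4)[OF s] d0(2) by metis
  qed
  then obtain k where k: "\<And>s. s \<in> {0..1} \<Longrightarrow> continuous_map ?I E (k s) \<and> k s 0 = d 0 \<and>
      (\<forall>t\<in>{0..1}. q (k s t) = f (H (s, t)))" by metis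
  have cont: "continuous_map ?I E (\<lambda>s. k s 1)"
  proof (rule lift_family_continuous[OF q fH])
    show "continuous_map ?I E (\<lambda>z. k z 0)"
      by (rule continuous_map_eq[of _ _ "\<lambda>_. d 0"]) (use k d0 in auto)
  qed (use k in auto)
  \<comment> \<open>The homotopy fixes the end of the loop, so all these points lie over
    \<open>f (g 0)\<close>.\<close>
  have const: "k s 1 = k 0 1" if "s \<in> {0..1}" for s
  proof (rule unique_lift[where h = "\<lambda>s. k s 1" and k = "\<lambda>_. k 0 1" and w = 0 and z = s,
        OF q connected_space_interval cont])
    show "continuous_map ?I E (\<lambda>_. k 0 1)" using continuous_map_in[OF cont] by auto
    show "q (k z 1) = q (k 0 1)" if "z \<in> topspace ?I" for z
      using k[of z] k[of 0] that H(4)[of z] H(4)[of 0] by auto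
  qed (use that in auto)
  have "k 0 1 = d 1"
  proof (rule unique_lift[where h = "k 0" and k = d and w = 0 and z = 1,
        OF q connected_space_interval _ dc])
    show "continuous_map ?I E (k 0)" using k by auto
    show "q (k 0 z) = q (d z)" if "z \<in> topspace ?I" for z using k[of 0] d(2) H(2) that by auto
    show "k 0 0 = d 0" using k by auto
  qed auto
  moreover have "k 1 1 = d 0"
  proof (rule unique_lift[where h = "k 1" and k = "\<lambda>_. d 0" and w = 0 and z = 1,
        OF q connected_space_interval])
    show "continuous_map ?I E (k 1)" using k by auto
    show "continuous_map ?I E (\<lambda>_. d 0)" using d0 by auto
    show "q (k 1 z) = q (d 0)" if "z \<in> topspace ?I" for z using k[of 1] d0(2) H(3) that by auto
    show "k 1 0 = d 0" using k by auto
  qed auto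
  ultimately show ?thesis using const[of 1] by simp
qed

lemma locally_path_connected_nhd:
  assumes "locally_path_connected_space T" "openin T W" "z \<in> W"
  obtains N where "openin T N" "path_connectedin T N" "z \<in> N" "N \<subseteq> W"
proof -
  have "\<exists>U V. openin T U \<and> (openin T V \<and> path_connectedin T V) \<and> z \<in> U \<and> U \<subseteq> V \<and> V \<subseteq> W"
    using assms unfolding locally_path_connected_space_alt neighbourhood_base_of by simp
  then show ?thesis using that by (elim exE conjE) (rule that, auto)
qed

section \<open>The lifting criterion for simply connected spaces\<close>

text \<open>The graph of the lift is the path component of \<open>(z0, e)\<close> in the fibre
  product of \<open>f\<close> and \<open>q\<close>. Path lifting makes it total,
  \<open>loop_lift_closed\<close> makes it single-valued, and local path connectedness makes the
  resulting function continuous.\<close>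

lemma lift_exists:
  assumes q: "covering_map E X q" and T: "simply_connected_space T"
    and lpc: "locally_path_connected_space T" and f: "continuous_map T X f"
    and z0: "z0 \<in> topspace T" and e: "e \<in> topspace E" "q e = f z0"
  obtains h where "continuous_map T E h" "h z0 = e" "\<And>z. z \<in> topspace T \<Longrightarrow> q (h z) = f z"
proof -
  define P where "P = subtopology (prod_topology T E) {(z, u). f z = q u}"
  define R where "R z u \<longleftrightarrow> path_component_of P (z0, e) (z, u)" for z u
  \<comment> \<open>A path in the fibre product between two points over the same \<open>z\<close>
    projects to a loop in \<open>T\<close> and to a lift of that loop in \<open>E\<close>.\<close>
  have uniq: "u = u'" if "R z u" "R z u'" for z u u'
  proof -
    have "path_component_of P (z, u) (z, u')"
      using that path_component_of_sym path_component_of_trans unfolding R_def by metis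
    then obtain g where g: "pathin P g" "g 0 = (z, u)" "g 1 = (z, u')"
      unfolding path_component_of_def by blast
    then have gc: "continuous_map (top_of_set {0..1}) (prod_topology T E) g"
      and gP: "\<And>t. t \<in> {0..1} \<Longrightarrow> f (fst (g t)) = q (snd (g t))"
      unfolding P_def pathin_def continuous_map_in_subtopology by (auto simp: case_prod_unfold)
    have "pathin T (\<lambda>t. fst (g t))" "pathin E (\<lambda>t. snd (g t))"
      using gc unfolding pathin_def continuous_map_pairwise by (simp_all add: o_def)
    then show ?thesis
      using loop_lift_closed[OF q T f, of "\<lambda>t. fst (g t)" "\<lambda>t. snd (g t)"] g gP by simp
  qed
  have RE: "z \<in> topspace T" "u \<in> topspace E" "q u = f z" if "R z u" for z u
    using path_component_in_topspace[OF that[unfolded R_def]] by (auto simp: P_def)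
  have ex: "\<exists>u. R z u" if z: "z \<in> topspace T" for z
  proof -
    obtain g where g: "pathin T g" "g 0 = z0" "g 1 = z"
      using T z z0 unfolding simply_connected_space_def path_connected_space_def by blast
    then have gc: "continuous_map (top_of_set {0..1}) T g" by (simp add: pathin_def)
    have "continuous_map (top_of_set {0..1}) X (\<lambda>t. f (g t))"
      using continuous_map_compose[OF gc f] by (simp add: o_def)
    then obtain d where d: "continuous_map (top_of_set {0..1}) E d" "d 0 = e"
        "\<And>t. t \<in> {0..1} \<Longrightarrow> q (d t) = f (g t)"
      using path_lifting[OF q _ e(1)] e(2) g(2) by metis
    have "pathin P (\<lambda>t. (g t, d t))"
      unfolding P_def pathin_def continuous_map_in_subtopology
      using gc d by (auto simp: continuous_map_paired)
    then show ?thesis unfolding R_def path_component_of_def using g d(2)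
      by (intro exI[of _ "d 1"] exI[of _ "\<lambda>t. (g t, d t)"]) auto
  qed
  define h where "h z = (THE u. R z u)" for z
  have hR: "R z (h z)" if "z \<in> topspace T" for z
    unfolding h_def using ex[OF that] uniq by (metis theI)
  have hq: "q (h z) = f z" if "z \<in> topspace T" for z using RE(3) hR that by blast
  have "(z0, e) \<in> topspace P" using z0 e by (simp add: P_def)
  then have "R z0 e" by (simp add: R_def path_component_of_refl)
  then have h0: "h z0 = e" using uniq hR z0 by blast
  have "continuous_map T E h"
    unfolding continuous_map_def
  proof (intro conjI allI impI)
    show "h \<in> topspace T \<rightarrow> topspace E" using RE(2) hR by blast
    fix W assume W: "openin E W"
    show "openin T {z \<in> topspace T. h z \<in> W}"
    proof (subst openin_subopen, intro ballI)
      fix z assume z: "z \<in> {z \<in> topspace T. h z \<in> W}"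
      then have "f z \<in> topspace X" using continuous_map_in[OF f] by auto
      then obtain U \<V> where U: "f z \<in> U" "evenly_covered E X q U \<V>"
        using covering_map_evenly[OF q] by metis
      have "h z \<in> topspace E" "q (h z) \<in> U" using RE(2) hR z hq U by auto
      then obtain V where V: "V \<in> \<V>" "h z \<in> V" using evenly_covered_in_sheet[OF U(2)] by metis
      note sh = evenly_covered_sheet[OF U(2) V(1)]
      let ?O = "{w \<in> topspace T. f w \<in> U}"
      have "openin T ?O" "z \<in> ?O" using openin_preimage[OF f sh(1)] z U(1) by auto
      from locally_path_connected_nhd[OF lpc this]
      obtain N where N: "openin T N" "path_connectedin T N" "z \<in> N" "N \<subseteq> ?O" .
      have "continuous_map (subtopology T N) X f" using f continuous_map_from_subtopology by blast
      then have "continuous_map (subtopology T N) (subtopology X U) f"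
        using N(4) by (auto simp: continuous_map_in_subtopology)
      from continuous_map_compose[OF this sh(5)] have c: "continuous_map (subtopology T N) E (\<lambda>w. inv_into V q (f w))"
        by (simp add: o_def)
      have hz: "inv_into V q (f z) = h z"
        using hq z V(2) sh(4) by (metis (no_types, lifting) inv_into_f_f mem_Collect_eq)
      \<comment> \<open>Over a path connected neighbourhood the graph of the section of
        \<open>V\<close> is path connected and contains \<open>(z, h z)\<close>, so it lies in the
        chosen component.\<close>
      have hw: "h w = inv_into V q (f w)" if w: "w \<in> N" for w
      proof -
        have s: "continuous_map (subtopology T N) P (\<lambda>w. (w, inv_into V q (f w)))"
          unfolding P_def continuous_map_in_subtopology
          using c N(4) sh(3) by (auto simp: continuous_map_paired f_inv_into_f continuous_map_from_subtopology)
        obtain g where g: "pathin (subtopology T N) g" "g 0 = z" "g 1 = w"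
        proof -
          have "path_connected_space (subtopology T N)" "topspace (subtopology T N) = N"
            using N(2) by (auto simp: path_connectedin_def)
          then show ?thesis using that N(3) w by (auto simp: path_connected_space_def)
        qed
        have "pathin P ((\<lambda>w. (w, inv_into V q (f w))) \<circ> g)"
          using pathin_compose[OF g(1) s] .
        then have "path_component_of P (z, h z) (w, inv_into V q (f w))"
          unfolding path_component_of_def using g hz
          by (intro exI[of _ "(\<lambda>w. (w, inv_into V q (f w))) \<circ> g"]) auto
        then have "R w (inv_into V q (f w))"
          using path_component_of_trans[OF hR[of z, unfolded R_def]] z unfolding R_def by simp
        moreover have "w \<in> topspace T" using N(4) w by auto
        ultimately show ?thesis using uniq[OF hR[of w]] by simp
      qed
      have "openin (subtopology T N) {w \<in> N. inv_into V q (f w) \<in> W}"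
        using openin_preimage[OF c W] openin_subset[OF N(1)] by (simp add: Int_absorb1)
      then have "openin T {w \<in> N. inv_into V q (f w) \<in> W}" using N(1) openin_trans_full by blast
      moreover have "z \<in> {w \<in> N. inv_into V q (f w) \<in> W}" using N(3) hz z by auto
      moreover have "{w \<in> N. inv_into V q (f w) \<in> W} \<subseteq> {z \<in> topspace T. h z \<in> W}"
        using hw N(4) by auto
      ultimately show "\<exists>S. openin T S \<and> z \<in> S \<and> S \<subseteq> {z \<in> topspace T. h z \<in> W}" by blast
    qed
  qed
  then show ?thesis using that h0 hq by blast
qed

section \<open>Surjectivity and separation for coverings\<close>

text \<open>The image is open, and so is its complement: one sheet over \<open>U\<close> already
  maps onto all of \<open>U\<close>.\<close>

lemma covering_map_surj:
  assumes q: "covering_map E X q" and X: "connected_space X" and E: "topspace E \<noteq> {}"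
  shows "q ` topspace E = topspace X"
proof -
  note c = covering_map_continuous[OF q]
  have "openin X (q ` topspace E)"
    using local_homeo_open_map[OF covering_map_local_homeo[OF q]] unfolding open_map_def by blast
  moreover have "openin X (topspace X - q ` topspace E)"
  proof (subst openin_subopen, intro ballI)
    fix x assume x: "x \<in> topspace X - q ` topspace E"
    then obtain U \<V> where U: "x \<in> U" "evenly_covered E X q U \<V>"
      using covering_map_evenly[OF q, of x] by auto
    have "U \<inter> q ` topspace E = {}"
    proof (rule ccontr)
      assume "U \<inter> q ` topspace E \<noteq> {}"
      then obtain e where e: "e \<in> topspace E" "q e \<in> U" by blast
      then obtain V where V: "V \<in> \<V>" "e \<in> V" using evenly_covered_in_sheet[OF U(2)] by metis
      note sh = evenly_covered_sheet[OF U(2) V(1)]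
      show False using sh(3) U(1) x openin_subset[OF sh(2)] by blast
    qed
    moreover have "openin X U" using U(2) by (simp add: evenly_covered_def)
    ultimately show "\<exists>T. openin X T \<and> x \<in> T \<and> T \<subseteq> topspace X - q ` topspace E"
      using U(1) openin_subset[of X U] by (intro exI[of _ U]) auto
  qed
  moreover obtain e where "e \<in> topspace E" using E by blast
  ultimately have "topspace X \<subseteq> q ` topspace E"
    using connected_space_clopenD[OF X, of "q ` topspace E" "q e"] by (intro subsetI) auto
  then show ?thesis using continuous_map_image_subset_topspace[OF c] by blast
qed

text \<open>Points of different fibres are separated in \<open>X\<close>, points of one fibre by
  their sheets. This is how the quotient topology is seen to be Hausdorff.\<close>

lemma covering_map_Hausdorff:
  assumes q: "covering_map E X q" and X: "Hausdorff_space X"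
  shows "Hausdorff_space E"
  unfolding Hausdorff_space_def
proof (intro allI impI, elim conjE)
  fix a b assume ab: "a \<in> topspace E" "b \<in> topspace E" "a \<noteq> b"
  note c = covering_map_continuous[OF q]
  have qab: "q a \<in> topspace X" "q b \<in> topspace X" using ab continuous_map_in[OF c] by auto
  show "\<exists>U V. openin E U \<and> openin E V \<and> a \<in> U \<and> b \<in> V \<and> disjnt U V"
  proof (cases "q a = q b")
    case False
    then obtain U V where UV: "openin X U" "openin X V" "q a \<in> U" "q b \<in> V" "disjnt U V"
      using X qab unfolding Hausdorff_space_def by blast
    show ?thesis
      by (intro exI[of _ "{e \<in> topspace E. q e \<in> U}"] exI[of _ "{e \<in> topspace E. q e \<in> V}"])
        (use UV ab openin_preimage[OF c] in \<open>auto simp: disjnt_def\<close>)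
  next
    case True
    obtain U \<V> where U: "q a \<in> U" "evenly_covered E X q U \<V>"
      using covering_map_evenly[OF q qab(1)] by metis
    obtain V where V: "V \<in> \<V>" "a \<in> V" using evenly_covered_in_sheet[OF U(2) ab(1) U(1)] by metis
    obtain V' where V': "V' \<in> \<V>" "b \<in> V'" using evenly_covered_in_sheet[OF U(2) ab(2)] U(1) True by metis
    have "V \<noteq> V'" using V V' True ab(3) evenly_covered_sheet(4)[OF U(2) V(1)] by (auto dest: inj_onD)
    then show ?thesis
      using V V' evenly_covered_sheet(2)[OF U(2)] evenly_covered_unique[OF U(2) V(1) V'(1)]
      by (intro exI[of _ V] exI[of _ V']) (auto simp: disjnt_def)
  qed
qed

section \<open>Charts and holomorphic maps\<close>

lemma is_chartD:
  assumes "is_chart T (U, \<phi>)"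
  shows "openin T U" "open (\<phi> ` U)" "inj_on \<phi> U"
    "homeomorphic_map (subtopology T U) (top_of_set (\<phi> ` U)) \<phi>"
  using assms openin_subset[of T U]
  by (auto simp: is_chart_def homeomorphic_eq_everything_map Int_absorb1)

lemma is_chart_open_image:
  assumes c: "is_chart T (U, \<phi>)" and W: "openin T W" "W \<subseteq> U"
  shows "open (\<phi> ` W)"
proof -
  have "open_map (subtopology T U) (top_of_set (\<phi> ` U)) \<phi>"
    using is_chartD(4)[OF c] homeomorphic_imp_open_map by blast
  moreover have "openin (subtopology T U) W"
    using W is_chartD(1)[OF c] by (simp add: openin_open_subtopology)
  ultimately have "openin (top_of_set (\<phi> ` U)) (\<phi> ` W)" by (simp add: open_map_def)
  then show ?thesis using is_chartD(2)[OF c] openin_open_trans by blast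
qed

lemma is_chart_open_preimage:
  assumes c: "is_chart T (U, \<phi>)" and D: "open D"
  shows "openin T {u \<in> U. \<phi> u \<in> D}"
proof -
  have U: "topspace (subtopology T U) = U" using openin_subset[OF is_chartD(1)[OF c]] by auto
  have "continuous_map (subtopology T U) (top_of_set (\<phi> ` U)) \<phi>"
    using is_chartD(4)[OF c] homeomorphic_imp_continuous_map by blast
  then have "continuous_map (subtopology T U) euclidean \<phi>"
    using continuous_map_into_fulltopology by blast
  from openin_preimage[OF this, of D] D have "openin (subtopology T U) {u \<in> U. \<phi> u \<in> D}"
    unfolding U by simp
  then show ?thesis using is_chartD(1)[OF c] openin_trans_full by blast
qed

lemma is_chart_inv:
  assumes "is_chart T (U, \<phi>)" "y \<in> U"
  shows "inv_into U \<phi> (\<phi> y) = y"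
  using is_chartD(3)[OF assms(1)] assms(2) by (rule inv_into_f_f)

definition charted :: "'a surface \<Rightarrow> bool" where
  "charted S \<longleftrightarrow> (\<forall>c\<in>surf_charts S. is_chart (surf_top S) c)"

text \<open>Compatibility of the charts is not needed for most of what follows, and dropping it makes
  conjugation of the charts harmless.\<close>
definition charted_cover :: "'a surface \<Rightarrow> bool" where
  "charted_cover S \<longleftrightarrow> charted S \<and> (\<forall>y\<in>points S. \<exists>U \<phi>. (U, \<phi>) \<in> surf_charts S \<and> y \<in> U)"

lemma chartedD: "charted S \<Longrightarrow> (U, \<phi>) \<in> surf_charts S \<Longrightarrow> is_chart (surf_top S) (U, \<phi>)"
  by (simp add: charted_def)

lemma charted_cover_charted: "charted_cover S \<Longrightarrow> charted S"
  by (simp add: charted_cover_def)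

lemma charted_coverE:
  assumes "charted_cover S" "y \<in> points S"
  obtains U \<phi> where "(U, \<phi>) \<in> surf_charts S" "y \<in> U" "is_chart (surf_top S) (U, \<phi>)"
proof -
  have "\<exists>U \<phi>. (U, \<phi>) \<in> surf_charts S \<and> y \<in> U"
    using assms by (simp add: charted_cover_def)
  then obtain U \<phi> where U: "(U, \<phi>) \<in> surf_charts S" "y \<in> U" by (elim exE conjE)
  show ?thesis
    by (rule that[OF U chartedD[OF charted_cover_charted[OF assms(1)] U(1)]])
qed

lemma charted_coverI:
  assumes "\<And>c. c \<in> surf_charts S \<Longrightarrow> is_chart (surf_top S) c" "points S \<subseteq> (\<Union>(U, \<phi>)\<in>surf_charts S. U)"
  shows "charted_cover S"
  unfolding charted_cover_def charted_def
proof (intro conjI ballI assms(1))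
  fix y assume "y \<in> points S"
  then have "y \<in> (\<Union>(U, \<phi>)\<in>surf_charts S. U)" using assms(2) by (rule subsetD[rotated])
  then obtain c where "c \<in> surf_charts S" "y \<in> (\<lambda>(U, \<phi>). U) c" by (rule UN_E)
  then show "\<exists>U \<phi>. (U, \<phi>) \<in> surf_charts S \<and> y \<in> U"
    by (cases c) auto
qed

lemma complex_structure_charted_cover:
  assumes "complex_structure T A"
  shows "charted_cover \<lparr>surf_top = T, surf_charts = A\<rparr>"
  by (rule charted_coverI) (use assms in \<open>simp_all add: complex_structure_def\<close>)

lemma riemann_surface_charted_cover: "riemann_surface S \<Longrightarrow> charted_cover S"
  using complex_structure_charted_cover[of "surf_top S" "surf_charts S"]
  by (cases S) (simp add: riemann_surface_def)

section \<open>Holomorphic maps: locality, composition, lifting\<close>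

lemma holomorphic_on_localI:
  assumes "\<And>z. z \<in> D \<Longrightarrow> \<exists>N. open N \<and> z \<in> N \<and> g holomorphic_on N"
  shows "g holomorphic_on D"
  unfolding holomorphic_on_def
proof
  fix z assume "z \<in> D"
  then obtain N where "open N" "z \<in> N" "g holomorphic_on N" using assms by blast
  then have "g field_differentiable (at z)" by (rule holomorphic_on_imp_differentiable_at[rotated])
  then show "g field_differentiable (at z within D)" by (rule field_differentiable_at_within)
qed

lemma holomorphic_map_continuous: "holomorphic_map S S' f \<Longrightarrow> continuous_map (surf_top S) (surf_top S') f"
  by (simp add: holomorphic_map_def map_in_charts_def)

lemma holomorphic_mapD:
  assumes "holomorphic_map S S' f" "(U, \<phi>) \<in> surf_charts S" "(V, \<psi>) \<in> surf_charts S'"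
  shows "(\<psi> \<circ> f \<circ> inv_into U \<phi>) holomorphic_on \<phi> ` {y \<in> U. f y \<in> V}"
proof -
  have "\<forall>(U, \<phi>)\<in>surf_charts S. \<forall>(V, \<psi>)\<in>surf_charts S'.
        (\<psi> \<circ> f \<circ> inv_into U \<phi>) holomorphic_on \<phi> ` {y \<in> U. f y \<in> V}"
    using assms(1) by (simp add: holomorphic_map_def map_in_charts_def)
  from bspec[OF this assms(2)] show ?thesis using assms(3) by auto
qed

lemma openin_chart_domain:
  fixes S :: "'a surface"
  assumes f: "continuous_map (surf_top S) T' f" and U: "openin (surf_top S) U" and V: "openin T' V"
  shows "openin (surf_top S) {y \<in> U. f y \<in> V}"
proof -
  have "{y \<in> U. f y \<in> V} = {y \<in> points S. f y \<in> V} \<inter> U" using openin_subset[OF U] by auto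
  then show ?thesis using openin_preimage[OF f V] U by (simp add: openin_Int)
qed

lemma holomorphic_mapI:
  assumes S: "charted S" and f: "continuous_map (surf_top S) (surf_top S') f"
    and loc: "\<And>U \<phi> V \<psi> y. (U, \<phi>) \<in> surf_charts S \<Longrightarrow> (V, \<psi>) \<in> surf_charts S' \<Longrightarrow> y \<in> U \<Longrightarrow> f y \<in> V \<Longrightarrow>
      \<exists>N. openin (surf_top S) N \<and> y \<in> N \<and> N \<subseteq> U \<and> (\<psi> \<circ> f \<circ> inv_into U \<phi>) holomorphic_on \<phi> ` N"
  shows "holomorphic_map S S' f"
  unfolding holomorphic_map_def map_in_charts_def
proof (intro conjI f ballI, clarify)
  fix U \<phi> V \<psi> assume c: "(U, \<phi>) \<in> surf_charts S" "(V, \<psi>) \<in> surf_charts S'"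
  show "(\<psi> \<circ> f \<circ> inv_into U \<phi>) holomorphic_on \<phi> ` {y \<in> U. f y \<in> V}"
  proof (rule holomorphic_on_localI)
    fix z assume "z \<in> \<phi> ` {y \<in> U. f y \<in> V}"
    then obtain y where y: "y \<in> U" "f y \<in> V" "z = \<phi> y" by blast
    obtain N where N: "openin (surf_top S) N" "y \<in> N" "N \<subseteq> U"
        "(\<psi> \<circ> f \<circ> inv_into U \<phi>) holomorphic_on \<phi> ` N"
      using loc[OF c y(1,2)] by (elim exE conjE)
    have "open (\<phi> ` N)" using is_chart_open_image[OF chartedD[OF S c(1)] N(1,3)] .
    then show "\<exists>N. open N \<and> z \<in> N \<and> (\<psi> \<circ> f \<circ> inv_into U \<phi>) holomorphic_on N"
      using N y(3) by (intro exI[of _ "\<phi> ` N"]) auto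
  qed
qed

lemma holomorphic_map_cong:
  assumes S: "charted S" and f: "holomorphic_map S S' f"
    and fg: "\<And>y. y \<in> points S \<Longrightarrow> f y = g y"
  shows "holomorphic_map S S' g"
  unfolding holomorphic_map_def map_in_charts_def
proof (intro conjI ballI, goal_cases)
  case 1
  show ?case using continuous_map_eq[OF holomorphic_map_continuous[OF f]] fg by blast
next
  case (2 c)
  obtain U \<phi> where c: "c = (U, \<phi>)" by fastforce
  note ch = chartedD[OF S 2[unfolded c]]
  have US: "U \<subseteq> points S" using openin_subset[OF is_chartD(1)[OF ch]] .
  have "(\<psi> \<circ> g \<circ> inv_into U \<phi>) holomorphic_on \<phi> ` {y \<in> U. g y \<in> V}" if V: "(V, \<psi>) \<in> surf_charts S'" for V \<psi>
  proof -
    have eq: "{y \<in> U. g y \<in> V} = {y \<in> U. f y \<in> V}" using US fg by auto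
    show ?thesis
      unfolding eq
    proof (rule holomorphic_transform[OF holomorphic_mapD[OF f 2[unfolded c] V]])
      fix z assume "z \<in> \<phi> ` {y \<in> U. f y \<in> V}"
      then obtain u where "u \<in> U" "z = \<phi> u" by blast
      then show "(\<psi> \<circ> f \<circ> inv_into U \<phi>) z = (\<psi> \<circ> g \<circ> inv_into U \<phi>) z"
        using is_chart_inv[OF ch] US fg by auto
    qed
  qed
  then show ?case unfolding c by auto
qed

text \<open>Both maps are holomorphic with respect to every chart of \<open>S'\<close> around
  \<open>f y\<close>, so any one of them serves as intermediate coordinate. That is why only
  \<open>S'\<close> has to be covered by its charts.\<close>

lemma holomorphic_map_compose:
  assumes S: "charted S" and S': "charted_cover S'" and S'': "charted S''"
    and f: "holomorphic_map S S' f" and g: "holomorphic_map S' S'' g"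
  shows "holomorphic_map S S'' (g \<circ> f)"
proof (rule holomorphic_mapI[OF S])
  note fc = holomorphic_map_continuous[OF f] and gc = holomorphic_map_continuous[OF g]
  show gf: "continuous_map (surf_top S) (surf_top S'') (g \<circ> f)" by (rule continuous_map_compose[OF fc gc])
  fix U \<phi> W \<xi> y
  assume c: "(U, \<phi>) \<in> surf_charts S" "(W, \<xi>) \<in> surf_charts S''" and y: "y \<in> U" "(g \<circ> f) y \<in> W"
  note cU = chartedD[OF S c(1)] and cW = chartedD[OF S'' c(2)]
  have "f y \<in> points S'" using continuous_map_in[OF fc] openin_subset[OF is_chartD(1)[OF cU]] y(1) by auto
  then obtain V \<psi> where V: "(V, \<psi>) \<in> surf_charts S'" "f y \<in> V" "is_chart (surf_top S') (V, \<psi>)"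
    using charted_coverE[OF S'] by metis
  let ?N = "{y \<in> U. f y \<in> V} \<inter> {y \<in> U. (g \<circ> f) y \<in> W}"
  show "\<exists>N. openin (surf_top S) N \<and> y \<in> N \<and> N \<subseteq> U \<and> (\<xi> \<circ> (g \<circ> f) \<circ> inv_into U \<phi>) holomorphic_on \<phi> ` N"
  proof (intro exI conjI)
    show "openin (surf_top S) ?N"
      using openin_chart_domain[OF fc is_chartD(1)[OF cU] is_chartD(1)[OF V(3)]]
        openin_chart_domain[OF gf is_chartD(1)[OF cU] is_chartD(1)[OF cW]] by (rule openin_Int)
    show "y \<in> ?N" using y V(2) by auto
    show "?N \<subseteq> U" by auto
    have "(\<xi> \<circ> g \<circ> inv_into V \<psi>) \<circ> (\<psi> \<circ> f \<circ> inv_into U \<phi>) holomorphic_on \<phi> ` ?N"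
    proof (rule holomorphic_on_compose_gen)
      show "(\<psi> \<circ> f \<circ> inv_into U \<phi>) holomorphic_on \<phi> ` ?N"
        by (rule holomorphic_on_subset[OF holomorphic_mapD[OF f c(1) V(1)]]) auto
      show "(\<xi> \<circ> g \<circ> inv_into V \<psi>) holomorphic_on \<psi> ` {v \<in> V. g v \<in> W}"
        by (rule holomorphic_mapD[OF g V(1) c(2)])
      show "(\<psi> \<circ> f \<circ> inv_into U \<phi>) ` \<phi> ` ?N \<subseteq> \<psi> ` {v \<in> V. g v \<in> W}"
        using is_chart_inv[OF cU] by auto
    qed
    then show "(\<xi> \<circ> (g \<circ> f) \<circ> inv_into U \<phi>) holomorphic_on \<phi> ` ?N"
      by (rule holomorphic_transform) (use is_chart_inv[OF cU] is_chart_inv[OF V(3)] in auto)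
  qed
qed

text \<open>In charts, \<open>q\<close> is injective near \<open>f y\<close>, so it has a holomorphic local inverse, and \<open>f\<close> is that
  inverse after \<open>q \<circ> f\<close>.\<close>
lemma holomorphic_map_lift:
  assumes S: "charted S" and S': "charted S'" and X: "charted_cover X"
    and q: "holomorphic_map S' X q" "local_homeo (surf_top S') (surf_top X) q"
    and f: "continuous_map (surf_top S) (surf_top S') f" and qf: "holomorphic_map S X (q \<circ> f)"
  shows "holomorphic_map S S' f"
proof (rule holomorphic_mapI[OF S f])
  note qc = holomorphic_map_continuous[OF q(1)] and qfc = holomorphic_map_continuous[OF qf]
  fix U \<phi> V \<psi> y
  assume c: "(U, \<phi>) \<in> surf_charts S" "(V, \<psi>) \<in> surf_charts S'" and y: "y \<in> U" "f y \<in> V"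
  note cU = chartedD[OF S c(1)] and cV = chartedD[OF S' c(2)]
  have fy: "f y \<in> points S'" using openin_subset[OF is_chartD(1)[OF cV]] y by auto
  obtain W \<xi> where W: "(W, \<xi>) \<in> surf_charts X" "q (f y) \<in> W" "is_chart (surf_top X) (W, \<xi>)"
    using charted_coverE[OF X continuous_map_in[OF qc fy]] by metis
  have o: "openin (surf_top S') {v \<in> V. q v \<in> W}"
    using openin_chart_domain[OF qc is_chartD(1)[OF cV] is_chartD(1)[OF W(3)]] .
  have "f y \<in> {v \<in> V. q v \<in> W}" using y W(2) by auto
  from local_homeo_small[OF q(2) o this] obtain V0 where V0: "openin (surf_top S') V0" "f y \<in> V0"
    "V0 \<subseteq> {v \<in> V. q v \<in> W}" "openin (surf_top X) (q ` V0)"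
    "homeomorphic_map (subtopology (surf_top S') V0) (subtopology (surf_top X) (q ` V0)) q" .
  have V0V: "V0 \<subseteq> V" and V0W: "q ` V0 \<subseteq> W" using V0(3) by auto
  have injq: "inj_on q V0"
    by (rule homeomorphic_map_section(2)[OF V0(5) openin_subset[OF V0(1)] openin_subset[OF V0(4)]])
  \<comment> \<open>\<open>k\<close> is \<open>q\<close> read in the charts \<open>\<psi>\<close>
    and \<open>\<xi>\<close>. An injective holomorphic function on an open set has a holomorphic
    inverse, which is the \<open>g\<close> obtained below.\<close>
  define k where "k = \<xi> \<circ> q \<circ> inv_into V \<psi>"
  have k: "k (\<psi> v) = \<xi> (q v)" if "v \<in> V" for v using is_chart_inv[OF cV that] by (simp add: k_def)
  have "k holomorphic_on \<psi> ` {v \<in> V. q v \<in> W}"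
    unfolding k_def by (rule holomorphic_mapD[OF q(1) c(2) W(1)])
  then have khol: "k holomorphic_on \<psi> ` V0"
    by (rule holomorphic_on_subset) (use V0(3) in auto)
  have oV0: "open (\<psi> ` V0)" using is_chart_open_image[OF cV V0(1) V0V] .
  have "inj_on \<xi> (q ` V0)" using is_chartD(3)[OF W(3)] V0W by (rule inj_on_subset)
  with injq have "inj_on (\<xi> \<circ> q) V0" by (rule comp_inj_on)
  have kinj: "inj_on k (\<psi> ` V0)"
  proof (rule inj_onI)
    fix a b assume ab: "a \<in> \<psi> ` V0" "b \<in> \<psi> ` V0" "k a = k b"
    then obtain u v where uv: "u \<in> V0" "v \<in> V0" "a = \<psi> u" "b = \<psi> v" by blast
    then have "(\<xi> \<circ> q) u = (\<xi> \<circ> q) v"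
      using ab(3) k[OF subsetD[OF V0V uv(1)]] k[OF subsetD[OF V0V uv(2)]] by simp
    then have "u = v" using \<open>inj_on (\<xi> \<circ> q) V0\<close> uv by (meson inj_onD)
    then show "a = b" using uv by simp
  qed
  obtain g where g: "g holomorphic_on (k ` \<psi> ` V0)" "\<And>z. z \<in> \<psi> ` V0 \<Longrightarrow> g (k z) = z"
    using holomorphic_has_inverse[OF khol oV0 kinj] by metis
  let ?N = "{u \<in> U. f u \<in> V0}"
  show "\<exists>N. openin (surf_top S) N \<and> y \<in> N \<and> N \<subseteq> U \<and> (\<psi> \<circ> f \<circ> inv_into U \<phi>) holomorphic_on \<phi> ` N"
  proof (intro exI conjI)
    show "openin (surf_top S) ?N" using openin_chart_domain[OF f is_chartD(1)[OF cU] V0(1)] .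
    show "y \<in> ?N" using y V0(2) by auto
    show "?N \<subseteq> U" by auto
    have "g \<circ> (\<xi> \<circ> (q \<circ> f) \<circ> inv_into U \<phi>) holomorphic_on \<phi> ` ?N"
    proof (rule holomorphic_on_compose_gen[OF _ g(1)])
      show "(\<xi> \<circ> (q \<circ> f) \<circ> inv_into U \<phi>) holomorphic_on \<phi> ` ?N"
        by (rule holomorphic_on_subset[OF holomorphic_mapD[OF qf c(1) W(1)]]) (use V0W in auto)
      show "(\<xi> \<circ> (q \<circ> f) \<circ> inv_into U \<phi>) ` \<phi> ` ?N \<subseteq> k ` \<psi> ` V0"
      proof clarify
        fix u assume u: "u \<in> U" "f u \<in> V0"
        then have "(\<xi> \<circ> (q \<circ> f) \<circ> inv_into U \<phi>) (\<phi> u) = k (\<psi> (f u))"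
          using is_chart_inv[OF cU u(1)] k[of "f u"] V0V by auto
        then show "(\<xi> \<circ> (q \<circ> f) \<circ> inv_into U \<phi>) (\<phi> u) \<in> k ` \<psi> ` V0" using u by auto
      qed
    qed
    then show "(\<psi> \<circ> f \<circ> inv_into U \<phi>) holomorphic_on \<phi> ` ?N"
    proof (rule holomorphic_transform)
      fix z assume "z \<in> \<phi> ` ?N"
      then obtain u where u: "u \<in> U" "f u \<in> V0" "z = \<phi> u" by blast
      then have "\<xi> (q (f u)) = k (\<psi> (f u))" using k[of "f u"] V0V by auto
      then show "(g \<circ> (\<xi> \<circ> (q \<circ> f) \<circ> inv_into U \<phi>)) z = (\<psi> \<circ> f \<circ> inv_into U \<phi>) z"
        using u is_chart_inv[OF cU u(1)] g(2)[of "\<psi> (f u)"] by auto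
    qed
  qed
qed

section \<open>Conjugation of charts\<close>

text \<open>The conjugate surface. Holomorphic maps into it are the anti-holomorphic maps into
  \<open>S\<close>, so results about the former transfer.\<close>

definition conj_surface :: "'a surface \<Rightarrow> 'a surface" where
  "conj_surface S = \<lparr>surf_top = surf_top S, surf_charts = (\<lambda>(U, \<phi>). (U, cnj \<circ> \<phi>)) ` surf_charts S\<rparr>"

lemma surf_top_conj [simp]: "surf_top (conj_surface S) = surf_top S"
  by (simp add: conj_surface_def)

lemma antiholomorphic_map_iff: "antiholomorphic_map S S' f \<longleftrightarrow> holomorphic_map S (conj_surface S') f"
  by (simp add: antiholomorphic_map_def holomorphic_map_def map_in_charts_def conj_surface_def
      case_prod_unfold o_assoc)

lemma open_cnj_image: "open A \<Longrightarrow> open (cnj ` A)"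
  unfolding image_cnj_conv_vimage_cnj by (intro open_vimage continuous_intros) auto

lemma is_chart_conj:
  assumes "is_chart T (U, \<phi>)"
  shows "is_chart T (U, cnj \<circ> \<phi>)"
proof -
  have "homeomorphic_maps (top_of_set (\<phi> ` U)) (top_of_set (cnj ` \<phi> ` U)) cnj cnj"
    by (auto simp: homeomorphic_maps_def intro!: continuous_on_cnj continuous_on_id)
  then have "homeomorphic_map (top_of_set (\<phi> ` U)) (top_of_set (cnj ` \<phi> ` U)) cnj"
    using homeomorphic_maps_map by blast
  note h = homeomorphic_map_compose[OF is_chartD(4)[OF assms] this]
  have im: "(cnj \<circ> \<phi>) ` U = cnj ` \<phi> ` U" by (simp add: image_comp)
  show ?thesis
    unfolding is_chart_def split_conv im
    using is_chartD(1)[OF assms] open_cnj_image[OF is_chartD(2)[OF assms]] h by simp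
qed

lemma charted_cover_conj: "charted_cover S \<Longrightarrow> charted_cover (conj_surface S)"
  unfolding charted_cover_def charted_def
proof (elim conjE, intro conjI ballI, goal_cases)
  case (1 c)
  then show ?case by (cases c) (auto simp: conj_surface_def intro!: is_chart_conj)
next
  case (2 y)
  then obtain U \<phi> where "(U, \<phi>) \<in> surf_charts S" "y \<in> U" by (auto dest!: bspec[of _ _ y])
  then have "(U, cnj \<circ> \<phi>) \<in> surf_charts (conj_surface S)" "y \<in> U"
    by (auto simp: conj_surface_def intro: image_eqI[where x = "(U, \<phi>)"])
  then show ?case by (intro exI conjI)
qed

text \<open>In the conjugated charts a local representative \<open>g\<close> becomes
  \<open>cnj \<circ> g \<circ> cnj\<close>, which is holomorphic on the reflected domain.\<close>

lemma holomorphic_map_conj: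
  assumes S: "charted S" and S': "charted S'" and f: "holomorphic_map S S' f"
  shows "holomorphic_map (conj_surface S) (conj_surface S') f"
  unfolding holomorphic_map_def map_in_charts_def
proof (intro conjI ballI, goal_cases)
  case 1
  show ?case using holomorphic_map_continuous[OF f] by simp
next
  case (2 c)
  then obtain U \<phi> where c: "c = (U, cnj \<circ> \<phi>)" "(U, \<phi>) \<in> surf_charts S"
    by (auto simp: conj_surface_def)
  note ch = chartedD[OF S c(2)]
  have "((cnj \<circ> \<psi>) \<circ> f \<circ> inv_into U (cnj \<circ> \<phi>)) holomorphic_on (cnj \<circ> \<phi>) ` {y \<in> U. f y \<in> V}"
    if V: "(V, \<psi>) \<in> surf_charts S'" for V \<psi>
  proof -
    let ?D = "\<phi> ` {y \<in> U. f y \<in> V}"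
    have "cnj \<circ> (\<psi> \<circ> f \<circ> inv_into U \<phi>) \<circ> cnj holomorphic_on cnj ` ?D"
    proof -
      have "cnj ` cnj ` ?D = ?D" by (auto simp: image_comp)
      then have "(\<psi> \<circ> f \<circ> inv_into U \<phi>) holomorphic_on cnj ` cnj ` ?D"
        using holomorphic_mapD[OF f c(2) V] by simp
      moreover have "open ?D"
        using is_chart_open_image[OF ch openin_chart_domain[OF holomorphic_map_continuous[OF f]
            is_chartD(1)[OF ch] is_chartD(1)[OF chartedD[OF S' V]]]] by auto
      then have "open (cnj ` ?D)" by (rule open_cnj_image)
      ultimately show ?thesis by (rule holomorphic_on_compose_cnj_cnj)
    qed
    then show ?thesis
    proof (subst image_comp[symmetric], elim holomorphic_transform)
      fix z assume "z \<in> cnj ` ?D"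
      then obtain u where u: "u \<in> U" "z = cnj (\<phi> u)" by blast
      have "inv_into U (cnj \<circ> \<phi>) ((cnj \<circ> \<phi>) u) = u" using is_chart_inv[OF is_chart_conj[OF ch] u(1)] .
      then show "(cnj \<circ> (\<psi> \<circ> f \<circ> inv_into U \<phi>) \<circ> cnj) z = (cnj \<circ> \<psi> \<circ> f \<circ> inv_into U (cnj \<circ> \<phi>)) z"
        using u is_chart_inv[OF ch u(1)] by simp
    qed
  qed
  then show ?case unfolding c by (auto simp: conj_surface_def)
qed

section \<open>Real smoothness of holomorphic and anti-holomorphic maps\<close>

text \<open>\<open>Ck_on\<close> differentiates in a full neighbourhood of each point; openness of
  \<open>D\<close> makes these derivatives depend on the values on \<open>D\<close> alone.\<close>

lemma Ck_on_cong:
  assumes "open D" "\<And>z. z \<in> D \<Longrightarrow> g z = h z" "Ck_on k g D"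
  shows "Ck_on k h D"
  using assms(2,3)
proof (induction k arbitrary: g h)
  case 0
  then show ?case using continuous_on_cong[of D D g h] by simp
next
  case (Suc k)
  have der: "(h has_derivative frechet_derivative g (at z)) (at z)" if z: "z \<in> D" for z
  proof -
    have "g differentiable (at z)" using Suc.prems(2) z by simp
    then have "(g has_derivative frechet_derivative g (at z)) (at z)" by (simp add: frechet_derivative_works)
    then show ?thesis
      by (rule has_derivative_transform_within_open[OF _ assms(1) z]) (rule Suc.prems(1))
  qed
  have eq: "frechet_derivative g (at z) = frechet_derivative h (at z)" if "z \<in> D" for z
    using frechet_derivative_at[OF der[OF that]] .
  have "Ck_on k (\<lambda>z. frechet_derivative h (at z) v) D" for v
    by (rule Suc.IH[of "\<lambda>z. frechet_derivative g (at z) v"]) (use eq Suc.prems(2) in auto)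
  moreover have "\<forall>z\<in>D. h differentiable (at z)" using der by (auto simp: differentiable_def)
  ultimately show ?case by simp
qed

text \<open>The derivative in direction \<open>v\<close> is \<open>deriv g z * v\<close>, which is
  holomorphic again, so induction on \<open>k\<close> closes.\<close>

lemma holomorphic_imp_Ck_on:
  assumes "open D" "g holomorphic_on D"
  shows "Ck_on k g D"
  using assms(2)
proof (induction k arbitrary: g)
  case 0
  then show ?case by (simp add: holomorphic_on_imp_continuous_on)
next
  case (Suc k)
  have der: "(g has_derivative (*) (deriv g z)) (at z)" if "z \<in> D" for z
    using holomorphic_derivI[OF Suc.prems assms(1) that] by (simp add: has_field_derivative_def)
  have "Ck_on k (\<lambda>z. frechet_derivative g (at z) v) D" for v
  proof (rule Ck_on_cong[OF assms(1)])
    show "Ck_on k (\<lambda>z. deriv g z * v) D"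
      by (intro Suc.IH holomorphic_on_mult holomorphic_deriv Suc.prems assms(1) holomorphic_on_const)
    show "deriv g z * v = frechet_derivative g (at z) v" if "z \<in> D" for z
      using frechet_derivative_at[OF der[OF that]] by metis
  qed
  moreover have "\<forall>z\<in>D. g differentiable (at z)" using der by (auto simp: differentiable_def)
  ultimately show ?case by simp
qed

text \<open>The derivative in direction \<open>v\<close> is
  \<open>cnj (deriv (cnj \<circ> g) z * v)\<close>, which is anti-holomorphic again; this keeps the
  induction within one class.\<close>

lemma antiholomorphic_imp_Ck_on:
  assumes "open D" "(cnj \<circ> g) holomorphic_on D"
  shows "Ck_on k g D"
  using assms(2)
proof (induction k arbitrary: g)
  case 0
  then have "continuous_on D (\<lambda>z. cnj ((cnj \<circ> g) z))"
    by (intro continuous_on_cnj holomorphic_on_imp_continuous_on)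
  then show ?case by simp
next
  case (Suc k)
  have der: "(g has_derivative (\<lambda>v. cnj (deriv (cnj \<circ> g) z * v))) (at z)" if "z \<in> D" for z
  proof -
    have "((cnj \<circ> g) has_derivative (*) (deriv (cnj \<circ> g) z)) (at z)"
      using holomorphic_derivI[OF Suc.prems assms(1) that] unfolding has_field_derivative_def .
    from bounded_linear.has_derivative[OF bounded_linear_cnj this] show ?thesis by simp
  qed
  have "Ck_on k (\<lambda>z. frechet_derivative g (at z) v) D" for v
  proof (rule Ck_on_cong[OF assms(1)])
    have "(\<lambda>z. deriv (cnj \<circ> g) z * v) holomorphic_on D"
      by (intro holomorphic_on_mult holomorphic_deriv Suc.prems assms(1) holomorphic_on_const)
    then have "cnj \<circ> (\<lambda>z. cnj (deriv (cnj \<circ> g) z * v)) holomorphic_on D" by (simp add: o_def)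
    then show "Ck_on k (\<lambda>z. cnj (deriv (cnj \<circ> g) z * v)) D" by (rule Suc.IH)
    show "cnj (deriv (cnj \<circ> g) z * v) = frechet_derivative g (at z) v" if "z \<in> D" for z
      using fun_cong[OF frechet_derivative_at[OF der[OF that]], of v] .
  qed
  moreover have "\<forall>z\<in>D. g differentiable (at z)" using der by (auto simp: differentiable_def)
  ultimately show ?case by simp
qed

text \<open>Through this the word diffeomorphism in the definition of \<open>piR\<close> costs
  nothing more than a homeomorphism over \<open>id\<close> or \<open>\<sigma>\<close>.\<close>

lemma smooth_mapI:
  assumes S: "charted S" and S': "charted S'"
    and f: "holomorphic_map S S' f \<or> antiholomorphic_map S S' f"
  shows "smooth_map S S' f"
  unfolding smooth_map_def map_in_charts_def
proof (intro conjI ballI, goal_cases)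
  case 1
  show ?case using f by (auto simp: holomorphic_map_def antiholomorphic_map_def map_in_charts_def)
next
  case (2 c)
  have fc: "continuous_map (surf_top S) (surf_top S') f"
    using f by (auto simp: holomorphic_map_def antiholomorphic_map_def map_in_charts_def)
  obtain U \<phi> where c: "c = (U, \<phi>)" by fastforce
  note ch = chartedD[OF S 2[unfolded c]]
  have "Ck_on k (\<psi> \<circ> f \<circ> inv_into U \<phi>) (\<phi> ` {y \<in> U. f y \<in> V})" if V: "(V, \<psi>) \<in> surf_charts S'" for V \<psi> k
  proof -
    have o: "open (\<phi> ` {y \<in> U. f y \<in> V})"
      using is_chart_open_image[OF ch openin_chart_domain[OF fc
            is_chartD(1)[OF ch] is_chartD(1)[OF chartedD[OF S' V]]]] by auto
    from f show ?thesis
    proof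
      assume "holomorphic_map S S' f"
      from holomorphic_imp_Ck_on[OF o holomorphic_mapD[OF this 2[unfolded c] V]] show ?thesis .
    next
      assume "antiholomorphic_map S S' f"
      then have "holomorphic_map S (conj_surface S') f" by (simp add: antiholomorphic_map_iff)
      moreover have "(V, cnj \<circ> \<psi>) \<in> surf_charts (conj_surface S')"
        using V by (auto simp: conj_surface_def intro: image_eqI[where x = "(V, \<psi>)"])
      ultimately have "(cnj \<circ> \<psi> \<circ> f \<circ> inv_into U \<phi>) holomorphic_on \<phi> ` {y \<in> U. f y \<in> V}"
        by (rule holomorphic_mapD[OF _ 2[unfolded c]])
      then have "(cnj \<circ> (\<psi> \<circ> f \<circ> inv_into U \<phi>)) holomorphic_on \<phi> ` {y \<in> U. f y \<in> V}"
        by (simp add: o_assoc)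
      from antiholomorphic_imp_Ck_on[OF o this] show ?thesis .
    qed
  qed
  then show ?case unfolding c by auto
qed

section \<open>The complex structure induced by a local homeomorphism\<close>

text \<open>Compatibility of atlases is read as holomorphy of the identity, so that the composition
  and lifting results for maps also prove facts about atlases.\<close>

lemma holomorphic_map_id_iff:
  "holomorphic_map \<lparr>surf_top = T, surf_charts = A\<rparr> \<lparr>surf_top = T, surf_charts = B\<rparr> id \<longleftrightarrow>
     (\<forall>c\<in>A. \<forall>d\<in>B. holo_transition c d)"
  by (simp add: holomorphic_map_def map_in_charts_def holo_transition_def case_prod_unfold Int_def)

definition maximal_atlas :: "'a topology \<Rightarrow> ('a set \<times> ('a \<Rightarrow> complex)) set \<Rightarrow> ('a set \<times> ('a \<Rightarrow> complex)) set" where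
  "maximal_atlas T B = {c. is_chart T c \<and> (\<forall>d\<in>B. holo_transition c d \<and> holo_transition d c)}"

text \<open>Two charts compatible with all of \<open>B\<close> are compatible with each other,
  because the identity of the maximal atlas factors through \<open>B\<close>.\<close>

lemma complex_structure_maximal_atlas:
  assumes B: "charted_cover \<lparr>surf_top = T, surf_charts = B\<rparr>"
    and comp: "\<And>c d. c \<in> B \<Longrightarrow> d \<in> B \<Longrightarrow> holo_transition c d"
  shows "complex_structure T (maximal_atlas T B)"
proof -
  let ?A = "maximal_atlas T B"
  let ?SA = "\<lparr>surf_top = T, surf_charts = ?A\<rparr>" and ?SB = "\<lparr>surf_top = T, surf_charts = B\<rparr>"
  have chB: "is_chart T c" if "c \<in> B" for c
    using charted_cover_charted[OF B] that by (simp add: charted_def)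
  have BA: "B \<subseteq> ?A" using chB comp by (auto simp: maximal_atlas_def)
  have chA: "charted ?SA" by (simp add: charted_def maximal_atlas_def)
  have "holomorphic_map ?SA ?SB id" "holomorphic_map ?SB ?SA id"
    unfolding holomorphic_map_id_iff by (auto simp: maximal_atlas_def)
  then have "holomorphic_map ?SA ?SA (id \<circ> id)" by (rule holomorphic_map_compose[OF chA B chA])
  then have AA: "\<forall>c\<in>?A. \<forall>d\<in>?A. holo_transition c d" unfolding id_o holomorphic_map_id_iff .
  have cover: "(\<Union>(U, \<phi>)\<in>?A. U) = topspace T"
  proof (intro equalityI subsetI)
    fix y assume "y \<in> (\<Union>(U, \<phi>)\<in>?A. U)"
    then obtain c where "c \<in> ?A" "y \<in> (\<lambda>(U, \<phi>). U) c" by (rule UN_E)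
    then show "y \<in> topspace T"
      using openin_subset[OF is_chartD(1)[of T "fst c" "snd c"]] by (cases c) (auto simp: maximal_atlas_def)
  next
    fix y assume y: "y \<in> topspace T"
    then have "y \<in> points ?SB" by simp
    from charted_coverE[OF B this] obtain U \<phi> where U: "(U, \<phi>) \<in> surf_charts ?SB" "y \<in> U" .
    then have "(U, \<phi>) \<in> ?A" using BA by auto
    then show "y \<in> (\<Union>(U, \<phi>)\<in>?A. U)" by (rule UN_I) (simp add: U(2))
  qed
  show ?thesis
    unfolding complex_structure_def
  proof (intro conjI cover AA allI impI)
    show "\<forall>c\<in>?A. is_chart T c" by (simp add: maximal_atlas_def)
    fix c assume c: "is_chart T c \<and> (\<forall>d\<in>?A. holo_transition c d \<and> holo_transition d c)"
    then have "holo_transition c d \<and> holo_transition d c" if "d \<in> B" for d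
      using subsetD[OF BA that] by simp
    with c show "c \<in> ?A" by (simp add: maximal_atlas_def)
  qed
qed

text \<open>Domains are small enough for \<open>p\<close> to be a homeomorphism onto an open part of
  a single chart domain of \<open>X\<close>.\<close>

definition pullback_charts :: "'a topology \<Rightarrow> 'b surface \<Rightarrow> ('a \<Rightarrow> 'b) \<Rightarrow> ('a set \<times> ('a \<Rightarrow> complex)) set" where
  "pullback_charts T X p = {(V, \<phi> \<circ> p) | V U \<phi>. openin T V \<and> (U, \<phi>) \<in> surf_charts X \<and> p ` V \<subseteq> U \<and>
     openin (surf_top X) (p ` V) \<and>
     homeomorphic_map (subtopology T V) (subtopology (surf_top X) (p ` V)) p}"

lemma is_chart_pullback:
  assumes V: "openin T V" and U: "is_chart X (U, \<phi>)" and pV: "p ` V \<subseteq> U" "openin X (p ` V)"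
    and h: "homeomorphic_map (subtopology T V) (subtopology X (p ` V)) p"
  shows "is_chart T (V, \<phi> \<circ> p)"
proof -
  have UX: "U \<subseteq> topspace X" using openin_subset[OF is_chartD(1)[OF U]] .
  have eq: "\<phi> ` (topspace (subtopology X U) \<inter> p ` V) = topspace (top_of_set (\<phi> ` U)) \<inter> \<phi> ` p ` V"
    using pV(1) UX by auto
  have "homeomorphic_map (subtopology (subtopology X U) (p ` V))
      (subtopology (top_of_set (\<phi> ` U)) (\<phi> ` p ` V)) \<phi>"
    by (rule homeomorphic_map_subtopologies[OF is_chartD(4)[OF U] eq])
  then have "homeomorphic_map (subtopology X (p ` V)) (top_of_set (\<phi> ` p ` V)) \<phi>"
    using pV(1) by (simp add: subtopology_subtopology Int_absorb1 image_mono)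
  from homeomorphic_map_compose[OF h this] show ?thesis
    using V is_chart_open_image[OF U pV(2,1)] by (simp add: is_chart_def image_comp)
qed

lemma pullback_chartsE:
  assumes "c \<in> pullback_charts T X p"
  obtains V U \<phi> where "c = (V, \<phi> \<circ> p)" "openin T V" "(U, \<phi>) \<in> surf_charts X" "p ` V \<subseteq> U"
    "openin (surf_top X) (p ` V)" "homeomorphic_map (subtopology T V) (subtopology (surf_top X) (p ` V)) p"
  using assms unfolding pullback_charts_def mem_Collect_eq by (elim exE conjE) (rule that)

lemma pullback_charts_at:
  assumes p: "local_homeo T (surf_top X) p" and U: "(U, \<phi>) \<in> surf_charts X" "openin (surf_top X) U"
    and y: "y \<in> topspace T" "p y \<in> U"
  obtains V where "(V, \<phi> \<circ> p) \<in> pullback_charts T X p" "y \<in> V" "openin T V" "p ` V \<subseteq> U"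
proof -
  have "continuous_map T (surf_top X) p" using p by (simp add: local_homeo_def)
  then have "openin T {z \<in> topspace T. p z \<in> U}" "y \<in> {z \<in> topspace T. p z \<in> U}"
    using openin_preimage U(2) y by auto
  from local_homeo_small[OF p this] obtain V where V: "openin T V" "y \<in> V" "V \<subseteq> {z \<in> topspace T. p z \<in> U}"
    "openin (surf_top X) (p ` V)" "homeomorphic_map (subtopology T V) (subtopology (surf_top X) (p ` V)) p" .
  have pV: "p ` V \<subseteq> U" using V(3) by auto
  show ?thesis
    by (rule that[of V]) (use V U pV in \<open>auto simp: pullback_charts_def\<close>)
qed

text \<open>The transitions between pulled back charts are restrictions of transitions of
  \<open>X\<close>, so they generate a complex structure.\<close>

lemma induced_structure_ex:
  assumes X: "riemann_surface X" and p: "local_homeo T (surf_top X) p"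
  shows "complex_structure T (maximal_atlas T (pullback_charts T X p))"
    "holomorphic_map \<lparr>surf_top = T, surf_charts = maximal_atlas T (pullback_charts T X p)\<rparr> X p"
proof -
  let ?B = "pullback_charts T X p"
  let ?SB = "\<lparr>surf_top = T, surf_charts = ?B\<rparr>"
  let ?SA = "\<lparr>surf_top = T, surf_charts = maximal_atlas T ?B\<rparr>"
  note Xc = riemann_surface_charted_cover[OF X]
  note Xch = chartedD[OF charted_cover_charted[OF Xc]]
  have pc: "continuous_map T (surf_top X) p" using p by (simp add: local_homeo_def)
  have chB: "is_chart T c" if cB: "c \<in> ?B" for c
  proof -
    obtain V U \<phi> where c: "c = (V, \<phi> \<circ> p)" "openin T V" "(U, \<phi>) \<in> surf_charts X" "p ` V \<subseteq> U"
      "openin (surf_top X) (p ` V)" "homeomorphic_map (subtopology T V) (subtopology (surf_top X) (p ` V)) p"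
      using pullback_chartsE[OF cB] .
    show ?thesis unfolding c(1) by (rule is_chart_pullback[OF c(2) Xch[OF c(3)] c(4,5,6)])
  qed
  have covB: "\<exists>V \<phi>. (V, \<phi> \<circ> p) \<in> ?B \<and> y \<in> V" if y: "y \<in> topspace T" for y
  proof -
    obtain U \<phi> where U: "(U, \<phi>) \<in> surf_charts X" "p y \<in> U" "is_chart (surf_top X) (U, \<phi>)"
      using charted_coverE[OF Xc continuous_map_in[OF pc y]] .
    obtain V where "(V, \<phi> \<circ> p) \<in> ?B" "y \<in> V"
      using pullback_charts_at[OF p U(1) is_chartD(1)[OF U(3)] y U(2)] .
    then show ?thesis by (intro exI conjI)
  qed
  have SB: "charted_cover ?SB"
    unfolding charted_cover_def charted_def
  proof (intro conjI ballI)
    show "is_chart (surf_top ?SB) c" if "c \<in> surf_charts ?SB" for c using chB that by simp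
    fix y assume "y \<in> points ?SB"
    then obtain V \<phi> where "(V, \<phi> \<circ> p) \<in> ?B" "y \<in> V" using covB[of y] by auto
    then show "\<exists>U \<phi>. (U, \<phi>) \<in> surf_charts ?SB \<and> y \<in> U" by (intro exI[of _ V] exI[of _ "\<phi> \<circ> p"]) simp
  qed
  have XX: "holo_transition c d" if "c \<in> surf_charts X" "d \<in> surf_charts X" for c d
    using X that by (simp add: riemann_surface_def complex_structure_def)
  have BB: "holo_transition c d" if cB: "c \<in> ?B" and dB: "d \<in> ?B" for c d
  proof -
    obtain V U \<phi> where c: "c = (V, \<phi> \<circ> p)" "openin T V" "(U, \<phi>) \<in> surf_charts X" "p ` V \<subseteq> U"
      using pullback_chartsE[OF cB] by metis
    obtain W O' \<psi> where d: "d = (W, \<psi> \<circ> p)" "(O', \<psi>) \<in> surf_charts X" "p ` W \<subseteq> O'"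
      using pullback_chartsE[OF dB] by metis
    have "holo_transition (U, \<phi>) (O', \<psi>)" using XX c(3) d(2) by blast
    then have "(\<psi> \<circ> inv_into U \<phi>) holomorphic_on \<phi> ` (U \<inter> O')" by (simp add: holo_transition_def)
    then have "(\<psi> \<circ> inv_into U \<phi>) holomorphic_on (\<phi> \<circ> p) ` (V \<inter> W)"
      by (rule holomorphic_on_subset) (use c(4) d(3) in auto)
    then have "((\<psi> \<circ> p) \<circ> inv_into V (\<phi> \<circ> p)) holomorphic_on (\<phi> \<circ> p) ` (V \<inter> W)"
    proof (rule holomorphic_transform)
      fix z assume "z \<in> (\<phi> \<circ> p) ` (V \<inter> W)"
      then obtain y where y: "y \<in> V" "z = (\<phi> \<circ> p) y" by blast
      have "is_chart T (V, \<phi> \<circ> p)" using chB[OF cB] c(1) by simp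
      from is_chart_inv[OF this y(1)] is_chart_inv[OF Xch[OF c(3)], of "p y"] c(4) y
      show "(\<psi> \<circ> inv_into U \<phi>) z = ((\<psi> \<circ> p) \<circ> inv_into V (\<phi> \<circ> p)) z" by auto
    qed
    then show ?thesis by (simp add: holo_transition_def c d)
  qed
  show cs: "complex_structure T (maximal_atlas T ?B)"
    by (rule complex_structure_maximal_atlas[OF SB BB])
  note SA = complex_structure_charted_cover[OF cs]
  show "holomorphic_map ?SA X p"
  proof (rule holomorphic_mapI[OF charted_cover_charted[OF SA]])
    show "continuous_map (surf_top ?SA) (surf_top X) p" using pc by simp
    fix U \<phi> V \<psi> y
    assume c: "(U, \<phi>) \<in> surf_charts ?SA" "(V, \<psi>) \<in> surf_charts X" and y: "y \<in> U" "p y \<in> V"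
    have cU: "is_chart T (U, \<phi>)" using chartedD[OF charted_cover_charted[OF SA] c(1)] by simp
    have "y \<in> topspace T" using openin_subset[OF is_chartD(1)[OF cU]] y by auto
    from pullback_charts_at[OF p c(2) is_chartD(1)[OF Xch[OF c(2)]] this y(2)]
    obtain W where W: "(W, \<psi> \<circ> p) \<in> ?B" "y \<in> W" "openin T W" .
    \<comment> \<open>The representative of \<open>p\<close> in the charts \<open>\<phi>\<close> and
      \<open>\<psi>\<close> is literally the transition from \<open>\<phi>\<close> to the pulled
      back chart \<open>\<psi> \<circ> p\<close>.\<close>
    have "holo_transition (U, \<phi>) (W, \<psi> \<circ> p)" using c(1) W(1) by (simp add: maximal_atlas_def)
    then have "(\<psi> \<circ> p \<circ> inv_into U \<phi>) holomorphic_on \<phi> ` (U \<inter> W)" by (simp add: holo_transition_def)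
    then show "\<exists>N. openin (surf_top ?SA) N \<and> y \<in> N \<and> N \<subseteq> U \<and> (\<psi> \<circ> p \<circ> inv_into U \<phi>) holomorphic_on \<phi> ` N"
      using W y is_chartD(1)[OF cU] by (intro exI[of _ "U \<inter> W"]) auto
  qed
qed

text \<open>The identity is a continuous lift of \<open>p\<close> through \<open>p\<close>, so
  \<open>holomorphic_map_lift\<close> makes it holomorphic from one structure to the other.
  Maximality of both atlases then gives uniqueness.\<close>

lemma induced_structure_mono:
  assumes X: "riemann_surface X" and p: "local_homeo T (surf_top X) p"
    and A: "complex_structure T A" "holomorphic_map \<lparr>surf_top = T, surf_charts = A\<rparr> X p"
    and B: "complex_structure T B" "holomorphic_map \<lparr>surf_top = T, surf_charts = B\<rparr> X p"
  shows "\<forall>c\<in>A. \<forall>d\<in>B. holo_transition c d"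
proof -
  have "holomorphic_map \<lparr>surf_top = T, surf_charts = A\<rparr> \<lparr>surf_top = T, surf_charts = B\<rparr> id"
    by (rule holomorphic_map_lift[OF charted_cover_charted[OF complex_structure_charted_cover[OF A(1)]]
        charted_cover_charted[OF complex_structure_charted_cover[OF B(1)]]
        riemann_surface_charted_cover[OF X] B(2)]) (use p A(2) in simp_all)
  then show ?thesis unfolding holomorphic_map_id_iff .
qed

lemma induced_structure_unique:
  assumes X: "riemann_surface X" and p: "local_homeo T (surf_top X) p"
    and A: "complex_structure T A" "holomorphic_map \<lparr>surf_top = T, surf_charts = A\<rparr> X p"
    and B: "complex_structure T B" "holomorphic_map \<lparr>surf_top = T, surf_charts = B\<rparr> X p"
  shows "A = B"
proof -
  have "A \<subseteq> B" if A: "complex_structure T A" "holomorphic_map \<lparr>surf_top = T, surf_charts = A\<rparr> X p"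
    and B: "complex_structure T B" "holomorphic_map \<lparr>surf_top = T, surf_charts = B\<rparr> X p" for A B
  proof
    fix c assume c: "c \<in> A"
    then have ch: "is_chart T c" using A(1) by (simp add: complex_structure_def)
    have tr: "\<forall>d\<in>B. holo_transition c d \<and> holo_transition d c"
      using c induced_structure_mono[OF X p A B] induced_structure_mono[OF X p B A] by simp
    from B(1)[unfolded complex_structure_def, THEN conjunct2, THEN conjunct2, THEN conjunct2]
    have "is_chart T c \<and> (\<forall>d\<in>B. holo_transition c d \<and> holo_transition d c) \<longrightarrow> c \<in> B"
      by (rule spec)
    then show "c \<in> B" using ch tr by (intro mp[of "_ \<and> _" "c \<in> B"] conjI)
  qed
  from this[OF A B] this[OF B A] show ?thesis by (rule equalityI)
qed

lemma induced_surface: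
  assumes X: "riemann_surface X" and p: "local_homeo T (surf_top X) p"
  shows "surf_top (induced_surface X T p) = T"
    "complex_structure T (surf_charts (induced_surface X T p))"
    "holomorphic_map (induced_surface X T p) X p"
    "charted_cover (induced_surface X T p)"
proof -
  have "\<exists>!A. complex_structure T A \<and> holomorphic_map \<lparr>surf_top = T, surf_charts = A\<rparr> X p"
  proof (rule ex1I)
    show "complex_structure T (maximal_atlas T (pullback_charts T X p)) \<and>
       holomorphic_map \<lparr>surf_top = T, surf_charts = maximal_atlas T (pullback_charts T X p)\<rparr> X p"
      using induced_structure_ex[OF X p] by simp
    show "A = maximal_atlas T (pullback_charts T X p)"
      if "complex_structure T A \<and> holomorphic_map \<lparr>surf_top = T, surf_charts = A\<rparr> X p" for A
      by (rule induced_structure_unique[OF X p conjunct1[OF that] conjunct2[OF that] induced_structure_ex[OF X p]])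
  qed
  from theI'[OF this] have *: "complex_structure T (surf_charts (induced_surface X T p))"
    "holomorphic_map \<lparr>surf_top = T, surf_charts = surf_charts (induced_surface X T p)\<rparr> X p"
    by (simp_all add: induced_surface_def)
  show "surf_top (induced_surface X T p) = T" by (simp add: induced_surface_def)
  have eq: "\<lparr>surf_top = T, surf_charts = surf_charts (induced_surface X T p)\<rparr> = induced_surface X T p"
    by (simp add: induced_surface_def)
  show "complex_structure T (surf_charts (induced_surface X T p))" by (rule *(1))
  show "holomorphic_map (induced_surface X T p) X p" using *(2) unfolding eq .
  show "charted_cover (induced_surface X T p)"
    using complex_structure_charted_cover[OF *(1)] unfolding eq .
qed

section \<open>The fundamental group\<close>

lemma locally_path_connected_charted:
  assumes S: "charted_cover S"
  shows "locally_path_connected_space (surf_top S)"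
  unfolding locally_path_connected_space_def neighbourhood_base_of
proof (intro allI impI, elim conjE)
  fix W z assume W: "openin (surf_top S) W" "z \<in> W"
  have "z \<in> points S" using openin_subset[OF W(1)] W(2) by blast
  from charted_coverE[OF S this] obtain U \<phi> where
    U: "(U, \<phi>) \<in> surf_charts S" "z \<in> U" "is_chart (surf_top S) (U, \<phi>)" .
  have UW: "openin (surf_top S) (U \<inter> W)" using is_chartD(1)[OF U(3)] W(1) by (rule openin_Int)
  have "open (\<phi> ` (U \<inter> W))" by (rule is_chart_open_image[OF U(3) UW]) simp
  moreover have "\<phi> z \<in> \<phi> ` (U \<inter> W)" using U(2) W(2) by blast
  ultimately obtain r where r: "r > 0" "ball (\<phi> z) r \<subseteq> \<phi> ` (U \<inter> W)" by (rule openE)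
  let ?N = "{u \<in> U. \<phi> u \<in> ball (\<phi> z) r}"
  have oN: "openin (surf_top S) ?N" by (rule is_chart_open_preimage[OF U(3)]) simp
  have NW: "?N \<subseteq> W"
  proof
    fix u assume u: "u \<in> ?N"
    then obtain v where v: "v \<in> U \<inter> W" "\<phi> u = \<phi> v" using r(2) by auto
    then have "u = v" using is_chartD(3)[OF U(3)] u by (auto dest: inj_onD)
    then show "u \<in> W" using v by simp
  qed
  have Nim: "?N = inv_into U \<phi> ` ball (\<phi> z) r"
  proof (intro equalityI subsetI)
    fix u assume "u \<in> ?N"
    then show "u \<in> inv_into U \<phi> ` ball (\<phi> z) r"
      using is_chart_inv[OF U(3), of u] by (intro image_eqI[of _ _ "\<phi> u"]) auto
  next
    fix u assume "u \<in> inv_into U \<phi> ` ball (\<phi> z) r"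
    then obtain w where w: "w \<in> ball (\<phi> z) r" "u = inv_into U \<phi> w" by blast
    then obtain v where v: "v \<in> U" "w = \<phi> v" using r(2) by auto
    then show "u \<in> ?N" using w is_chart_inv[OF U(3), of v] by auto
  qed
  have sec: "continuous_map (top_of_set (\<phi> ` U)) (surf_top S) (inv_into U \<phi>)"
    using homeomorphic_map_section(3)[OF is_chartD(4)[OF U(3)] openin_subset[OF is_chartD(1)[OF U(3)]]]
    by (auto intro: continuous_map_into_fulltopology)
  have "path_connectedin (top_of_set (\<phi> ` U)) (ball (\<phi> z) r)"
    using r(2) by (auto simp: path_connectedin_subtopology intro: convex_imp_path_connected)
  then have "path_connectedin (surf_top S) ?N"
    unfolding Nim by (rule path_connectedin_continuous_map_image[OF sec])
  then show "\<exists>N V. openin (surf_top S) N \<and> path_connectedin (surf_top S) V \<and> z \<in> N \<and> N \<subseteq> V \<and> V \<subseteq> W"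
    using oN NW U(2) r(1) by (intro exI[of _ ?N]) simp
qed

text \<open>A complex derivative would make \<open>cnj\<close> complex linear, which its values at 1
  and at the imaginary unit exclude.\<close>

lemma cnj_not_holomorphic:
  assumes "cnj holomorphic_on D" "open D" "z \<in> D"
  shows False
proof -
  have 1: "(cnj has_derivative (*) (deriv cnj z)) (at z)"
    using holomorphic_derivI[OF assms] unfolding has_field_derivative_def .
  have "(cnj has_derivative cnj) (at z)" by (rule bounded_linear_imp_has_derivative) (rule bounded_linear_cnj)
  from has_derivative_unique[OF this 1] have *: "cnj v = deriv cnj z * v" for v by metis
  show False using *[of 1] *[of \<i>] by simp
qed

lemma antiholomorphic_not_id:
  assumes S: "charted_cover S" and s: "antiholomorphic_map S S s" and x: "x \<in> points S"
  obtains y where "y \<in> points S" "s y \<noteq> y"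
proof -
  have False if id: "\<And>y. y \<in> points S \<Longrightarrow> s y = y"
  proof -
    obtain U \<phi> where U: "(U, \<phi>) \<in> surf_charts S" "x \<in> U" "is_chart (surf_top S) (U, \<phi>)"
      using charted_coverE[OF S x] .
    have US: "U \<subseteq> points S" using openin_subset[OF is_chartD(1)[OF U(3)]] .
    have "(U, cnj \<circ> \<phi>) \<in> surf_charts (conj_surface S)"
      using U(1) by (auto simp: conj_surface_def intro: image_eqI[where x = "(U, \<phi>)"])
    from holomorphic_mapD[OF s[unfolded antiholomorphic_map_iff] U(1) this]
    have "((cnj \<circ> \<phi>) \<circ> s \<circ> inv_into U \<phi>) holomorphic_on \<phi> ` {y \<in> U. s y \<in> U}" .
    moreover have "{y \<in> U. s y \<in> U} = U" using US id by auto
    ultimately have "((cnj \<circ> \<phi>) \<circ> s \<circ> inv_into U \<phi>) holomorphic_on \<phi> ` U" by simp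
    then have "cnj holomorphic_on \<phi> ` U"
    proof (rule holomorphic_transform)
      fix z assume "z \<in> \<phi> ` U"
      then obtain u where u: "u \<in> U" "z = \<phi> u" by blast
      then show "((cnj \<circ> \<phi>) \<circ> s \<circ> inv_into U \<phi>) z = cnj z"
        using is_chart_inv[OF U(3) u(1)] id[OF subsetD[OF US u(1)]] by simp
    qed
    from cnj_not_holomorphic[OF this is_chartD(2)[OF U(3)] imageI[OF U(2)]] show False .
  qed
  then show ?thesis using that by blast
qed

lemma holomorphic_map_over:
  assumes S: "charted_cover S" and S': "charted_cover S'" and X: "charted_cover X"
    and q: "holomorphic_map S X q" and q': "holomorphic_map S' X q'" "local_homeo (surf_top S') (surf_top X) q'"
    and f: "continuous_map (surf_top S) (surf_top S') f"
    and qf: "\<And>y. y \<in> points S \<Longrightarrow> q' (f y) = q y"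
  shows "holomorphic_map S S' f"
proof (rule holomorphic_map_lift[OF _ _ X q' f])
  show "holomorphic_map S X (q' \<circ> f)"
    by (rule holomorphic_map_cong[OF charted_cover_charted[OF S] q]) (simp add: qf)
qed (use S S' charted_cover_charted in auto)

text \<open>Conjugating the charts of both \<open>S'\<close> and \<open>X\<close> keeps
  \<open>q'\<close> holomorphic and makes \<open>s \<circ> q\<close> holomorphic, so this reduces to
  \<open>holomorphic_map_over\<close>.\<close>

lemma antiholomorphic_map_over:
  assumes S: "charted_cover S" and S': "charted_cover S'" and X: "charted_cover X"
    and q: "holomorphic_map S X q" and q': "holomorphic_map S' X q'" "local_homeo (surf_top S') (surf_top X) q'"
    and s: "antiholomorphic_map X X s"
    and f: "continuous_map (surf_top S) (surf_top S') f"
    and qf: "\<And>y. y \<in> points S \<Longrightarrow> q' (f y) = s (q y)"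
  shows "antiholomorphic_map S S' f"
  unfolding antiholomorphic_map_iff
proof (rule holomorphic_map_over[OF S charted_cover_conj[OF S'] charted_cover_conj[OF X]])
  show "holomorphic_map S (conj_surface X) (s \<circ> q)"
    by (rule holomorphic_map_compose[OF charted_cover_charted[OF S] X
          charted_cover_charted[OF charted_cover_conj[OF X]] q s[unfolded antiholomorphic_map_iff]])
  show "holomorphic_map (conj_surface S') (conj_surface X) q'"
    by (rule holomorphic_map_conj[OF charted_cover_charted[OF S'] charted_cover_charted[OF X] q'(1)])
qed (use q' f qf in auto)

section \<open>Lifts from the universal cover\<close>

locale klein_universal_cover =
  fixes X :: "'x surface" and \<sigma> :: "'x \<Rightarrow> 'x" and x :: 'x
    and Xt :: "'t topology" and xt :: 't and p :: "'t \<Rightarrow> 'x"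
  assumes klein: "klein_surface X \<sigma>"
    and conn: "connected_space (surf_top X)"
    and x: "x \<in> points X"
    and univ: "universal_cover (surf_top X) x Xt xt p"
begin

abbreviation "T \<equiv> topspace Xt"
abbreviation "S \<equiv> induced_surface X Xt p"
abbreviation "G \<equiv> piR X \<sigma> Xt p"
abbreviation "N \<equiv> pi1 X \<sigma> Xt p"

lemma X_riemann: "riemann_surface X" and \<sigma>_anti: "antiholomorphic_map X X \<sigma>"
  and \<sigma>_\<sigma>: "y \<in> points X \<Longrightarrow> \<sigma> (\<sigma> y) = y"
  using klein by (auto simp: klein_surface_def)

lemma X_cover: "charted_cover X"
  using X_riemann by (rule riemann_surface_charted_cover)

lemma \<sigma>_cont: "continuous_map (surf_top X) (surf_top X) \<sigma>"
  using \<sigma>_anti by (simp add: antiholomorphic_map_def map_in_charts_def)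

lemma p_cov: "covering_map Xt (surf_top X) p" and T_sc: "simply_connected_space Xt"
  and xt: "xt \<in> T" and p_xt: "p xt = x"
  using univ by (auto simp: universal_cover_def)

lemma p_homeo: "local_homeo Xt (surf_top X) p"
  using p_cov by (rule covering_map_local_homeo)

lemma p_cont: "continuous_map Xt (surf_top X) p"
  using p_cov by (rule covering_map_continuous)

lemma p_in: "z \<in> T \<Longrightarrow> p z \<in> points X"
  by (rule continuous_map_in[OF p_cont])

lemmas S_surf = induced_surface[OF X_riemann p_homeo]

lemma T_lpc: "locally_path_connected_space Xt"
  using locally_path_connected_charted[OF S_surf(4)] S_surf(1) by simp

lemma T_conn: "connected_space Xt"
  using T_sc by (simp add: simply_connected_space_def path_connected_imp_connected_space)

lemma p_surj: "p ` T = points X"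
  by (rule covering_map_surj[OF p_cov conn]) (use xt in auto)

lemma \<sigma>_nontrivial: obtains z where "z \<in> T" "\<sigma> (p z) \<noteq> p z"
proof -
  obtain y where y: "y \<in> points X" "\<sigma> y \<noteq> y" using antiholomorphic_not_id[OF X_cover \<sigma>_anti x] .
  then obtain z where "z \<in> T" "y = p z" using p_surj by (metis imageE)
  then show ?thesis using that y by blast
qed

lemma base_cont: "s \<in> {id, \<sigma>} \<Longrightarrow> continuous_map (surf_top X) (surf_top X) s"
  using \<sigma>_cont by auto

lemma base_invol: "s \<in> {id, \<sigma>} \<Longrightarrow> y \<in> points X \<Longrightarrow> s (s y) = y"
  using \<sigma>_\<sigma> by auto

text \<open>With \<open>s = id\<close> this yields the maps \<open>t_y\<close> and the deck
  transformations, with \<open>s = \<sigma>\<close> the elements of \<open>G\<close> outside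
  \<open>N\<close>.\<close>

lemma lift:
  assumes q: "covering_map E (surf_top X) q" and s: "s \<in> {id, \<sigma>}" and z: "z \<in> T"
    and e: "e \<in> topspace E" "q e = s (p z)"
  obtains h where "continuous_map Xt E h" "h z = e" "\<And>u. u \<in> T \<Longrightarrow> q (h u) = s (p u)"
proof -
  have "continuous_map Xt (surf_top X) (s \<circ> p)"
    by (rule continuous_map_compose[OF p_cont base_cont[OF s]])
  from lift_exists[OF q T_sc T_lpc this z e(1)] e(2)
  obtain h where "continuous_map Xt E h" "h z = e" "\<And>u. u \<in> T \<Longrightarrow> q (h u) = (s \<circ> p) u" by auto
  then show ?thesis using that[of h] by simp
qed

lemma lift_unique:
  assumes "covering_map E (surf_top X) q" "continuous_map Xt E h" "continuous_map Xt E k"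
    "\<And>u. u \<in> T \<Longrightarrow> q (h u) = q (k u)" "w \<in> T" "h w = k w" "z \<in> T"
  shows "h z = k z"
  by (rule unique_lift[OF assms(1) T_conn assms(2,3)]) (use assms in auto)

lemma over_smooth:
  assumes f: "continuous_map Xt Xt f" and s: "s \<in> {id, \<sigma>}" and pf: "\<And>z. z \<in> T \<Longrightarrow> p (f z) = s (p z)"
  shows "smooth_map S S f"
proof (rule smooth_mapI)
  note * = S_surf(4) S_surf(4) X_cover S_surf(3) S_surf(3)
  from s consider "s = id" | "s = \<sigma>" by auto
  then show "holomorphic_map S S f \<or> antiholomorphic_map S S f"
  proof cases
    case 1
    have "holomorphic_map S S f"
      by (rule holomorphic_map_over[OF *]) (use p_homeo f pf 1 S_surf(1) in auto)
    then show ?thesis ..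
  next
    case 2
    have "antiholomorphic_map S S f"
      by (rule antiholomorphic_map_over[OF * _ \<sigma>_anti]) (use p_homeo f pf 2 S_surf(1) in auto)
    then show ?thesis ..
  qed
qed (use charted_cover_charted[OF S_surf(4)] in auto)

section \<open>Elements of the fundamental group and the group law\<close>

text \<open>The inverse \<open>g\<close> lies over the same \<open>s\<close>, because
  \<open>s\<close> is an involution on the points of \<open>X\<close>; hence it is smooth for the
  same reason as \<open>f\<close>.\<close>

lemma piRI:
  assumes f: "continuous_map Xt Xt f" and g: "continuous_map Xt Xt g"
    and fg: "\<And>z. z \<in> T \<Longrightarrow> f (g z) = z" and gf: "\<And>z. z \<in> T \<Longrightarrow> g (f z) = z"
    and s: "s \<in> {id, \<sigma>}" and pf: "\<And>z. z \<in> T \<Longrightarrow> p (f z) = s (p z)"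
  shows "restrict f T \<in> carrier G"
proof -
  let ?f = "restrict f T"
  note fT = continuous_map_in[OF f] and gT = continuous_map_in[OF g]
  have bij: "bij_betw ?f T T"
    by (rule bij_betw_byWitness[where f' = g]) (use fg gf fT gT in auto)
  have inv: "inv_into T ?f z = g z" if z: "z \<in> T" for z
  proof -
    have "?f (g z) = z" using fg gT z by simp
    then show ?thesis using bij_betw_imp_inj_on[OF bij] gT[OF z] by (metis inv_into_f_f)
  qed
  have pg: "p (g z) = s (p z)" if z: "z \<in> T" for z
    using pf[OF gT[OF z]] fg[OF z] base_invol[OF s p_in[OF gT[OF z]]] by simp
  have "smooth_map S S ?f"
    by (rule over_smooth[OF continuous_map_eq[OF f] s]) (use pf in auto)
  moreover have "smooth_map S S (inv_into T ?f)"
  proof (rule over_smooth[OF _ s])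
    show "continuous_map Xt Xt (inv_into T ?f)"
      by (rule continuous_map_eq[OF g]) (simp add: inv)
    show "p (inv_into T ?f z) = s (p z)" if "z \<in> T" for z using inv pg that by simp
  qed
  ultimately have "diffeomorphism S S ?f"
    using bij S_surf(1) by (simp add: diffeomorphism_def)
  moreover have "\<exists>s\<in>{id, \<sigma>}. \<forall>z\<in>T. p (?f z) = s (p z)" using s pf by (intro bexI[of _ s]) auto
  ultimately show ?thesis by (simp add: piR_def)
qed

lemma piRE:
  assumes "f \<in> carrier G"
  obtains s where "s \<in> {id, \<sigma>}" "\<And>z. z \<in> T \<Longrightarrow> p (f z) = s (p z)" "f \<in> extensional T" "bij_betw f T T"
    "continuous_map Xt Xt f" "continuous_map Xt Xt (inv_into T f)"
proof -
  have "\<exists>s\<in>{id, \<sigma>}. \<forall>z\<in>T. p (f z) = s (p z)" and ext: "f \<in> extensional T" and d: "diffeomorphism S S f"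
    using assms by (auto simp: piR_def)
  then obtain s where s: "s \<in> {id, \<sigma>}" "\<forall>z\<in>T. p (f z) = s (p z)" by blast
  have "bij_betw f T T" "continuous_map Xt Xt f" "continuous_map Xt Xt (inv_into T f)"
    using d S_surf(1) by (simp_all add: diffeomorphism_def smooth_map_def map_in_charts_def)
  then show ?thesis using that[OF s(1) _ ext] s(2) by simp
qed

text \<open>One lift of \<open>s \<circ> p\<close> sends \<open>z\<close> to \<open>w\<close>,
  another sends \<open>w\<close> back to \<open>z\<close>. Their composites lie over the identity
  and fix a point, so unique lifting makes them mutually inverse.\<close>

lemma piR_lift:
  assumes s: "s \<in> {id, \<sigma>}" and zw: "z \<in> T" "w \<in> T" "p w = s (p z)"
  obtains f where "f \<in> carrier G" "f z = w" "\<And>u. u \<in> T \<Longrightarrow> p (f u) = s (p u)"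
proof -
  obtain f where f: "continuous_map Xt Xt f" "f z = w" "\<And>u. u \<in> T \<Longrightarrow> p (f u) = s (p u)"
    using lift[OF p_cov s zw] by metis
  have "p z = s (p w)" using zw(3) base_invol[OF s p_in[OF zw(1)]] by simp
  then obtain g where g: "continuous_map Xt Xt g" "g w = z" "\<And>u. u \<in> T \<Longrightarrow> p (g u) = s (p u)"
    using lift[OF p_cov s zw(2,1)] by metis
  note fT = continuous_map_in[OF f(1)] and gT = continuous_map_in[OF g(1)]
  have fg: "f (g u) = u" if "u \<in> T" for u
    by (rule lift_unique[OF p_cov continuous_map_compose[OF g(1) f(1), unfolded o_def] _ _ zw(2)])
      (use f g gT base_invol[OF s p_in] that in auto)
  have gf: "g (f u) = u" if "u \<in> T" for u
    by (rule lift_unique[OF p_cov continuous_map_compose[OF f(1) g(1), unfolded o_def] _ _ zw(1)])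
      (use f g fT base_invol[OF s p_in] that in auto)
  have "restrict f T \<in> carrier G" by (rule piRI[OF f(1) g(1) fg gf s f(3)])
  then show ?thesis using that[of "restrict f T"] zw(1) f by simp
qed

lemma piR_mult: "f \<in> carrier G \<Longrightarrow> z \<in> T \<Longrightarrow> (f \<otimes>\<^bsub>G\<^esub> g) z = g (f z)"
  by (simp add: piR_def compose_def)

lemma piR_one: "z \<in> T \<Longrightarrow> \<one>\<^bsub>G\<^esub> z = z"
  by (simp add: piR_def)

lemma piR_in: "f \<in> carrier G \<Longrightarrow> z \<in> T \<Longrightarrow> f z \<in> T"
  by (elim piRE) (auto dest: continuous_map_in)

lemma piR_ext: "f \<in> carrier G \<Longrightarrow> g \<in> carrier G \<Longrightarrow> (\<And>z. z \<in> T \<Longrightarrow> f z = g z) \<Longrightarrow> f = g"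
  by (elim piRE) (auto intro: extensionalityI)

lemma piR_mult_closed:
  assumes "f \<in> carrier G" "g \<in> carrier G"
  shows "f \<otimes>\<^bsub>G\<^esub> g \<in> carrier G"
proof -
  obtain s where s: "s \<in> {id, \<sigma>}" "\<And>z. z \<in> T \<Longrightarrow> p (f z) = s (p z)" "bij_betw f T T"
    "continuous_map Xt Xt f" "continuous_map Xt Xt (inv_into T f)" using piRE[OF assms(1)] by metis
  obtain t where t: "t \<in> {id, \<sigma>}" "\<And>z. z \<in> T \<Longrightarrow> p (g z) = t (p z)" "bij_betw g T T"
    "continuous_map Xt Xt g" "continuous_map Xt Xt (inv_into T g)" using piRE[OF assms(2)] by metis
  \<comment> \<open>The product in the two-element group on \<open>{id, \<sigma>}\<close>. Two
    factors \<open>\<sigma>\<close> cancel only on the points of \<open>X\<close>, so the value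
    \<open>id\<close> is entered by hand.\<close>
  let ?r = "if s = id then t else if t = id then s else id"
  have "restrict (g \<circ> f) T \<in> carrier G"
  proof (rule piRI[of _ "inv_into T f \<circ> inv_into T g" ?r])
    show "?r \<in> {id, \<sigma>}" using s(1) t(1) by auto
    show "continuous_map Xt Xt (g \<circ> f)" by (rule continuous_map_compose[OF s(4) t(4)])
    show "continuous_map Xt Xt (inv_into T f \<circ> inv_into T g)" by (rule continuous_map_compose[OF t(5) s(5)])
    fix z assume z: "z \<in> T"
    have fz: "f z \<in> T" using piR_in assms z by blast
    have gz: "inv_into T g z \<in> T" using continuous_map_in[OF t(5) z] .
    show "(g \<circ> f) ((inv_into T f \<circ> inv_into T g) z) = z"
      using bij_betw_inv_into_right[OF s(3) gz] bij_betw_inv_into_right[OF t(3) z] by simp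
    show "(inv_into T f \<circ> inv_into T g) ((g \<circ> f) z) = z"
      using bij_betw_inv_into_left[OF s(3) z] bij_betw_inv_into_left[OF t(3) fz] by simp
    have "t (s (p z)) = ?r (p z)" using s(1) t(1) base_invol[OF s(1) p_in[OF z]] by auto
    then show "p ((g \<circ> f) z) = ?r (p z)" using t(2)[OF fz] s(2)[OF z] by simp
  qed
  moreover have "f \<otimes>\<^bsub>G\<^esub> g = restrict (g \<circ> f) T" by (simp add: piR_def compose_def o_def)
  ultimately show ?thesis by simp
qed

lemma piR_one_closed: "\<one>\<^bsub>G\<^esub> \<in> carrier G"
proof -
  have "restrict (\<lambda>z. z) T \<in> carrier G" by (rule piRI[of _ "\<lambda>z. z" id]) auto
  then show ?thesis by (simp add: piR_def)
qed

lemma piR_group: "group G"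
proof (rule groupI)
  show "\<one>\<^bsub>G\<^esub> \<in> carrier G" by (rule piR_one_closed)
  show mc: "f \<otimes>\<^bsub>G\<^esub> g \<in> carrier G" if "f \<in> carrier G" "g \<in> carrier G" for f g
    using piR_mult_closed that .
  show "f \<otimes>\<^bsub>G\<^esub> g \<otimes>\<^bsub>G\<^esub> h = f \<otimes>\<^bsub>G\<^esub> (g \<otimes>\<^bsub>G\<^esub> h)"
    if "f \<in> carrier G" "g \<in> carrier G" "h \<in> carrier G" for f g h
    by (rule piR_ext) (use that mc piR_in in \<open>auto simp: piR_mult\<close>)
  show "\<one>\<^bsub>G\<^esub> \<otimes>\<^bsub>G\<^esub> f = f" if "f \<in> carrier G" for f
    by (rule piR_ext) (use that mc piR_one_closed in \<open>auto simp: piR_mult piR_one\<close>)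
  show "\<exists>g\<in>carrier G. g \<otimes>\<^bsub>G\<^esub> f = \<one>\<^bsub>G\<^esub>" if f: "f \<in> carrier G" for f
  proof -
    obtain s where s: "s \<in> {id, \<sigma>}" "\<And>z. z \<in> T \<Longrightarrow> p (f z) = s (p z)" "bij_betw f T T"
      "continuous_map Xt Xt f" "continuous_map Xt Xt (inv_into T f)" using piRE[OF f] by metis
    note gT = continuous_map_in[OF s(5)]
    let ?g = "restrict (inv_into T f) T"
    have g: "?g \<in> carrier G"
    proof (rule piRI[OF s(5,4) _ _ s(1)])
      fix z assume z: "z \<in> T"
      show "inv_into T f (f z) = z" "f (inv_into T f z) = z"
        using bij_betw_inv_into_left[OF s(3) z] bij_betw_inv_into_right[OF s(3) z] by auto
      then have "p z = s (p (inv_into T f z))" using s(2)[OF gT[OF z]] by simp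
      then show "p (inv_into T f z) = s (p z)" using base_invol[OF s(1) p_in[OF gT[OF z]]] by simp
    qed
    have "?g \<otimes>\<^bsub>G\<^esub> f = \<one>\<^bsub>G\<^esub>"
      by (rule piR_ext) (use g f mc piR_one_closed bij_betw_inv_into_right[OF s(3)] in \<open>auto simp: piR_mult piR_one\<close>)
    then show ?thesis using g by blast
  qed
qed

sublocale piR: group G
  by (rule piR_group)

lemma piR_inv:
  assumes "f \<in> carrier G" "z \<in> T"
  shows "(inv\<^bsub>G\<^esub> f) z \<in> T" "f ((inv\<^bsub>G\<^esub> f) z) = z" "(inv\<^bsub>G\<^esub> f) (f z) = z"
proof -
  have i: "inv\<^bsub>G\<^esub> f \<in> carrier G" using assms by simp
  show "(inv\<^bsub>G\<^esub> f) z \<in> T" using piR_in[OF i assms(2)] .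
  show "f ((inv\<^bsub>G\<^esub> f) z) = z"
    using piR_mult[OF i assms(2), of f] piR.l_inv[OF assms(1)] piR_one[OF assms(2)] by simp
  show "(inv\<^bsub>G\<^esub> f) (f z) = z"
    using piR_mult[OF assms, of "inv\<^bsub>G\<^esub> f"] piR.r_inv[OF assms(1)] piR_one[OF assms(2)] by simp
qed

lemma piR_cont: "f \<in> carrier G \<Longrightarrow> continuous_map Xt Xt f"
  by (elim piRE)

section \<open>The subgroup over the identity and its index\<close>

lemma pi1_iff: "f \<in> N \<longleftrightarrow> f \<in> carrier G \<and> (\<forall>z\<in>T. p (f z) = p z)"
  by (simp add: pi1_def)

lemma pi1_carrier: "f \<in> N \<Longrightarrow> f \<in> carrier G" and pi1_p: "f \<in> N \<Longrightarrow> z \<in> T \<Longrightarrow> p (f z) = p z"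
  by (simp_all add: pi1_iff)

lemma not_pi1_p:
  assumes "f \<in> carrier G" "f \<notin> N" "z \<in> T"
  shows "p (f z) = \<sigma> (p z)"
proof -
  obtain s where s: "s \<in> {id, \<sigma>}" "\<And>z. z \<in> T \<Longrightarrow> p (f z) = s (p z)" using piRE[OF assms(1)] by metis
  have "s \<noteq> id"
  proof
    assume "s = id"
    then have "f \<in> N" using s(2) assms(1) by (simp add: pi1_iff)
    then show False using assms(2) by simp
  qed
  then show ?thesis using s assms(3) by auto
qed

text \<open>A map could lie over both \<open>id\<close> and \<open>\<sigma>\<close> if they agreed
  on \<open>X\<close>; \<open>\<sigma>_nontrivial\<close> rules this out.\<close>

lemma not_pi1I:
  assumes "\<And>z. z \<in> T \<Longrightarrow> p (f z) = \<sigma> (p z)"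
  shows "f \<notin> N"
  using \<sigma>_nontrivial assms pi1_p by metis

lemma pi1_transitive:
  assumes "z \<in> T" "w \<in> T" "p w = p z"
  obtains f where "f \<in> N" "f z = w"
proof -
  obtain f where "f \<in> carrier G" "f z = w" "\<And>u. u \<in> T \<Longrightarrow> p (f u) = id (p u)"
    using piR_lift[of id z w] assms by auto
  then show ?thesis using that[of f] by (simp add: pi1_iff)
qed

lemma pi1_free:
  assumes "f \<in> N" "z \<in> T" "f z = z"
  shows "f = \<one>\<^bsub>G\<^esub>"
proof (rule piR_ext)
  show "f \<in> carrier G" using assms(1) by (rule pi1_carrier)
  show "\<one>\<^bsub>G\<^esub> \<in> carrier G" by simp
  fix u assume u: "u \<in> T"
  have "f u = id u"
    by (rule lift_unique[OF p_cov piR_cont[OF pi1_carrier[OF assms(1)]] continuous_map_id _ assms(2) _ u])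
      (use assms pi1_p in auto)
  then show "f u = \<one>\<^bsub>G\<^esub> u" using piR_one[OF u] by simp
qed

text \<open>Surjectivity of \<open>p\<close> provides a point over \<open>\<sigma> x\<close>, hence
  a lift of \<open>\<sigma>\<close>. Its existence makes the index two rather than one and gives the
  description in \<open>Q_inv\<close> something to range over.\<close>

lemma not_pi1_ex: obtains h where "h \<in> carrier G" "h \<notin> N"
proof -
  have "\<sigma> x \<in> points X" using continuous_map_in[OF \<sigma>_cont x] .
  then obtain w where w: "w \<in> T" "\<sigma> x = p w" using p_surj by (metis imageE)
  then obtain f where "f \<in> carrier G" "\<And>u. u \<in> T \<Longrightarrow> p (f u) = \<sigma> (p u)"
    using piR_lift[of \<sigma> xt w] xt p_xt by auto
  then show ?thesis using that not_pi1I by blast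
qed

text \<open>Lying over \<open>\<sigma>\<close> is a parity: it adds up under multiplication, as
  \<open>\<sigma>\<close> cancels itself. Normality, the index, the independence of \<open>h\<close>
  in the quotient and the multiplicativity of \<open>tau_of\<close> all rest on this.\<close>

lemma pi1_mult_iff:
  assumes "f \<in> carrier G" "g \<in> carrier G"
  shows "f \<otimes>\<^bsub>G\<^esub> g \<in> N \<longleftrightarrow> (f \<in> N \<longleftrightarrow> g \<in> N)"
proof -
  have c: "f \<otimes>\<^bsub>G\<^esub> g \<in> carrier G" using assms by simp
  have fT: "f z \<in> T" if "z \<in> T" for z using piR_in assms(1) that by blast
  have f: "p (f z) = (if f \<in> N then p z else \<sigma> (p z))" if "z \<in> T" for z
    using pi1_p not_pi1_p assms(1) that by auto
  have g: "p (g z) = (if g \<in> N then p z else \<sigma> (p z))" if "z \<in> T" for z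
    using pi1_p not_pi1_p assms(2) that by auto
  have fg: "p ((f \<otimes>\<^bsub>G\<^esub> g) z) = (if f \<in> N \<longleftrightarrow> g \<in> N then p z else \<sigma> (p z))" if z: "z \<in> T" for z
    using piR_mult[OF assms(1) z, of g] g[OF fT[OF z]] f[OF z] \<sigma>_\<sigma>[OF p_in[OF z]] by auto
  show ?thesis
  proof (cases "f \<in> N \<longleftrightarrow> g \<in> N")
    case True
    then have "\<forall>z\<in>T. p ((f \<otimes>\<^bsub>G\<^esub> g) z) = p z" using fg by auto
    then have "f \<otimes>\<^bsub>G\<^esub> g \<in> N" using c by (simp add: pi1_iff)
    then show ?thesis using True by blast
  next
    case False
    then have "f \<otimes>\<^bsub>G\<^esub> g \<notin> N" using fg by (intro not_pi1I) auto
    then show ?thesis using False by blast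
  qed
qed

lemma one_pi1: "\<one>\<^bsub>G\<^esub> \<in> N"
  by (simp add: pi1_iff piR_one)

lemma inv_pi1_iff:
  assumes "f \<in> carrier G"
  shows "inv\<^bsub>G\<^esub> f \<in> N \<longleftrightarrow> f \<in> N"
  using pi1_mult_iff[of "inv\<^bsub>G\<^esub> f" f] assms one_pi1 by simp

text \<open>\<open>k\<close> is the parity as a homomorphism onto the integers mod 2; the first
  isomorphism theorem then gives normality and index.\<close>

lemma pi1_kernel:
  defines "k \<equiv> \<lambda>f. if f \<in> N then 0 else 1 :: int"
  shows "group_hom G (integer_mod_group 2) k" "kernel G (integer_mod_group 2) k = N"
    "k ` carrier G = carrier (integer_mod_group 2)"
proof -
  have "k \<in> hom G (integer_mod_group 2)"
    by (rule homI) (auto simp: k_def carrier_integer_mod_group pi1_mult_iff)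
  then show "group_hom G (integer_mod_group 2) k"
    using piR_group by (simp add: group_hom_def group_hom_axioms_def)
  show "kernel G (integer_mod_group 2) k = N"
    by (auto simp: kernel_def k_def dest: pi1_carrier)
  obtain h where "h \<in> carrier G" "h \<notin> N" using not_pi1_ex .
  then have "1 \<in> k ` carrier G" by (intro image_eqI[of _ _ h]) (simp_all add: k_def)
  moreover have "0 \<in> k ` carrier G"
    using one_pi1 by (intro image_eqI[of _ _ "\<one>\<^bsub>G\<^esub>"]) (simp_all add: k_def)
  moreover have "carrier (integer_mod_group 2) = {0, 1}" by (auto simp: carrier_integer_mod_group)
  moreover have "k ` carrier G \<subseteq> {0, 1}" by (auto simp: k_def)
  ultimately show "k ` carrier G = carrier (integer_mod_group 2)" by auto
qed

lemma pi1_normal: "N \<lhd> G" and pi1_index_two: "G Mod N \<cong> integer_mod_group 2"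
  using group_hom.normal_kernel[OF pi1_kernel(1)] group_hom.FactGroup_iso[OF pi1_kernel(1) pi1_kernel(3)]
  unfolding pi1_kernel(2) by simp_all

end

section \<open>The quotient construction\<close>

lemma openin_quotient_topology:
  "openin (quotient_topology Z k) U \<longleftrightarrow> U \<subseteq> k ` topspace Z \<and> openin Z {z \<in> topspace Z. k z \<in> U}"
proof -
  have "istopology (\<lambda>U. U \<subseteq> k ` topspace Z \<and> openin Z {z \<in> topspace Z. k z \<in> U})"
    unfolding istopology_def
  proof (rule conjI; intro allI impI)
    fix U V assume U: "U \<subseteq> k ` topspace Z \<and> openin Z {z \<in> topspace Z. k z \<in> U}"
      and V: "V \<subseteq> k ` topspace Z \<and> openin Z {z \<in> topspace Z. k z \<in> V}"
    have "{z \<in> topspace Z. k z \<in> U \<inter> V} = {z \<in> topspace Z. k z \<in> U} \<inter> {z \<in> topspace Z. k z \<in> V}" by auto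
    then show "U \<inter> V \<subseteq> k ` topspace Z \<and> openin Z {z \<in> topspace Z. k z \<in> U \<inter> V}"
      using U V by (auto simp: openin_Int)
  next
    fix K assume K: "\<forall>U\<in>K. U \<subseteq> k ` topspace Z \<and> openin Z {z \<in> topspace Z. k z \<in> U}"
    have "{z \<in> topspace Z. k z \<in> \<Union>K} = (\<Union>U\<in>K. {z \<in> topspace Z. k z \<in> U})" by auto
    then show "\<Union>K \<subseteq> k ` topspace Z \<and> openin Z {z \<in> topspace Z. k z \<in> \<Union>K}"
      using K by auto
  qed
  then show ?thesis by (simp add: quotient_topology_def)
qed

lemma topspace_quotient_topology: "topspace (quotient_topology Z k) = k ` topspace Z"
proof (rule equalityI)
  show "topspace (quotient_topology Z k) \<subseteq> k ` topspace Z"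
    using openin_topspace[of "quotient_topology Z k"] unfolding openin_quotient_topology by (rule conjunct1)
  have "{z \<in> topspace Z. k z \<in> k ` topspace Z} = topspace Z" by auto
  then have "openin (quotient_topology Z k) (k ` topspace Z)" by (simp add: openin_quotient_topology)
  then show "k ` topspace Z \<subseteq> topspace (quotient_topology Z k)" by (rule openin_subset)
qed

lemma quotient_map_quotient_topology: "quotient_map Z (quotient_topology Z k) k"
  unfolding quotient_map_def topspace_quotient_topology openin_quotient_topology by simp

lemma openin_times_singleton:
  assumes "v \<in> E" "openin Z W"
  shows "openin (prod_topology Z (discrete_topology E)) (W \<times> {v})"
  using assms by (simp add: openin_prod_Times_iff)

lemma continuous_map_prod_discrete:
  assumes g: "\<And>v. v \<in> E \<Longrightarrow> continuous_map Z Y (\<lambda>y. g (y, v))"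
  shows "continuous_map (prod_topology Z (discrete_topology E)) Y g"
  unfolding continuous_map_def
proof (intro conjI allI impI)
  show "g \<in> topspace (prod_topology Z (discrete_topology E)) \<rightarrow> topspace Y"
    using continuous_map_in[OF g] by auto
  fix W assume W: "openin Y W"
  have "{z \<in> topspace (prod_topology Z (discrete_topology E)). g z \<in> W} =
      (\<Union>v\<in>E. {y \<in> topspace Z. g (y, v) \<in> W} \<times> {v})" by auto
  moreover have "openin (prod_topology Z (discrete_topology E)) \<dots>"
    using openin_preimage[OF g W] by (intro openin_Union ballI) (auto intro: openin_times_singleton)
  ultimately show "openin (prod_topology Z (discrete_topology E))
      {z \<in> topspace (prod_topology Z (discrete_topology E)). g z \<in> W}" by simp
qed

lemma homeomorphic_map_sectionI:
  assumes V: "V \<subseteq> topspace Y" and U: "U \<subseteq> topspace Z"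
    and f: "continuous_map Y Z f" and g: "continuous_map (subtopology Z U) Y g"
    and fV: "\<And>b. b \<in> V \<Longrightarrow> f b \<in> U \<and> g (f b) = b" and gU: "\<And>u. u \<in> U \<Longrightarrow> g u \<in> V \<and> f (g u) = u"
  shows "homeomorphic_map (subtopology Y V) (subtopology Z U) f"
proof -
  have "continuous_map (subtopology Y V) (subtopology Z U) f"
    using continuous_map_from_subtopology[OF f] fV by (auto simp: continuous_map_in_subtopology)
  moreover have "continuous_map (subtopology Z U) (subtopology Y V) g"
    using g gU by (auto simp: continuous_map_in_subtopology)
  ultimately have "homeomorphic_maps (subtopology Y V) (subtopology Z U) f g"
    using fV gU by (simp add: homeomorphic_maps_def)
  then show ?thesis by (rule homeomorphic_maps_imp_map)
qed

lemma group_action_facts: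
  assumes "group_action G E \<rho>"
  shows "g \<in> carrier G \<Longrightarrow> v \<in> E \<Longrightarrow> \<rho> g v \<in> E"
    "g \<in> carrier G \<Longrightarrow> h \<in> carrier G \<Longrightarrow> v \<in> E \<Longrightarrow> \<rho> (g \<otimes>\<^bsub>G\<^esub> h) v = \<rho> g (\<rho> h v)"
    "v \<in> E \<Longrightarrow> \<rho> \<one>\<^bsub>G\<^esub> v = v"
proof -
  show "\<rho> g v \<in> E" if "g \<in> carrier G" "v \<in> E"
    by (rule group_action.element_image[OF assms that refl])
  show "\<rho> (g \<otimes>\<^bsub>G\<^esub> h) v = \<rho> g (\<rho> h v)" if "g \<in> carrier G" "h \<in> carrier G" "v \<in> E"
    by (rule group_action.composition_rule[OF assms that(3,1,2)])
  show "\<rho> \<one>\<^bsub>G\<^esub> v = v" if "v \<in> E"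
    using fun_cong[OF group_action.id_eq_one[OF assms], of v] that by simp
qed

text \<open>Each \<open>\<rho> g\<close> is bijective because the inverse element acts as its
  inverse; extensionality is the other condition for membership in \<open>Bij E\<close>.\<close>

lemma group_actionI:
  assumes G: "group G"
    and ext: "\<And>g. g \<in> carrier G \<Longrightarrow> \<rho> g \<in> extensional E"
    and cl: "\<And>g v. g \<in> carrier G \<Longrightarrow> v \<in> E \<Longrightarrow> \<rho> g v \<in> E"
    and mult: "\<And>g h v. g \<in> carrier G \<Longrightarrow> h \<in> carrier G \<Longrightarrow> v \<in> E \<Longrightarrow> \<rho> (g \<otimes>\<^bsub>G\<^esub> h) v = \<rho> g (\<rho> h v)"
    and one: "\<And>v. v \<in> E \<Longrightarrow> \<rho> \<one>\<^bsub>G\<^esub> v = v"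
  shows "group_action G E \<rho>"
proof -
  interpret group G by (rule G)
  have bij: "\<rho> g \<in> Bij E" if g: "g \<in> carrier G" for g
  proof -
    have i: "inv\<^bsub>G\<^esub> g \<in> carrier G" using g by simp
    have "bij_betw (\<rho> g) E E"
    proof (rule bij_betw_byWitness[where f' = "\<rho> (inv\<^bsub>G\<^esub> g)"])
      show "\<forall>v\<in>E. \<rho> (inv\<^bsub>G\<^esub> g) (\<rho> g v) = v" using mult[OF i g] one l_inv[OF g] by auto
      show "\<forall>v\<in>E. \<rho> g (\<rho> (inv\<^bsub>G\<^esub> g) v) = v" using mult[OF g i] one r_inv[OF g] by auto
    qed (use cl g i in auto)
    then show ?thesis using ext[OF g] by (simp add: Bij_def)
  qed
  have "\<rho> \<in> hom G (BijGroup E)"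
  proof (rule homI)
    show "\<rho> g \<in> carrier (BijGroup E)" if "g \<in> carrier G" for g using bij[OF that] by (simp add: BijGroup_def)
    fix g h assume gh: "g \<in> carrier G" "h \<in> carrier G"
    have "\<rho> (g \<otimes>\<^bsub>G\<^esub> h) = compose E (\<rho> g) (\<rho> h)"
      by (rule extensionalityI[of _ E]) (use ext gh mult in \<open>auto simp: compose_def\<close>)
    then show "\<rho> (g \<otimes>\<^bsub>G\<^esub> h) = \<rho> g \<otimes>\<^bsub>BijGroup E\<^esub> \<rho> h"
      using bij gh by (simp add: BijGroup_def)
  qed
  then have "group_hom G (BijGroup E) \<rho>"
    using G group_BijGroup by (simp add: group_hom_def group_hom_axioms_def)
  then show ?thesis by (simp add: group_action_def)
qed

section \<open>The real cover attached to a group set\<close>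

text \<open>\<open>code_meet\<close> weakens injectivity to what naming by representatives can
  offer: distinct sets may share a name if they meet. For orbits, which are equal or disjoint, that
  is enough.\<close>

locale klein_quotient = klein_universal_cover X \<sigma> x Xt xt p
  for X :: "'x surface" and \<sigma> :: "'x \<Rightarrow> 'x" and x :: 'x
    and Xt :: "'t topology" and xt :: 't and p :: "'t \<Rightarrow> 'x" +
  fixes code :: "('t \<times> 'f) set \<Rightarrow> 'c"
  assumes code_meet: "A \<noteq> {} \<Longrightarrow> B \<noteq> {} \<Longrightarrow> code A = code B \<Longrightarrow> A \<inter> B \<noteq> {}"
begin

context
  fixes E :: "'f set" and \<rho> :: "('t \<Rightarrow> 't) \<Rightarrow> 'f \<Rightarrow> 'f"
  assumes act: "group_action G E \<rho>"
begin

abbreviation "c \<equiv> cls code X \<sigma> Xt p (E, \<rho>)"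
abbreviation "QT \<equiv> Q_top code X \<sigma> Xt p (E, \<rho>)"
abbreviation "qm \<equiv> Q_map code X \<sigma> Xt p (E, \<rho>)"
abbreviation "qi \<equiv> Q_inv code X \<sigma> Xt p (E, \<rho>)"
abbreviation "orb \<equiv> orbit (G\<lparr>carrier := N\<rparr>) (diag_act G \<rho>)"

lemmas \<rho>_facts = group_action_facts[OF act]

lemma \<rho>_inv:
  assumes "f \<in> carrier G" "v \<in> E"
  shows "\<rho> (inv\<^bsub>G\<^esub> f) (\<rho> f v) = v" "\<rho> f (\<rho> (inv\<^bsub>G\<^esub> f) v) = v"
  using \<rho>_facts(2)[of "inv\<^bsub>G\<^esub> f" f v] \<rho>_facts(2)[of f "inv\<^bsub>G\<^esub> f" v] \<rho>_facts(3)[of v] assms by simp_all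

text \<open>The inverse reverses the order of a product and the group law reverses composition, so
  the two reversals cancel and a left action results.\<close>

lemma diag_act_mult:
  assumes "f \<in> carrier G" "g \<in> carrier G" "y \<in> T" "v \<in> E"
  shows "diag_act G \<rho> (f \<otimes>\<^bsub>G\<^esub> g) (y, v) = diag_act G \<rho> f (diag_act G \<rho> g (y, v))"
proof -
  have i: "inv\<^bsub>G\<^esub> f \<in> carrier G" "inv\<^bsub>G\<^esub> g \<in> carrier G" using assms by simp_all
  show ?thesis
    using \<rho>_facts(2) assms piR_mult[OF i(2) assms(3), of "inv\<^bsub>G\<^esub> f"]
    by (simp add: diag_act_def piR.inv_mult_group)
qed

lemma cls_orb: "c z = code (orb z)"
  by (simp add: cls_def)

lemma orb_mem: "w \<in> orb z \<longleftrightarrow> (\<exists>f\<in>N. w = diag_act G \<rho> f z)"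
  by (auto simp: orbit_def)

lemma orb_refl:
  assumes "y \<in> T" "v \<in> E"
  shows "(y, v) \<in> orb (y, v)"
  unfolding orb_mem using one_pi1 assms \<rho>_facts(3)
  by (intro bexI[of _ "\<one>\<^bsub>G\<^esub>"]) (auto simp: diag_act_def piR_one)

text \<open>The pair \<open>(y', v')\<close> is the translate of \<open>(y, v)\<close> by
  \<open>f\<close>, with the inverse on the first coordinate cleared as
  \<open>f y' = y\<close>.\<close>

lemma cls_eqI:
  assumes y: "y \<in> T" "y' \<in> T" and v: "v \<in> E" and f: "f \<in> N" "f y' = y" "v' = \<rho> f v"
  shows "c (y, v) = c (y', v')"
proof -
  note fG = pi1_carrier[OF f(1)]
  have i: "inv\<^bsub>G\<^esub> f \<in> N" using f(1) inv_pi1_iff[OF fG] by simp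
  have d: "(y', v') = diag_act G \<rho> f (y, v)"
    using f piR_inv(3)[OF fG y(2)] by (simp add: diag_act_def)
  have d': "(y, v) = diag_act G \<rho> (inv\<^bsub>G\<^esub> f) (y', v')"
    using f \<rho>_inv(1)[OF fG v] fG by (simp add: diag_act_def)
  have v': "v' \<in> E" using f(3) \<rho>_facts(1)[OF fG v] by simp
  have "orb (y, v) = orb (y', v')"
  proof (intro equalityI subsetI)
    fix w assume "w \<in> orb (y, v)"
    then obtain g where g: "g \<in> N" "w = diag_act G \<rho> g (y, v)" unfolding orb_mem by blast
    have "w = diag_act G \<rho> (g \<otimes>\<^bsub>G\<^esub> inv\<^bsub>G\<^esub> f) (y', v')"
      unfolding diag_act_mult[OF pi1_carrier[OF g(1)] pi1_carrier[OF i] y(2) v'] using g(2) d' by simp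
    moreover have "g \<otimes>\<^bsub>G\<^esub> inv\<^bsub>G\<^esub> f \<in> N"
      using pi1_mult_iff[OF pi1_carrier[OF g(1)] pi1_carrier[OF i]] g(1) i by simp
    ultimately show "w \<in> orb (y', v')" unfolding orb_mem by blast
  next
    fix w assume "w \<in> orb (y', v')"
    then obtain g where g: "g \<in> N" "w = diag_act G \<rho> g (y', v')" unfolding orb_mem by blast
    have "w = diag_act G \<rho> (g \<otimes>\<^bsub>G\<^esub> f) (y, v)"
      unfolding diag_act_mult[OF pi1_carrier[OF g(1)] fG y(1) v] using g(2) d by simp
    moreover have "g \<otimes>\<^bsub>G\<^esub> f \<in> N"
      using pi1_mult_iff[OF pi1_carrier[OF g(1)] fG] g(1) f(1) by simp
    ultimately show "w \<in> orb (y, v)" unfolding orb_mem by blast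
  qed
  then show ?thesis by (simp add: cls_orb)
qed

text \<open>Equal names make the orbits meet; if \<open>g\<close> and \<open>g'\<close> move the two
  pairs to a common point, the inverse of \<open>g'\<close> times \<open>g\<close> moves the first
  pair to the second.\<close>

lemma cls_eqD:
  assumes y: "y \<in> T" "y' \<in> T" and v: "v \<in> E" "v' \<in> E" and eq: "c (y, v) = c (y', v')"
  obtains f where "f \<in> N" "f y' = y" "v' = \<rho> f v"
proof -
  have "orb (y, v) \<inter> orb (y', v') \<noteq> {}"
    using eq orb_refl[OF y(1) v(1)] orb_refl[OF y(2) v(2)] unfolding cls_orb by (intro code_meet) auto
  then obtain w where w: "w \<in> orb (y, v)" "w \<in> orb (y', v')" by blast
  obtain g where g: "g \<in> N" "w = diag_act G \<rho> g (y, v)" using w(1) unfolding orb_mem by blast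
  obtain g' where g': "g' \<in> N" "w = diag_act G \<rho> g' (y', v')" using w(2) unfolding orb_mem by blast
  note gG = pi1_carrier[OF g(1)] and gG' = pi1_carrier[OF g'(1)]
  have i: "inv\<^bsub>G\<^esub> g' \<in> carrier G" using gG' by simp
  have e: "(inv\<^bsub>G\<^esub> g) y = (inv\<^bsub>G\<^esub> g') y'" "\<rho> g v = \<rho> g' v'"
    using g(2) g'(2) by (simp_all add: diag_act_def)
  let ?f = "inv\<^bsub>G\<^esub> g' \<otimes>\<^bsub>G\<^esub> g"
  have "?f \<in> N" using pi1_mult_iff[OF i gG] inv_pi1_iff[OF gG'] g(1) g'(1) by simp
  moreover have "?f y' = y"
    using piR_mult[OF i y(2), of g] e(1) piR_inv(2)[OF gG y(1)] by simp
  moreover have "v' = \<rho> ?f v"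
    using \<rho>_facts(2)[OF i gG v(1)] e(2) \<rho>_inv(1)[OF gG' v(2)] by simp
  ultimately show ?thesis by (rule that)
qed

lemma QT_quotient: "quotient_map (prod_topology Xt (discrete_topology E)) QT c"
  by (simp add: Q_top_def quotient_map_quotient_topology)

lemma QT_points: "topspace QT = c ` (T \<times> E)"
  by (simp add: Q_top_def topspace_quotient_topology)

lemma QT_pointsE:
  assumes "b \<in> topspace QT"
  obtains y v where "y \<in> T" "v \<in> E" "b = c (y, v)"
  using assms unfolding QT_points by auto

lemma QT_pointsI: "y \<in> T \<Longrightarrow> v \<in> E \<Longrightarrow> c (y, v) \<in> topspace QT"
  unfolding QT_points by auto

lemma QT_continuousI:
  assumes "\<And>v. v \<in> E \<Longrightarrow> continuous_map Xt Y (\<lambda>y. f (c (y, v)))"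
  shows "continuous_map QT Y f"
proof (rule continuous_compose_quotient_map[OF QT_quotient])
  show "continuous_map (prod_topology Xt (discrete_topology E)) Y (f \<circ> c)"
    by (rule continuous_map_prod_discrete) (use assms in simp)
qed

lemma cls_continuous:
  assumes "v \<in> E"
  shows "continuous_map Xt QT (\<lambda>y. c (y, v))"
proof -
  have "continuous_map Xt (prod_topology Xt (discrete_topology E)) (\<lambda>y. (y, v))"
    using assms by (intro continuous_map_pairedI) auto
  from continuous_map_compose[OF this quotient_imp_continuous_map[OF QT_quotient]]
  show ?thesis by (simp add: o_def)
qed

lemma Q_map_cls:
  assumes "y \<in> T" "v \<in> E"
  shows "qm (c (y, v)) = p y"
proof -
  have P: "\<forall>y'\<in>T. \<forall>v'\<in>E. c (y', v') = c (y, v) \<longrightarrow> p y = p y'"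
  proof (intro ballI impI)
    fix y' v' assume "y' \<in> T" "v' \<in> E" "c (y', v') = c (y, v)"
    from cls_eqD[OF this(1) assms(1) this(2) assms(2) this(3)]
    obtain f where "f \<in> N" "f y = y'" by metis
    then show "p y = p y'" using pi1_p[of f y] assms(1) by simp
  qed
  have "(THE a. \<forall>y'\<in>T. \<forall>v'\<in>E. c (y', v') = c (y, v) \<longrightarrow> a = p y') = p y"
    by (rule the_equality, rule P) (use assms in blast)
  then show ?thesis using QT_pointsI[OF assms] by (simp add: Q_map_def)
qed

text \<open>The preimage in the product is the union of the translates of
  \<open>W \<times> {v}\<close> by \<open>N\<close>, each open because \<open>E\<close> is discrete
  and \<open>N\<close> acts continuously.\<close>

lemma open_sheet:
  assumes W: "openin Xt W" and v: "v \<in> E"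
  shows "openin QT (c ` (W \<times> {v}))"
proof -
  have WT: "W \<subseteq> T" using openin_subset[OF W] .
  let ?Z = "prod_topology Xt (discrete_topology E)"
  let ?O = "{z \<in> topspace ?Z. c z \<in> c ` (W \<times> {v})}"
  \<comment> \<open>The pairs that \<open>f\<close> moves into
    \<open>W \<times> {v}\<close>.\<close>
  let ?P = "\<lambda>f. {y \<in> T. (inv\<^bsub>G\<^esub> f) y \<in> W} \<times> {u \<in> E. \<rho> f u = v}"
  have O: "?O = (\<Union>f\<in>N. ?P f)"
  proof (intro equalityI subsetI)
    fix z assume z: "z \<in> ?O"
    then obtain y u where yu: "z = (y, u)" "y \<in> T" "u \<in> E" by auto
    from z obtain w where w: "w \<in> W" "c z = c (w, v)" by auto
    have wT: "w \<in> T" using w(1) WT by blast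
    from cls_eqD[OF yu(2) wT yu(3) v] w(2) yu(1)
    obtain f where f: "f \<in> N" "f w = y" "v = \<rho> f u" by metis
    have "(inv\<^bsub>G\<^esub> f) y = w" using piR_inv(3)[OF pi1_carrier[OF f(1)] wT] f(2) by simp
    then have "z \<in> ?P f" using yu w(1) f(3) by simp
    then show "z \<in> (\<Union>f\<in>N. ?P f)" using f(1) by blast
  next
    fix z assume "z \<in> (\<Union>f\<in>N. ?P f)"
    then obtain f where f: "f \<in> N" "z \<in> ?P f" by blast
    then obtain y u where yu: "z = (y, u)" "y \<in> T" "u \<in> E" "(inv\<^bsub>G\<^esub> f) y \<in> W" "\<rho> f u = v" by auto
    have "c (y, u) = c ((inv\<^bsub>G\<^esub> f) y, v)"
      by (rule cls_eqI[OF yu(2) piR_inv(1)[OF pi1_carrier[OF f(1)] yu(2)] yu(3) f(1)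
            piR_inv(2)[OF pi1_carrier[OF f(1)] yu(2)] yu(5)[symmetric]])
    then have "c z \<in> c ` (W \<times> {v})" using yu(1,4) by auto
    then show "z \<in> ?O" using yu(1-3) by simp
  qed
  have P: "openin ?Z (?P f)" if "f \<in> N" for f
  proof -
    have "continuous_map Xt Xt (inv\<^bsub>G\<^esub> f)" using piR_cont pi1_carrier[OF that] by simp
    from openin_preimage[OF this W] show ?thesis
      by (subst openin_prod_Times_iff) auto
  qed
  have "openin ?Z (\<Union>f\<in>N. ?P f)"
    by (rule openin_Union) (use P in blast)
  then have "openin ?Z ?O" unfolding O .
  moreover have "c ` (W \<times> {v}) \<subseteq> c ` topspace ?Z" using WT v by auto
  ultimately show ?thesis unfolding Q_top_def openin_quotient_topology by simp
qed

text \<open>Over an evenly covered \<open>U\<close>, one sheet \<open>V\<^sub>0\<close> of the universal cover gives all sheets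
  \<open>[V\<^sub>0 \<times> {v}]\<close> of the quotient, since \<open>\<pi>\<^sub>1\<close> acts simply transitively on the fibres of \<open>p\<close>.\<close>
lemma Q_map_covering: "covering_map QT (surf_top X) qm"
proof (rule covering_mapI)
  show qc: "continuous_map QT (surf_top X) qm"
    by (rule QT_continuousI, rule continuous_map_eq[OF p_cont]) (simp add: Q_map_cls)
  fix x' assume x': "x' \<in> points X"
  obtain U \<V> where U: "x' \<in> U" "evenly_covered Xt (surf_top X) p U \<V>"
    using covering_map_evenly[OF p_cov x'] .
  obtain z where z: "z \<in> T" "x' = p z" using x' p_surj by (metis imageE)
  have "p z \<in> U" using U(1) z(2) by simp
  then obtain V0 where V0: "V0 \<in> \<V>" "z \<in> V0" using evenly_covered_in_sheet[OF U(2) z(1)] by metis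
  note sh = evenly_covered_sheet[OF U(2) V0(1)]
  have VT: "V0 \<subseteq> T" using openin_subset[OF sh(2)] .
  let ?sheet = "\<lambda>v. c ` (V0 \<times> {v})"
  have in_sheet: "\<exists>v\<in>E. b \<in> ?sheet v" if b: "b \<in> topspace QT" "qm b \<in> U" for b
  proof -
    obtain y v where y: "y \<in> T" "v \<in> E" "b = c (y, v)" using QT_pointsE[OF b(1)] .
    then have "p y \<in> U" using b(2) Q_map_cls by simp
    then obtain y0 where y0: "y0 \<in> V0" "p y0 = p y" using sh(3) by (metis imageE)
    have y0T: "y0 \<in> T" using y0 VT by blast
    obtain f where f: "f \<in> N" "f y0 = y" using pi1_transitive[OF y0T y(1)] y0(2) by metis
    have "c (y, v) = c (y0, \<rho> f v)" by (rule cls_eqI[OF y(1) y0T y(2) f refl])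
    moreover have "\<rho> f v \<in> E" using \<rho>_facts(1) pi1_carrier f(1) y(2) by blast
    ultimately show ?thesis using y0(1) y(3) by auto
  qed
  \<comment> \<open>Injectivity of \<open>p\<close> on \<open>V0\<close> forces the first
    coordinates to agree; the connecting element of \<open>N\<close> then has a fixed point and is
    the identity. This gives disjoint sheets as well.\<close>
  have sheet_inj: "y = y' \<and> v = v'"
    if y: "y \<in> V0" "y' \<in> V0" and v: "v \<in> E" "v' \<in> E" and eq: "c (y, v) = c (y', v')" for y y' v v'
  proof -
    have yT: "y \<in> T" "y' \<in> T" using y VT by auto
    obtain f where f: "f \<in> N" "f y' = y" "v' = \<rho> f v" using cls_eqD[OF yT v eq] .
    have "p y = p y'" using pi1_p[OF f(1) yT(2)] f(2) by simp
    then have yy: "y = y'" using sh(4) y by (auto dest: inj_onD)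
    then have "f = \<one>\<^bsub>G\<^esub>" using pi1_free[OF f(1) yT(2)] f(2) by simp
    then show ?thesis using yy f(3) \<rho>_facts(3)[OF v(1)] by simp
  qed
  have "evenly_covered QT (surf_top X) qm U (?sheet ` E)"
    unfolding evenly_covered_def
  proof (intro conjI ballI)
    show "openin (surf_top X) U" by (rule sh(1))
    show "\<Union>(?sheet ` E) = {e \<in> topspace QT. qm e \<in> U}"
    proof (intro equalityI subsetI)
      fix b assume "b \<in> \<Union>(?sheet ` E)"
      then obtain y v where "y \<in> V0" "v \<in> E" "b = c (y, v)" by auto
      then show "b \<in> {e \<in> topspace QT. qm e \<in> U}"
        using QT_pointsI[of y v] Q_map_cls[of y v] VT sh(3) by auto
    next
      fix b assume "b \<in> {e \<in> topspace QT. qm e \<in> U}"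
      then show "b \<in> \<Union>(?sheet ` E)" using in_sheet[of b] by simp
    qed
    show "openin QT V" if "V \<in> ?sheet ` E" for V
      using that open_sheet[OF sh(2)] by auto
    show "pairwise disjnt (?sheet ` E)"
    proof (rule pairwiseI)
      fix A B assume AB: "A \<in> ?sheet ` E" "B \<in> ?sheet ` E" "A \<noteq> B"
      then obtain v w where vw: "v \<in> E" "w \<in> E" "A = ?sheet v" "B = ?sheet w" by blast
      then have "v \<noteq> w" using AB(3) by blast
      then show "disjnt A B"
        using sheet_inj[OF _ _ vw(1,2)] unfolding disjnt_iff vw(3,4) by auto
    qed
    fix V assume "V \<in> ?sheet ` E"
    then obtain v where v: "v \<in> E" "V = ?sheet v" by blast
    show "homeomorphic_map (subtopology QT V) (subtopology (surf_top X) U) qm"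
    proof (rule homeomorphic_map_sectionI[OF _ openin_subset[OF sh(1)] qc])
      show "V \<subseteq> topspace QT" using v QT_pointsI VT by auto
      show "continuous_map (subtopology (surf_top X) U) QT (\<lambda>u. c (inv_into V0 p u, v))"
        using continuous_map_compose[OF sh(5) cls_continuous[OF v(1)]] by (simp add: o_def)
      show "qm b \<in> U \<and> c (inv_into V0 p (qm b), v) = b" if "b \<in> V" for b
      proof -
        obtain y where y: "y \<in> V0" "b = c (y, v)"  using \<open>b \<in> V\<close> v(2) by blast
        then have "qm b = p y" using Q_map_cls v(1) VT by auto
        then show ?thesis using y sh(3,4) by auto
      qed
      show "c (inv_into V0 p u, v) \<in> V \<and> qm (c (inv_into V0 p u, v)) = u" if u: "u \<in> U" for u
      proof -
        have i: "inv_into V0 p u \<in> V0" "p (inv_into V0 p u) = u"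
          using u sh(3) by (auto intro: inv_into_into f_inv_into_f)
        then show ?thesis using v Q_map_cls[of "inv_into V0 p u" v] VT by auto
      qed
    qed
  qed
  then show "\<exists>U \<V>. x' \<in> U \<and> evenly_covered QT (surf_top X) qm U \<V>" using U(1) by (intro exI conjI)
qed

text \<open>Well-definedness has to be shown for the representative and for \<open>h\<close> at
  once, since the description quantifies over both.\<close>

lemma Q_inv_cls:
  assumes y: "y \<in> T" and v: "v \<in> E" and h: "h \<in> carrier G" "h \<notin> N"
  shows "qi (c (y, v)) = c ((inv\<^bsub>G\<^esub> h) y, \<rho> h v)"
proof -
  let ?b = "c ((inv\<^bsub>G\<^esub> h) y, \<rho> h v)"
  have P: "\<forall>h'\<in>carrier G - N. \<forall>y'\<in>T. \<forall>v'\<in>E. c (y', v') = c (y, v) \<longrightarrow> ?b = c (diag_act G \<rho> h' (y', v'))"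
  proof (intro ballI impI)
    fix h' y' v' assume h': "h' \<in> carrier G - N" and y': "y' \<in> T" and v': "v' \<in> E" and eq: "c (y', v') = c (y, v)"
    have hG': "h' \<in> carrier G" "inv\<^bsub>G\<^esub> h' \<in> carrier G" using h' by auto
    obtain f where f: "f \<in> N" "f y = y'" "v = \<rho> f v'" using cls_eqD[OF y' y v' v eq] .
    note fG = pi1_carrier[OF f(1)]
    \<comment> \<open>\<open>k\<close> carries the result computed from \<open>h'\<close> and
      \<open>(y', v')\<close> to the one computed from \<open>h\<close> and \<open>(y, v)\<close>.
      It lies in \<open>N\<close> because the parities of \<open>h\<close> and \<open>h'\<close>
      cancel.\<close>
    define k where "k = h \<otimes>\<^bsub>G\<^esub> (f \<otimes>\<^bsub>G\<^esub> inv\<^bsub>G\<^esub> h')"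
    have kN: "k \<in> N"
      using h f(1) fG h' hG' by (simp add: k_def pi1_mult_iff inv_pi1_iff)
    have iy: "(inv\<^bsub>G\<^esub> h) y \<in> T" "(inv\<^bsub>G\<^esub> h') y' \<in> T" using piR_inv(1) h(1) hG'(1) y y' by auto
    have k1: "k ((inv\<^bsub>G\<^esub> h) y) = (inv\<^bsub>G\<^esub> h') y'"
      unfolding k_def piR_mult[OF h(1) iy(1)] piR_inv(2)[OF h(1) y] piR_mult[OF fG y] f(2) ..
    have "\<rho> k (\<rho> h' v') = \<rho> (k \<otimes>\<^bsub>G\<^esub> h') v'"
      using \<rho>_facts(2)[OF pi1_carrier[OF kN] hG'(1) v'] by simp
    also have "k \<otimes>\<^bsub>G\<^esub> h' = h \<otimes>\<^bsub>G\<^esub> f"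
      unfolding k_def using h(1) fG hG' by (simp add: piR.m_assoc)
    also have "\<rho> (h \<otimes>\<^bsub>G\<^esub> f) v' = \<rho> h v"
      using \<rho>_facts(2)[OF h(1) fG v'] f(3) by simp
    finally have k2: "\<rho> h v = \<rho> k (\<rho> h' v')" by simp
    have "c ((inv\<^bsub>G\<^esub> h') y', \<rho> h' v') = ?b"
      by (rule cls_eqI[OF iy(2,1) \<rho>_facts(1)[OF hG'(1) v'] kN k1 k2])
    then show "?b = c (diag_act G \<rho> h' (y', v'))" by (simp add: diag_act_def)
  qed
  have "(THE b'. \<forall>h'\<in>carrier G - N. \<forall>y'\<in>T. \<forall>v'\<in>E. c (y', v') = c (y, v) \<longrightarrow>
      b' = c (diag_act G \<rho> h' (y', v'))) = ?b"
  proof (rule the_equality, rule P)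
    fix b' assume "\<forall>h'\<in>carrier G - N. \<forall>y'\<in>T. \<forall>v'\<in>E. c (y', v') = c (y, v) \<longrightarrow>
      b' = c (diag_act G \<rho> h' (y', v'))"
    then have "b' = c (diag_act G \<rho> h (y, v))" using y v h by simp
    then show "b' = ?b" by (simp add: diag_act_def)
  qed
  then show ?thesis using QT_pointsI[OF y v] by (simp add: Q_inv_def)
qed

abbreviation "Qcov \<equiv> on_obj (Q code X \<sigma> Xt p) (E, \<rho>)"

lemma Qcov_simps:
  "cov_surf Qcov = induced_surface X QT qm" "cov_inv Qcov = qi" "cov_map Qcov = qm"
  "surf_top (induced_surface X QT qm) = QT"
  by (simp_all add: Q_def induced_surface_def)

lemma Qcov_real: "is_real_cover X \<sigma> Qcov"
proof -
  note lh = covering_map_local_homeo[OF Q_map_covering]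
  note S = induced_surface[OF X_riemann lh]
  have H: "Hausdorff_space QT"
    by (rule covering_map_Hausdorff[OF Q_map_covering]) (use X_riemann in \<open>simp add: riemann_surface_def\<close>)
  obtain h where h: "h \<in> carrier G" "h \<notin> N" using not_pi1_ex .
  have hi: "inv\<^bsub>G\<^esub> h \<in> carrier G" "inv\<^bsub>G\<^esub> h \<notin> N" using h inv_pi1_iff by auto
  have over: "qm (qi b) = \<sigma> (qm b)" if "b \<in> topspace QT" for b
  proof -
    obtain y v where y: "y \<in> T" "v \<in> E" "b = c (y, v)" using QT_pointsE[OF \<open>b \<in> topspace QT\<close>] .
    have "qm (qi b) = p ((inv\<^bsub>G\<^esub> h) y)"
      unfolding y(3) Q_inv_cls[OF y(1,2) h]
      by (rule Q_map_cls[OF piR_inv(1)[OF h(1) y(1)] \<rho>_facts(1)[OF h(1) y(2)]])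
    also have "\<dots> = \<sigma> (p y)" by (rule not_pi1_p[OF hi y(1)])
    finally show ?thesis using Q_map_cls[OF y(1,2)] y(3) by simp
  qed
  have invol: "qi (qi b) = b" if "b \<in> topspace QT" for b
  proof -
    obtain y v where y: "y \<in> T" "v \<in> E" "b = c (y, v)" using QT_pointsE[OF \<open>b \<in> topspace QT\<close>] .
    note iy = piR_inv[OF h(1) y(1)] and iv = \<rho>_facts(1)[OF h(1) y(2)]
    \<comment> \<open>The second application is evaluated with the inverse of \<open>h\<close> in
      place of \<open>h\<close>, as independence of the choice allows; of the square of
      \<open>h\<close> one knows only that it lies in \<open>N\<close>.\<close>
    have "qi (qi b) = c ((inv\<^bsub>G\<^esub> (inv\<^bsub>G\<^esub> h)) ((inv\<^bsub>G\<^esub> h) y), \<rho> (inv\<^bsub>G\<^esub> h) (\<rho> h v))"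
      unfolding y(3) Q_inv_cls[OF y(1,2) h] by (rule Q_inv_cls[OF iy(1) iv hi])
    then show ?thesis using iy(2) \<rho>_inv(1)[OF h(1) y(2)] h(1) y(3) by simp
  qed
  have "continuous_map QT QT qi"
  proof (rule QT_continuousI)
    fix v assume v: "v \<in> E"
    have "continuous_map Xt QT (\<lambda>y. c ((inv\<^bsub>G\<^esub> h) y, \<rho> h v))"
      using continuous_map_compose[OF piR_cont[OF hi(1)] cls_continuous[OF \<rho>_facts(1)[OF h(1) v]]]
      by (simp add: o_def)
    then show "continuous_map Xt QT (\<lambda>y. qi (c (y, v)))"
      by (rule continuous_map_eq) (simp add: Q_inv_cls[OF _ v h])
  qed
  then have "antiholomorphic_map (induced_surface X QT qm) (induced_surface X QT qm) qi"
    by (intro antiholomorphic_map_over[OF S(4) S(4) X_cover S(3) S(3) _ \<sigma>_anti])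
      (use lh S(1) over in auto)
  then show ?thesis
    using H S over invol Q_map_covering
    by (simp add: is_real_cover_def klein_surface_def riemann_surface_def Qcov_simps)
qed

end

text \<open>Equivariance of \<open>u\<close> under \<open>N\<close> makes the value independent of
  the representative.\<close>

lemma Q_hom_cls:
  assumes F: "group_action G E \<rho>" and F': "group_action G E' \<rho>'"
    and u: "u \<in> Hom (GSets G) (E, \<rho>) (E', \<rho>')" and y: "y \<in> T" and v: "v \<in> E"
  shows "on_hom (Q code X \<sigma> Xt p) (E, \<rho>) (E', \<rho>') u (cls code X \<sigma> Xt p (E, \<rho>) (y, v)) =
    cls code X \<sigma> Xt p (E', \<rho>') (y, u v)"
proof -
  let ?c = "cls code X \<sigma> Xt p (E, \<rho>)" and ?c' = "cls code X \<sigma> Xt p (E', \<rho>')"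
  have uE: "u v \<in> E'" if "v \<in> E" for v using u that by (auto simp: GSets_def)
  have ue: "u (\<rho> g v) = \<rho>' g (u v)" if "g \<in> carrier G" "v \<in> E" for g v
    using u that by (auto simp: GSets_def)
  have P: "\<forall>y'\<in>T. \<forall>v'\<in>E. ?c (y', v') = ?c (y, v) \<longrightarrow> ?c' (y, u v) = ?c' (y', u v')"
  proof (intro ballI impI)
    fix y' v' assume y': "y' \<in> T" and v': "v' \<in> E" and eq: "?c (y', v') = ?c (y, v)"
    obtain f where f: "f \<in> N" "f y = y'" "v = \<rho> f v'" using cls_eqD[OF F y' y v' v eq] .
    have "u v = \<rho>' f (u v')" using ue[OF pi1_carrier[OF f(1)] v'] f(3) by simp
    from cls_eqI[OF F' y' y uE[OF v'] f(1,2) this] show "?c' (y, u v) = ?c' (y', u v')" by simp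
  qed
  have "(THE b'. \<forall>y'\<in>T. \<forall>v'\<in>E. ?c (y', v') = ?c (y, v) \<longrightarrow> b' = ?c' (y', u v')) = ?c' (y, u v)"
    by (rule the_equality, rule P) (use y v in simp)
  then show ?thesis using QT_pointsI[OF F y v] by (simp add: Q_def)
qed

end

section \<open>The equivalence of categories\<close>

lemma GSets_simps:
  "(E, \<rho>) \<in> Obj (GSets G) \<longleftrightarrow> group_action G E \<rho>"
  "u \<in> Hom (GSets G) (E, \<rho>) (E', \<rho>') \<longleftrightarrow>
     u \<in> extensional E \<and> (\<forall>v\<in>E. u v \<in> E') \<and> (\<forall>g\<in>carrier G. \<forall>v\<in>E. u (\<rho> g v) = \<rho>' g (u v))"
  "Ident (GSets G) (E, \<rho>) = (\<lambda>v\<in>E. v)"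
  "Comp (GSets G) (E, \<rho>) b c g f = compose E g f"
  by (auto simp: GSets_def PiE_def)

lemma GSets_category: "is_category (GSets G)"
  unfolding is_category_def
proof (intro conjI ballI, goal_cases)
  case (1 a)
  obtain E \<rho> where a: "a = (E, \<rho>)" by fastforce
  have "group_action G E \<rho>" using 1 by (simp add: a GSets_simps)
  from group_action_facts(1)[OF this] show ?case unfolding a GSets_simps by simp
next
  case (2 a b c f g)
  obtain E \<rho> E' \<rho>' E'' \<rho>'' where "a = (E, \<rho>)" "b = (E', \<rho>')" "c = (E'', \<rho>'')" by (metis surj_pair)
  then show ?case using 2 group_action_facts(1)[of G E \<rho>] by (auto simp: GSets_simps compose_def)
next
  case (3 a b f)
  obtain E \<rho> E' \<rho>' where "a = (E, \<rho>)" "b = (E', \<rho>')" by (metis surj_pair)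
  then show ?case using 3 by (auto simp: GSets_simps compose_def intro!: extensionalityI[of _ E])
next
  case (4 a b f)
  obtain E \<rho> E' \<rho>' where "a = (E, \<rho>)" "b = (E', \<rho>')" by (metis surj_pair)
  then show ?case using 4 by (auto simp: GSets_simps compose_def intro!: extensionalityI[of _ E])
next
  case (5 a b c d f g h)
  obtain E \<rho> E' \<rho>' E'' \<rho>'' where "a = (E, \<rho>)" "b = (E', \<rho>')" "c = (E'', \<rho>'')" by (metis surj_pair)
  then show ?case using 5 by (auto simp: GSets_simps compose_def fun_eq_iff)
qed

lemma GSets_iso:
  assumes F: "group_action G E \<rho>" and F': "group_action G E' \<rho>'"
    and u: "u \<in> Hom (GSets G) (E, \<rho>) (E', \<rho>')" and bij: "bij_betw u E E'"
  shows "is_iso_in (GSets G) (E, \<rho>) (E', \<rho>') u"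
proof -
  let ?w = "restrict (inv_into E u) E'"
  have w: "inv_into E u v \<in> E" "u (inv_into E u v) = v" if "v \<in> E'" for v
    using bij that by (auto simp: bij_betw_def inv_into_into f_inv_into_f)
  have wu: "inv_into E u (u v) = v" if "v \<in> E" for v
    using bij_betw_inv_into_left[OF bij that] .
  have "inv_into E u (\<rho>' g v) = \<rho> g (inv_into E u v)" if g: "g \<in> carrier G" and v: "v \<in> E'" for g v
  proof -
    have "\<rho>' g v = u (\<rho> g (inv_into E u v))" using u g w[OF v] by (simp add: GSets_simps)
    then show ?thesis using wu group_action_facts(1)[OF F g w(1)[OF v]] by simp
  qed
  then have "?w \<in> Hom (GSets G) (E', \<rho>') (E, \<rho>)"
    using w(1) group_action_facts(1)[OF F'] by (auto simp: GSets_simps)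
  moreover have "compose E ?w u = (\<lambda>v\<in>E. v)" "compose E' u ?w = (\<lambda>v\<in>E'. v)"
    using w wu u by (auto simp: compose_def fun_eq_iff GSets_simps)
  ultimately show ?thesis
    unfolding is_iso_in_def GSets_simps(3,4) using u by blast
qed

context klein_universal_cover
begin

section \<open>The category of real covers\<close>

lemma real_coverD:
  assumes C: "is_real_cover X \<sigma> C"
  shows "covering_map (surf_top (cov_surf C)) (surf_top X) (cov_map C)"
    "holomorphic_map (cov_surf C) X (cov_map C)" "charted_cover (cov_surf C)"
    "local_homeo (surf_top (cov_surf C)) (surf_top X) (cov_map C)"
    "continuous_map (surf_top (cov_surf C)) (surf_top (cov_surf C)) (cov_inv C)"
    "y \<in> cov_points C \<Longrightarrow> cov_inv C y \<in> cov_points C"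
    "y \<in> cov_points C \<Longrightarrow> cov_inv C (cov_inv C y) = y"
    "y \<in> cov_points C \<Longrightarrow> cov_map C (cov_inv C y) = \<sigma> (cov_map C y)"
proof -
  have k: "klein_surface (cov_surf C) (cov_inv C)" using C by (simp add: is_real_cover_def)
  show cov: "covering_map (surf_top (cov_surf C)) (surf_top X) (cov_map C)"
    and "holomorphic_map (cov_surf C) X (cov_map C)"
    using C by (simp_all add: is_real_cover_def)
  show "charted_cover (cov_surf C)"
    using k by (simp add: klein_surface_def riemann_surface_charted_cover)
  show "local_homeo (surf_top (cov_surf C)) (surf_top X) (cov_map C)"
    using cov by (rule covering_map_local_homeo)
  show c: "continuous_map (surf_top (cov_surf C)) (surf_top (cov_surf C)) (cov_inv C)"
    using k by (simp add: klein_surface_def antiholomorphic_map_def map_in_charts_def)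
  show "cov_inv C y \<in> cov_points C" if "y \<in> cov_points C"
    using continuous_map_in[OF c that] .
  show "cov_inv C (cov_inv C y) = y" if "y \<in> cov_points C"
    using k that by (simp add: klein_surface_def)
  show "cov_map C (cov_inv C y) = \<sigma> (cov_map C y)" if "y \<in> cov_points C"
    using C that by (simp add: is_real_cover_def)
qed

lemma RealCov_simps:
  "C \<in> Obj (RealCov X \<sigma>) \<longleftrightarrow> is_real_cover X \<sigma> C"
  "Ident (RealCov X \<sigma>) C = (\<lambda>y\<in>cov_points C. y)"
  "Comp (RealCov X \<sigma>) C C' C'' g f = compose (cov_points C) g f"
  by (simp_all add: RealCov_def)

text \<open>From here on a morphism of covers is checked by continuity, without charts.\<close>

lemma RealCov_Hom_iff:
  assumes C: "is_real_cover X \<sigma> C" and D: "is_real_cover X \<sigma> D"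
  shows "\<phi> \<in> Hom (RealCov X \<sigma>) C D \<longleftrightarrow> \<phi> \<in> extensional (cov_points C) \<and>
    continuous_map (surf_top (cov_surf C)) (surf_top (cov_surf D)) \<phi> \<and>
    (\<forall>y\<in>cov_points C. \<phi> (cov_inv C y) = cov_inv D (\<phi> y)) \<and>
    (\<forall>y\<in>cov_points C. cov_map D (\<phi> y) = cov_map C y)" (is "_ \<longleftrightarrow> ?R")
proof
  assume "\<phi> \<in> Hom (RealCov X \<sigma>) C D"
  then show ?R by (simp add: RealCov_def holomorphic_map_continuous)
next
  assume R: ?R
  have "holomorphic_map (cov_surf C) (cov_surf D) \<phi>"
    by (rule holomorphic_map_over[OF real_coverD(3)[OF C] real_coverD(3)[OF D] X_cover
          real_coverD(2)[OF C] real_coverD(2,4)[OF D]]) (use R in auto)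
  then show "\<phi> \<in> Hom (RealCov X \<sigma>) C D" using R by (simp add: RealCov_def)
qed

lemma RealCov_HomD:
  assumes C: "is_real_cover X \<sigma> C" and D: "is_real_cover X \<sigma> D" and \<phi>: "\<phi> \<in> Hom (RealCov X \<sigma>) C D"
  shows "\<phi> \<in> extensional (cov_points C)"
    "continuous_map (surf_top (cov_surf C)) (surf_top (cov_surf D)) \<phi>"
    "y \<in> cov_points C \<Longrightarrow> \<phi> (cov_inv C y) = cov_inv D (\<phi> y)"
    "y \<in> cov_points C \<Longrightarrow> cov_map D (\<phi> y) = cov_map C y"
    "y \<in> cov_points C \<Longrightarrow> \<phi> y \<in> cov_points D"
  using \<phi>[unfolded RealCov_Hom_iff[OF C D]] continuous_map_in by auto

lemma RealCov_category: "is_category (RealCov X \<sigma> :: (('y, 'x) real_cover, 'y \<Rightarrow> 'y) cat)"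
  unfolding is_category_def RealCov_simps
proof (intro conjI ballI, goal_cases)
  case (1 C)
  note 1 = 1[unfolded RealCov_simps]
  from 1 show ?case
    using real_coverD(6)[of C] continuous_map_eq[OF continuous_map_id]
    by (auto simp: RealCov_Hom_iff)
next
  case (2 C D K f g)
  note 2 = 2[unfolded RealCov_simps]
  have "continuous_map (surf_top (cov_surf C)) (surf_top (cov_surf K)) (compose (cov_points C) g f)"
    by (rule continuous_map_eq[OF continuous_map_compose[OF RealCov_HomD(2)[OF 2(1,2,4)] RealCov_HomD(2)[OF 2(2,3,5)]]])
      (simp add: compose_def)
  then show ?case
    using RealCov_HomD[OF 2(1,2,4)] RealCov_HomD[OF 2(2,3,5)] real_coverD(6)[OF 2(1)]
    unfolding RealCov_Hom_iff[OF 2(1,3)] by (auto simp: compose_def)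
next
  case (3 C D f)
  note 3 = 3[unfolded RealCov_simps]
  show ?case
    by (rule extensionalityI[of _ "cov_points C"]) (use RealCov_HomD[OF 3] in \<open>auto simp: compose_def\<close>)
next
  case (4 C D f)
  note 4 = 4[unfolded RealCov_simps]
  show ?case
    by (rule extensionalityI[of _ "cov_points C"]) (use RealCov_HomD[OF 4] in \<open>auto simp: compose_def\<close>)
next
  case (5 C D K L f g h)
  note 5 = 5[unfolded RealCov_simps]
  show ?case
    by (rule extensionalityI[of _ "cov_points C"]) (use RealCov_HomD(5)[OF 5(1,2,5)] in \<open>auto simp: compose_def\<close>)
qed

text \<open>A morphism of covers is open by \<open>open_map_over\<close>, so a bijective one has a
  continuous inverse; compatibility with the projections and real structures is inherited.\<close>

lemma RealCov_iso:
  assumes C: "is_real_cover X \<sigma> C" and D: "is_real_cover X \<sigma> D"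
    and \<phi>: "\<phi> \<in> Hom (RealCov X \<sigma>) C D" and bij: "bij_betw \<phi> (cov_points C) (cov_points D)"
  shows "is_iso_in (RealCov X \<sigma>) C D \<phi>"
proof -
  note h = RealCov_HomD[OF C D \<phi>]
  let ?Y = "cov_points C" and ?Y' = "cov_points D"
  let ?i = "inv_into ?Y \<phi>"
  have i: "?i y \<in> ?Y" "\<phi> (?i y) = y" if "y \<in> ?Y'" for y
    using bij that by (auto simp: bij_betw_def inv_into_into f_inv_into_f)
  have i\<phi>: "?i (\<phi> y) = y" if "y \<in> ?Y" for y
    using bij_betw_inv_into_left[OF bij that] .
  have op: "open_map (surf_top (cov_surf C)) (surf_top (cov_surf D)) \<phi>"
    by (rule open_map_over[OF real_coverD(4)[OF C] real_coverD(4)[OF D] h(2,4)])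
  have ic: "continuous_map (surf_top (cov_surf D)) (surf_top (cov_surf C)) ?i"
    unfolding continuous_map_def
  proof (intro conjI allI impI)
    show "?i \<in> ?Y' \<rightarrow> ?Y" using i by auto
    fix W assume W: "openin (surf_top (cov_surf C)) W"
    have "{y \<in> ?Y'. ?i y \<in> W} = \<phi> ` W"
    proof (intro equalityI subsetI)
      fix y assume y: "y \<in> {y \<in> ?Y'. ?i y \<in> W}"
      then have "y = \<phi> (?i y)" using i(2) by simp
      then show "y \<in> \<phi> ` W" by (rule image_eqI) (use y in simp)
    next
      fix y assume "y \<in> \<phi> ` W"
      then obtain w where w: "w \<in> W" "y = \<phi> w" by blast
      then have "w \<in> ?Y" using openin_subset[OF W] by blast
      then show "y \<in> {y \<in> ?Y'. ?i y \<in> W}" using w i\<phi> h(5) by simp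
    qed
    then show "openin (surf_top (cov_surf D)) {y \<in> ?Y'. ?i y \<in> W}"
      using op W by (simp add: open_map_def)
  qed
  have \<tau>: "?i (cov_inv D y) = cov_inv C (?i y)" if y: "y \<in> ?Y'" for y
  proof -
    have "\<phi> (cov_inv C (?i y)) = cov_inv D y" using h(3)[OF i(1)[OF y]] i(2)[OF y] by simp
    then show ?thesis using i\<phi>[OF real_coverD(6)[OF C i(1)[OF y]]] by simp
  qed
  have "restrict ?i ?Y' \<in> Hom (RealCov X \<sigma>) D C"
    unfolding RealCov_Hom_iff[OF D C]
    using continuous_map_eq[OF ic] \<tau> h(4)[OF i(1)] i(2) real_coverD(6)[OF D] by auto
  moreover have "compose ?Y (restrict ?i ?Y') \<phi> = (\<lambda>y\<in>?Y. y)" "compose ?Y' \<phi> (restrict ?i ?Y') = (\<lambda>y\<in>?Y'. y)"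
    using i i\<phi> h(5) by (auto simp: compose_def fun_eq_iff)
  ultimately show ?thesis
    unfolding is_iso_in_def RealCov_simps using \<phi> by blast
qed

section \<open>The fibre functor\<close>

lemma fibre_iff: "y \<in> fibre C x \<longleftrightarrow> y \<in> cov_points C \<and> cov_map C y = x"
  by (simp add: fibre_def)

lemma lift_at_eq:
  assumes C: "is_real_cover X \<sigma> C"
    and t: "continuous_map Xt (surf_top (cov_surf C)) t" "\<And>z. z \<in> T \<Longrightarrow> cov_map C (t z) = p z" "t xt = y"
  shows "lift_at Xt xt p C y = restrict t T"
  unfolding lift_at_def
proof (rule the_equality)
  show "restrict t T \<in> extensional T \<and> continuous_map Xt (surf_top (cov_surf C)) (restrict t T) \<and>
     (\<forall>z\<in>T. cov_map C (restrict t T z) = p z) \<and> restrict t T xt = y"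
    using t xt continuous_map_eq[OF t(1)] by simp
  fix t' assume t': "t' \<in> extensional T \<and> continuous_map Xt (surf_top (cov_surf C)) t' \<and>
     (\<forall>z\<in>T. cov_map C (t' z) = p z) \<and> t' xt = y"
  show "t' = restrict t T"
  proof (rule extensionalityI[of _ T])
    fix z assume z: "z \<in> T"
    have "t' z = t z"
      by (rule lift_unique[OF real_coverD(1)[OF C] _ t(1) _ xt _ z]) (use t' t in auto)
    then show "t' z = restrict t T z" using z by simp
  qed (use t' in auto)
qed

lemma lift_at:
  assumes C: "is_real_cover X \<sigma> C" and y: "y \<in> fibre C x"
  shows "continuous_map Xt (surf_top (cov_surf C)) (lift_at Xt xt p C y)"
    "z \<in> T \<Longrightarrow> cov_map C (lift_at Xt xt p C y z) = p z"
    "lift_at Xt xt p C y xt = y"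
    "z \<in> T \<Longrightarrow> lift_at Xt xt p C y z \<in> cov_points C"
proof -
  have y': "y \<in> cov_points C" "cov_map C y = id (p xt)" using y p_xt by (simp_all add: fibre_iff)
  obtain t where t: "continuous_map Xt (surf_top (cov_surf C)) t" "t xt = y"
      "\<And>z. z \<in> T \<Longrightarrow> cov_map C (t z) = id (p z)"
    using lift[where s = id and z = xt and e = y, OF real_coverD(1)[OF C] _ xt y'] by auto
  have eq: "lift_at Xt xt p C y = restrict t T"
    by (rule lift_at_eq[OF C t(1) _ t(2)]) (simp add: t(3))
  show "continuous_map Xt (surf_top (cov_surf C)) (lift_at Xt xt p C y)"
    unfolding eq by (rule continuous_map_eq[OF t(1)]) simp
  show "cov_map C (lift_at Xt xt p C y z) = p z" if "z \<in> T" unfolding eq using t(3) that by simp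
  show "lift_at Xt xt p C y xt = y" unfolding eq using t(2) xt by simp
  show "lift_at Xt xt p C y z \<in> cov_points C" if "z \<in> T"
    unfolding eq using continuous_map_in[OF t(1) that] that by simp
qed

lemma lift_at_unique:
  assumes "is_real_cover X \<sigma> C"
    "continuous_map Xt (surf_top (cov_surf C)) t" "\<And>z. z \<in> T \<Longrightarrow> cov_map C (t z) = p z" "t xt = y" "z \<in> T"
  shows "lift_at Xt xt p C y z = t z"
  using lift_at_eq[OF assms(1-4)] assms(5) by simp

abbreviation "tau C \<equiv> tau_of X \<sigma> Xt p C"

definition fibre_act :: "('y, 'x) real_cover \<Rightarrow> ('t \<Rightarrow> 't) \<Rightarrow> 'y \<Rightarrow> 'y" where
  "fibre_act C = (\<lambda>f. \<lambda>y\<in>fibre C x. inv_into (cov_points C) (tau C f) (lift_at Xt xt p C y (f xt)))"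

lemma Fib_simps:
  "on_obj (Fib X \<sigma> Xt xt p x) C = (fibre C x, fibre_act C)"
  "on_hom (Fib X \<sigma> Xt xt p x) C D \<phi> = restrict \<phi> (fibre C x)"
  by (simp_all add: Fib_def fibre_act_def)

text \<open>Being the identity or the real structure, \<open>tau C f\<close> is its own inverse on
  the points of the cover, which removes \<open>inv_into\<close> from the definition of
  \<open>Fib\<close>. The last fact says that it cancels the effect of \<open>f\<close> on the
  projection.\<close>

lemma tau:
  assumes C: "is_real_cover X \<sigma> C"
  shows "continuous_map (surf_top (cov_surf C)) (surf_top (cov_surf C)) (tau C f)"
    "y \<in> cov_points C \<Longrightarrow> tau C f y \<in> cov_points C"
    "y \<in> cov_points C \<Longrightarrow> tau C f (tau C f y) = y"
    "y \<in> cov_points C \<Longrightarrow> inv_into (cov_points C) (tau C f) y = tau C f y"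
    "f \<in> carrier G \<Longrightarrow> y \<in> cov_points C \<Longrightarrow> z \<in> T \<Longrightarrow> cov_map C y = p (f z) \<Longrightarrow> cov_map C (tau C f y) = p z"
proof -
  note r = real_coverD[OF C]
  show "continuous_map (surf_top (cov_surf C)) (surf_top (cov_surf C)) (tau C f)"
    using r(5) by (simp add: tau_of_def)
  show in': "tau C f y \<in> cov_points C" if "y \<in> cov_points C" for y
    using r(6) that by (simp add: tau_of_def)
  show inv': "tau C f (tau C f y) = y" if "y \<in> cov_points C" for y
    using r(7) that by (simp add: tau_of_def)
  show "inv_into (cov_points C) (tau C f) y = tau C f y" if "y \<in> cov_points C"
  proof (rule inv_into_f_eq)
    show "tau C f y \<in> cov_points C" "tau C f (tau C f y) = y" using in' inv' that by simp_all
    show "inj_on (tau C f) (cov_points C)" by (rule inj_on_inverseI[where g = "tau C f"]) (rule inv')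
  qed
  show "cov_map C (tau C f y) = p z"
    if "f \<in> carrier G" "y \<in> cov_points C" "z \<in> T" "cov_map C y = p (f z)"
    using that r(8) pi1_p not_pi1_p \<sigma>_\<sigma> p_in by (simp add: tau_of_def)
qed

text \<open>The last fact is the workhorse: \<open>tau C f\<close> after \<open>t_y\<close> after
  \<open>f\<close> is again a lift of \<open>p\<close>, and its value at \<open>xt\<close> is the
  acted point, so it is the whole lift through that point.\<close>

lemma fibre_act:
  assumes C: "is_real_cover X \<sigma> C" and f: "f \<in> carrier G" and y: "y \<in> fibre C x"
  shows "fibre_act C f y = tau C f (lift_at Xt xt p C y (f xt))"
    "fibre_act C f y \<in> fibre C x"
    "z \<in> T \<Longrightarrow> lift_at Xt xt p C (fibre_act C f y) z = tau C f (lift_at Xt xt p C y (f z))"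
proof -
  let ?t = "lift_at Xt xt p C y"
  note fT = piR_in[OF f]
  note t = lift_at[OF C y]
  show eq: "fibre_act C f y = tau C f (?t (f xt))"
    using tau(4)[OF C t(4)[OF fT[OF xt]]] y by (simp add: fibre_act_def)
  have over: "cov_map C (tau C f (?t (f z))) = p z" if "z \<in> T" for z
    by (rule tau(5)[OF C f t(4)[OF fT[OF that]] that t(2)[OF fT[OF that]]])
  show "fibre_act C f y \<in> fibre C x"
    unfolding eq fibre_iff using tau(2)[OF C t(4)[OF fT[OF xt]]] over[OF xt] p_xt by simp
  have "continuous_map Xt (surf_top (cov_surf C)) (\<lambda>z. tau C f (?t (f z)))"
    using continuous_map_compose[OF continuous_map_compose[OF piR_cont[OF f] t(1)] tau(1)[OF C]]
    by (simp add: o_def)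
  from lift_at_unique[OF C this over refl]
  show "lift_at Xt xt p C (fibre_act C f y) z = tau C f (?t (f z))" if "z \<in> T"
    unfolding eq using that by blast
qed

lemma fibre_group_action:
  assumes C: "is_real_cover X \<sigma> C"
  shows "group_action G (fibre C x) (fibre_act C)"
proof (rule group_actionI[OF piR_group])
  show "fibre_act C f \<in> extensional (fibre C x)" for f by (simp add: fibre_act_def)
  show "fibre_act C f y \<in> fibre C x" if "f \<in> carrier G" "y \<in> fibre C x" for f y
    using fibre_act(2)[OF C that] .
  show "fibre_act C (f \<otimes>\<^bsub>G\<^esub> g) y = fibre_act C f (fibre_act C g y)"
    if f: "f \<in> carrier G" and g: "g \<in> carrier G" and y: "y \<in> fibre C x" for f g y
  proof -
    note fx = piR_in[OF f xt]
    have gy: "fibre_act C g y \<in> fibre C x" by (rule fibre_act(2)[OF C g y])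
    have fg: "f \<otimes>\<^bsub>G\<^esub> g \<in> carrier G" using f g by simp
    have w: "lift_at Xt xt p C y (g (f xt)) \<in> cov_points C" by (rule lift_at(4)[OF C y piR_in[OF g fx]])
    have "fibre_act C (f \<otimes>\<^bsub>G\<^esub> g) y = tau C (f \<otimes>\<^bsub>G\<^esub> g) (lift_at Xt xt p C y ((f \<otimes>\<^bsub>G\<^esub> g) xt))"
      by (rule fibre_act(1)[OF C fg y])
    also have "\<dots> = tau C (f \<otimes>\<^bsub>G\<^esub> g) (lift_at Xt xt p C y (g (f xt)))"
      by (simp only: piR_mult[OF f xt])
    \<comment> \<open>By parity: if both \<open>f\<close> and \<open>g\<close> lie outside
      \<open>N\<close>, the left side is the identity and the two real structures on the right
      cancel.\<close>
    also have "\<dots> = tau C f (tau C g (lift_at Xt xt p C y (g (f xt))))"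
      using pi1_mult_iff[OF f g] real_coverD(7)[OF C w] by (simp add: tau_of_def)
    also have "\<dots> = fibre_act C f (fibre_act C g y)"
      by (simp only: fibre_act(1)[OF C f gy] fibre_act(3)[OF C g y fx])
    finally show ?thesis .
  qed
  show "fibre_act C \<one>\<^bsub>G\<^esub> y = y" if y: "y \<in> fibre C x" for y
    using fibre_act(1)[OF C piR.one_closed y] piR_one[OF xt] lift_at(3)[OF C y]
    by (simp add: tau_of_def one_pi1)
qed

text \<open>A morphism composed with a lift of \<open>p\<close> is again a lift of \<open>p\<close>.
  Both the equivariance on fibres and the naturality of \<open>unit\<close> come from this.\<close>

lemma hom_lift_at:
  assumes C: "is_real_cover X \<sigma> C" and D: "is_real_cover X \<sigma> D"
    and \<phi>: "\<phi> \<in> Hom (RealCov X \<sigma>) C D" and y: "y \<in> fibre C x"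
  shows "\<phi> y \<in> fibre D x" "z \<in> T \<Longrightarrow> lift_at Xt xt p D (\<phi> y) z = \<phi> (lift_at Xt xt p C y z)"
proof -
  note h = RealCov_HomD[OF C D \<phi>] and t = lift_at[OF C y]
  show "\<phi> y \<in> fibre D x" using y h(4,5) by (simp add: fibre_iff)
  have "continuous_map Xt (surf_top (cov_surf D)) (\<lambda>z. \<phi> (lift_at Xt xt p C y z))"
    using continuous_map_compose[OF t(1) h(2)] by (simp add: o_def)
  from lift_at_unique[OF D this]
  show "lift_at Xt xt p D (\<phi> y) z = \<phi> (lift_at Xt xt p C y z)" if "z \<in> T"
    using h(4) t that by simp
qed

lemma fibre_hom:
  assumes C: "is_real_cover X \<sigma> C" and D: "is_real_cover X \<sigma> D"
    and \<phi>: "\<phi> \<in> Hom (RealCov X \<sigma>) C D"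
  shows "restrict \<phi> (fibre C x) \<in> Hom (GSets G) (fibre C x, fibre_act C) (fibre D x, fibre_act D)"
proof -
  have "\<phi> (fibre_act C f y) = fibre_act D f (\<phi> y)" if f: "f \<in> carrier G" and y: "y \<in> fibre C x" for f y
  proof -
    note fx = piR_in[OF f xt]
    have "\<phi> (tau C f (lift_at Xt xt p C y (f xt))) = tau D f (\<phi> (lift_at Xt xt p C y (f xt)))"
      using RealCov_HomD(3)[OF C D \<phi> lift_at(4)[OF C y fx]] by (simp add: tau_of_def)
    then show ?thesis
      by (simp only: fibre_act(1)[OF C f y] fibre_act(1)[OF D f hom_lift_at(1)[OF C D \<phi> y]]
        hom_lift_at(2)[OF C D \<phi> y fx])
  qed
  then show ?thesis
    unfolding GSets_simps
    using fibre_act(2)[OF C] hom_lift_at(1)[OF C D \<phi>] by simp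
qed

lemma Fib_functor: "is_functor (RealCov X \<sigma>) (GSets G) (Fib X \<sigma> Xt xt p x)"
  unfolding is_functor_def RealCov_simps Fib_simps GSets_simps(1,3,4)
proof (intro conjI ballI, goal_cases)
  case (1 C)
  note 1 = 1[unfolded RealCov_simps]
  from 1 show ?case by (rule fibre_group_action)
next
  case (2 C D \<phi>)
  note 2 = 2[unfolded RealCov_simps]
  from 2 show ?case by (rule fibre_hom)
next
  case (3 C)
  note 3 = 3[unfolded RealCov_simps]
  show ?case by (rule ext) (simp add: restrict_def fibre_iff)
next
  case (4 C D K f g)
  note 4 = 4[unfolded RealCov_simps]
  show ?case
    using hom_lift_at(1)[OF 4(1,2,4)]
    by (intro extensionalityI[of _ "fibre C x"]) (auto simp: compose_def fibre_iff)
qed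

end

section \<open>The functor \<open>Q\<close>\<close>

text \<open>Group sets and covers now live over the same type \<open>'u\<close>, so that the two
  functors can be composed in both orders.\<close>

locale klein_equivalence = klein_quotient X \<sigma> x Xt xt p code
  for X :: "'x surface" and \<sigma> :: "'x \<Rightarrow> 'x" and x :: 'x
    and Xt :: "'t topology" and xt :: 't and p :: "'t \<Rightarrow> 'x" and code :: "('t \<times> 'u) set \<Rightarrow> 'u"
begin

abbreviation "cl C \<equiv> cls code X \<sigma> Xt p (fibre C x, fibre_act C)"
abbreviation "QF C \<equiv> on_obj (Q code X \<sigma> Xt p) (fibre C x, fibre_act C)"

lemma Q_functor: "is_functor (GSets G) (RealCov X \<sigma>) (Q code X \<sigma> Xt p)"
  unfolding is_functor_def
proof (intro conjI ballI, goal_cases)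
  case (1 F)
  obtain E \<rho> where F: "F = (E, \<rho>)" by fastforce
  have "group_action G E \<rho>" using 1 unfolding F GSets_simps .
  from Qcov_real[OF this] show ?case unfolding F RealCov_simps .
next
  case (2 F F' u)
  obtain E \<rho> E' \<rho>' where F: "F = (E, \<rho>)" "F' = (E', \<rho>')" by (metis surj_pair)
  have act: "group_action G E \<rho>" and act': "group_action G E' \<rho>'"
    using 2(1,2) unfolding F GSets_simps by auto
  note u = 2(3)[unfolded F]
  have uE: "u v \<in> E'" if "v \<in> E" for v using u that by (simp add: GSets_simps)
  note hc = Q_hom_cls[OF act act' u]
  let ?\<phi> = "on_hom (Q code X \<sigma> Xt p) (E, \<rho>) (E', \<rho>') u"
  have "continuous_map (QT E \<rho>) (QT E' \<rho>') ?\<phi>"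
  proof (rule QT_continuousI[OF act])
    show "continuous_map Xt (QT E' \<rho>') (\<lambda>y. ?\<phi> (c E \<rho> (y, v)))" if v: "v \<in> E" for v
      by (rule continuous_map_eq[OF cls_continuous[OF act' uE[OF v]]]) (simp add: hc v)
  qed
  moreover obtain h where h: "h \<in> carrier G" "h \<notin> N" using not_pi1_ex .
  have "?\<phi> (qi E \<rho> b) = qi E' \<rho>' (?\<phi> b) \<and> qm E' \<rho>' (?\<phi> b) = qm E \<rho> b" if b: "b \<in> topspace (QT E \<rho>)" for b
  proof -
    obtain y v where y: "y \<in> T" "v \<in> E" "b = c E \<rho> (y, v)" using QT_pointsE[OF act b] .
    note hy = piR_inv(1)[OF h(1) y(1)] and hv = group_action_facts(1)[OF act h(1) y(2)]
    have "u (\<rho> h v) = \<rho>' h (u v)" using u h(1) y(2) by (simp add: GSets_simps)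
    then show ?thesis
      unfolding y(3) Q_inv_cls[OF act y(1,2) h] hc[OF y(1,2)] hc[OF hy hv]
        Q_inv_cls[OF act' y(1) uE[OF y(2)] h] Q_map_cls[OF act y(1,2)] Q_map_cls[OF act' y(1) uE[OF y(2)]]
      by simp
  qed
  moreover have "?\<phi> \<in> extensional (topspace (QT E \<rho>))" by (simp add: Q_def)
  ultimately show ?case
    unfolding F RealCov_Hom_iff[OF Qcov_real[OF act] Qcov_real[OF act']] Qcov_simps[OF act] Qcov_simps[OF act']
    by simp
next
  case (3 F)
  obtain E \<rho> where F: "F = (E, \<rho>)" by fastforce
  have act: "group_action G E \<rho>" using 3 unfolding F GSets_simps .
  have id: "(\<lambda>v\<in>E. v) \<in> Hom (GSets G) (E, \<rho>) (E, \<rho>)"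
    using group_action_facts(1)[OF act] by (simp add: GSets_simps)
  show ?case
    unfolding F RealCov_simps GSets_simps Qcov_simps[OF act]
  proof (rule extensionalityI[of _ "topspace (QT E \<rho>)"])
    fix b assume b: "b \<in> topspace (QT E \<rho>)"
    obtain y v where y: "y \<in> T" "v \<in> E" "b = c E \<rho> (y, v)" using QT_pointsE[OF act b] .
    then show "on_hom (Q code X \<sigma> Xt p) (E, \<rho>) (E, \<rho>) (\<lambda>v\<in>E. v) b = (\<lambda>y\<in>topspace (QT E \<rho>). y) b"
      using b Q_hom_cls[OF act act id y(1,2)] by simp
  qed (simp_all add: Q_def)
next
  case (4 F F' F'' u w)
  obtain E \<rho> E' \<rho>' E'' \<rho>'' where F: "F = (E, \<rho>)" "F' = (E', \<rho>')" "F'' = (E'', \<rho>'')" by (metis surj_pair)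
  have act: "group_action G E \<rho>" and act': "group_action G E' \<rho>'" and act'': "group_action G E'' \<rho>''"
    using 4(1-3) unfolding F GSets_simps by auto
  note u = 4(4)[unfolded F] and w = 4(5)[unfolded F]
  have uE: "u v \<in> E'" if "v \<in> E" for v using u that by (simp add: GSets_simps)
  have wu: "compose E w u \<in> Hom (GSets G) (E, \<rho>) (E'', \<rho>'')"
    using u w group_action_facts(1)[OF act] by (simp add: GSets_simps compose_def)
  show ?case
    unfolding F RealCov_simps GSets_simps Qcov_simps[OF act]
  proof (rule extensionalityI[of _ "topspace (QT E \<rho>)"])
    fix b assume b: "b \<in> topspace (QT E \<rho>)"
    obtain y v where y: "y \<in> T" "v \<in> E" "b = c E \<rho> (y, v)" using QT_pointsE[OF act b] .
    then show "on_hom (Q code X \<sigma> Xt p) (E, \<rho>) (E'', \<rho>'') (compose E w u) b =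
        compose (topspace (QT E \<rho>)) (on_hom (Q code X \<sigma> Xt p) (E', \<rho>') (E'', \<rho>'') w)
          (on_hom (Q code X \<sigma> Xt p) (E, \<rho>) (E', \<rho>') u) b"
      using b Q_hom_cls[OF act act'' wu y(1,2)] Q_hom_cls[OF act act' u y(1,2)]
        Q_hom_cls[OF act' act'' w y(1) uE[OF y(2)]] by (simp add: compose_def)
  qed (simp_all add: Q_def compose_def)
qed

section \<open>From the quotient of the fibre back to the cover\<close>

definition unit :: "('u, 'x) real_cover \<Rightarrow> 'u \<Rightarrow> 'u" where
  "unit C = (\<lambda>b\<in>cov_points (QF C). THE a. \<exists>y\<in>T. \<exists>v\<in>fibre C x. cl C (y, v) = b \<and> a = lift_at Xt xt p C v y)"

text \<open>For \<open>f\<close> in \<open>N\<close> no real structure intervenes. The identity is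
  exactly the invariance under \<open>N\<close> that makes \<open>unit\<close> well defined.\<close>

lemma lift_at_pi1:
  assumes C: "is_real_cover X \<sigma> C" and f: "f \<in> N" and v: "v \<in> fibre C x" and z: "z \<in> T"
  shows "lift_at Xt xt p C (fibre_act C f v) z = lift_at Xt xt p C v (f z)"
  using fibre_act(3)[OF C pi1_carrier[OF f] v z] f by (simp add: tau_of_def)

lemma unit_cls:
  assumes C: "is_real_cover X \<sigma> C" and y: "y \<in> T" and v: "v \<in> fibre C x"
  shows "unit C (cl C (y, v)) = lift_at Xt xt p C v y"
proof -
  note act = fibre_group_action[OF C]
  have "(THE a. \<exists>y'\<in>T. \<exists>v'\<in>fibre C x. cl C (y', v') = cl C (y, v) \<and> a = lift_at Xt xt p C v' y') =
      lift_at Xt xt p C v y"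
  proof (rule the_equality)
    fix a assume "\<exists>y'\<in>T. \<exists>v'\<in>fibre C x. cl C (y', v') = cl C (y, v) \<and> a = lift_at Xt xt p C v' y'"
    then obtain y' v' where yv: "y' \<in> T" "v' \<in> fibre C x" "cl C (y', v') = cl C (y, v)"
      "a = lift_at Xt xt p C v' y'" by blast
    obtain f where "f \<in> N" "f y = y'" "v = fibre_act C f v'"
      using cls_eqD[OF act yv(1) y yv(2) v yv(3)] .
    then show "a = lift_at Xt xt p C v y" using lift_at_pi1[OF C _ yv(2) y] yv(4) by metis
  qed (use y v in blast)
  then show ?thesis
    using QT_pointsI[OF act y v] unfolding unit_def Qcov_simps[OF act] by simp
qed

text \<open>For the real structures, the lift through \<open>h\<close> acting on \<open>v\<close>,
  taken at the inverse image of \<open>y\<close> under \<open>h\<close>, is \<open>cov_inv C\<close>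
  of the lift through \<open>v\<close> at \<open>y\<close>: the two occurrences of \<open>h\<close>
  cancel and leave its \<open>tau\<close>.\<close>

lemma unit_hom:
  assumes C: "is_real_cover X \<sigma> C"
  shows "unit C \<in> Hom (RealCov X \<sigma>) (QF C) C"
proof -
  note act = fibre_group_action[OF C]
  let ?E = "fibre C x" and ?r = "fibre_act C"
  have "continuous_map (QT ?E ?r) (surf_top (cov_surf C)) (unit C)"
  proof (rule QT_continuousI[OF act])
    show "continuous_map Xt (surf_top (cov_surf C)) (\<lambda>y. unit C (cl C (y, v)))" if v: "v \<in> ?E" for v
      by (rule continuous_map_eq[OF lift_at(1)[OF C v]]) (simp add: unit_cls[OF C _ v])
  qed
  moreover obtain h where h: "h \<in> carrier G" "h \<notin> N" using not_pi1_ex .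
  have "unit C (qi ?E ?r b) = cov_inv C (unit C b) \<and> cov_map C (unit C b) = qm ?E ?r b"
    if b: "b \<in> topspace (QT ?E ?r)" for b
  proof -
    obtain y v where y: "y \<in> T" "v \<in> ?E" "b = cl C (y, v)" using QT_pointsE[OF act b] .
    note hy = piR_inv(1)[OF h(1) y(1)] and hv = fibre_act(2)[OF C h(1) y(2)]
    have "unit C (qi ?E ?r b) = lift_at Xt xt p C (?r h v) ((inv\<^bsub>G\<^esub> h) y)"
      unfolding y(3) Q_inv_cls[OF act y(1,2) h] by (rule unit_cls[OF C hy hv])
    also have "\<dots> = tau C h (lift_at Xt xt p C v (h ((inv\<^bsub>G\<^esub> h) y)))"
      by (rule fibre_act(3)[OF C h(1) y(2) hy])
    also have "\<dots> = cov_inv C (lift_at Xt xt p C v y)"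
      using h piR_inv(2)[OF h(1) y(1)] by (simp add: tau_of_def)
    finally have "unit C (qi ?E ?r b) = cov_inv C (lift_at Xt xt p C v y)" .
    then show ?thesis
      unfolding y(3) unit_cls[OF C y(1,2)] Q_map_cls[OF act y(1,2)] using lift_at(2)[OF C y(2,1)] by simp
  qed
  moreover have "unit C \<in> extensional (topspace (QT ?E ?r))"
    unfolding unit_def Qcov_simps[OF act] by simp
  ultimately show ?thesis
    unfolding RealCov_Hom_iff[OF Qcov_real[OF act] C] Qcov_simps[OF act] by simp
qed

text \<open>If two lifts take the same value at \<open>y\<close> and \<open>y'\<close>, some
  \<open>f\<close> in \<open>N\<close> sends \<open>y'\<close> to \<open>y\<close>, and the lifts
  through \<open>f\<close> acting on \<open>v\<close> and through \<open>v'\<close> agree at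
  \<open>y'\<close>, hence at \<open>xt\<close>. For surjectivity, \<open>p\<close> is lifted so as
  to pass through the given point \<open>w\<close>; the value of that lift at \<open>xt\<close> is
  the fibre coordinate.\<close>

lemma unit_bij:
  assumes C: "is_real_cover X \<sigma> C"
  shows "bij_betw (unit C) (cov_points (QF C)) (cov_points C)"
proof -
  note act = fibre_group_action[OF C]
  let ?E = "fibre C x" and ?r = "fibre_act C"
  have inj: "b = b'" if b: "b \<in> topspace (QT ?E ?r)" "b' \<in> topspace (QT ?E ?r)" and eq: "unit C b = unit C b'" for b b'
  proof -
    obtain y v where y: "y \<in> T" "v \<in> ?E" "b = cl C (y, v)" using QT_pointsE[OF act b(1)] .
    obtain y' v' where y': "y' \<in> T" "v' \<in> ?E" "b' = cl C (y', v')" using QT_pointsE[OF act b(2)] .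
    have tt: "lift_at Xt xt p C v y = lift_at Xt xt p C v' y'"
      using eq unit_cls[OF C y(1,2)] unit_cls[OF C y'(1,2)] y(3) y'(3) by simp
    then have "p y = p y'" using lift_at(2)[OF C y(2,1)] lift_at(2)[OF C y'(2,1)] by simp
    then obtain f where f: "f \<in> N" "f y' = y" using pi1_transitive[OF y'(1) y(1)] by metis
    have fv: "?r f v \<in> ?E" by (rule fibre_act(2)[OF C pi1_carrier[OF f(1)] y(2)])
    have "lift_at Xt xt p C (?r f v) y' = lift_at Xt xt p C v' y'"
      using lift_at_pi1[OF C f(1) y(2) y'(1)] f(2) tt by simp
    then have "lift_at Xt xt p C (?r f v) xt = lift_at Xt xt p C v' xt"
      using lift_at(2)[OF C fv] lift_at(2)[OF C y'(2)]
      by (intro lift_unique[OF real_coverD(1)[OF C] lift_at(1)[OF C fv] lift_at(1)[OF C y'(2)] _ y'(1) _ xt]) simp_all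
    then have "v' = ?r f v" using lift_at(3)[OF C fv] lift_at(3)[OF C y'(2)] by simp
    then have "cl C (y, v) = cl C (y', v')"
      by (intro cls_eqI[OF act, where f = f]) (use y y' f in simp_all)
    then show ?thesis using y(3) y'(3) by simp
  qed
  have surj: "\<exists>b\<in>topspace (QT ?E ?r). w = unit C b" if w: "w \<in> cov_points C" for w
  proof -
    have "cov_map C w \<in> points X" using continuous_map_in[OF holomorphic_map_continuous[OF real_coverD(2)[OF C]] w] .
    then obtain z where z: "z \<in> T" "cov_map C w = p z" using p_surj by (metis imageE)
    have "cov_map C w = id (p z)" using z(2) by simp
    then obtain t where t: "continuous_map Xt (surf_top (cov_surf C)) t" "t z = w"
        "\<And>u. u \<in> T \<Longrightarrow> cov_map C (t u) = id (p u)"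
      using lift[where s = id and z = z and e = w, OF real_coverD(1)[OF C] _ z(1) w] by auto
    have v: "t xt \<in> ?E" using continuous_map_in[OF t(1) xt] t(3)[OF xt] p_xt by (simp add: fibre_iff)
    have "lift_at Xt xt p C (t xt) z = t z"
      by (rule lift_at_unique[OF C t(1) _ refl z(1)]) (simp add: t(3))
    then show ?thesis
      using QT_pointsI[OF act z(1) v] unit_cls[OF C z(1) v] t(2) by (intro bexI[of _ "cl C (z, t xt)"]) simp_all
  qed
  have inp: "unit C b \<in> cov_points C" if "b \<in> topspace (QT ?E ?r)" for b
    using RealCov_HomD(5)[OF Qcov_real[OF act] C unit_hom[OF C]] that unfolding Qcov_simps[OF act] by blast
  show ?thesis
    unfolding Qcov_simps[OF act] by (rule bij_betwI') (use inj inp surj in blast)+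
qed

lemma unit_natural_iso:
  "naturally_isomorphic (RealCov X \<sigma>) (RealCov X \<sigma>)
     (comp_functor (Q code X \<sigma> Xt p) (Fib X \<sigma> Xt xt p x)) id_functor"
  unfolding naturally_isomorphic_def comp_functor_def id_functor_def cat_functor.simps Fib_simps
proof (intro exI[of _ unit] conjI ballI, goal_cases)
  case (1 C)
  then have C: "is_real_cover X \<sigma> C" unfolding RealCov_simps .
  show ?case by (rule RealCov_iso[OF Qcov_real[OF fibre_group_action[OF C]] C unit_hom[OF C] unit_bij[OF C]])
next
  case (2 C D \<phi>)
  then have C: "is_real_cover X \<sigma> C" and D: "is_real_cover X \<sigma> D" and \<phi>: "\<phi> \<in> Hom (RealCov X \<sigma>) C D"
    unfolding RealCov_simps by auto
  note act = fibre_group_action[OF C] and act' = fibre_group_action[OF D]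
  note hc = Q_hom_cls[OF act act' fibre_hom[OF C D \<phi>]]
  show ?case
    unfolding RealCov_simps
  proof (rule extensionalityI[of _ "cov_points (QF C)"], goal_cases)
    case (3 b)
    then have b: "b \<in> topspace (QT (fibre C x) (fibre_act C))" unfolding Qcov_simps[OF act] .
    obtain y v where y: "y \<in> T" "v \<in> fibre C x" "b = cl C (y, v)" using QT_pointsE[OF act b] .
    have "on_hom (Q code X \<sigma> Xt p) (fibre C x, fibre_act C) (fibre D x, fibre_act D) (restrict \<phi> (fibre C x)) b =
        cl D (y, \<phi> v)"
      using hc[OF y(1,2)] y(2,3) by simp
    then have "unit D (on_hom (Q code X \<sigma> Xt p) (fibre C x, fibre_act C) (fibre D x, fibre_act D)
        (restrict \<phi> (fibre C x)) b) = \<phi> (unit C b)"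
      using unit_cls[OF D y(1) hom_lift_at(1)[OF C D \<phi> y(2)]] unit_cls[OF C y(1,2)]
        hom_lift_at(2)[OF C D \<phi> y(2,1)] y(3) by simp
    then show ?case using 3 by (simp only: compose_eq)
  qed (simp_all add: compose_def)
qed

section \<open>From the fibre of the quotient back to the group set\<close>

definition counit :: "('t \<Rightarrow> 't, 'u) gset \<Rightarrow> 'u \<Rightarrow> 'u" where
  "counit F = restrict (inv_into (fst F) (\<lambda>v. cls code X \<sigma> Xt p F (xt, v)))
     (fibre (on_obj (Q code X \<sigma> Xt p) F) x)"

context
  fixes E \<rho> assumes act: "group_action G E (\<rho> :: ('t \<Rightarrow> 't) \<Rightarrow> 'u \<Rightarrow> 'u)"
begin

text \<open>Every class over \<open>x\<close> has a representative with first coordinate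
  \<open>xt\<close> because \<open>N\<close> is transitive on the fibre of \<open>p\<close>, and
  only one because the action is free.\<close>

lemma base_cls_bij: "bij_betw (\<lambda>v. c E \<rho> (xt, v)) E (fibre (Qcov E \<rho>) x)"
proof -
  have inj: "v = v'" if v: "v \<in> E" "v' \<in> E" and eq: "c E \<rho> (xt, v) = c E \<rho> (xt, v')" for v v'
  proof -
    obtain f where f: "f \<in> N" "f xt = xt" "v' = \<rho> f v" using cls_eqD[OF act xt xt v eq] .
    then have "f = \<one>\<^bsub>G\<^esub>" using pi1_free xt by blast
    then show ?thesis using f(3) group_action_facts(3)[OF act v(1)] by simp
  qed
  have surj: "\<exists>v\<in>E. b = c E \<rho> (xt, v)" if b: "b \<in> fibre (Qcov E \<rho>) x" for b
  proof -
    have b': "b \<in> topspace (QT E \<rho>)" "qm E \<rho> b = x" using b unfolding fibre_iff Qcov_simps[OF act] by auto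
    obtain y v where y: "y \<in> T" "v \<in> E" "b = c E \<rho> (y, v)" using QT_pointsE[OF act b'(1)] .
    have "p y = p xt" using b'(2) Q_map_cls[OF act y(1,2)] y(3) p_xt by simp
    then obtain f where f: "f \<in> N" "f xt = y" using pi1_transitive[OF xt y(1)] by metis
    have "b = c E \<rho> (xt, \<rho> f v)" unfolding y(3) by (rule cls_eqI[OF act y(1) xt y(2) f refl])
    then show ?thesis using group_action_facts(1)[OF act pi1_carrier[OF f(1)] y(2)] by blast
  qed
  have inp: "c E \<rho> (xt, v) \<in> fibre (Qcov E \<rho>) x" if "v \<in> E" for v
    unfolding fibre_iff Qcov_simps[OF act] using QT_pointsI[OF act xt that] Q_map_cls[OF act xt that] p_xt by simp
  show ?thesis
    by (rule bij_betwI') (use inj inp surj in blast)+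
qed

lemma counit_cls: "v \<in> E \<Longrightarrow> counit (E, \<rho>) (c E \<rho> (xt, v)) = v"
  using bij_betw_inv_into_left[OF base_cls_bij] bij_betwE[OF base_cls_bij] by (simp add: counit_def)

lemma fibre_QcovE:
  assumes "b \<in> fibre (Qcov E \<rho>) x"
  obtains v where "v \<in> E" "b = c E \<rho> (xt, v)"
proof -
  have "b \<in> (\<lambda>v. c E \<rho> (xt, v)) ` E" using assms bij_betw_imp_surj_on[OF base_cls_bij] by simp
  then show ?thesis by (elim imageE) (rule that)
qed

text \<open>The lift through the class of \<open>(xt, v)\<close> is
  \<open>z \<mapsto> [(z, v)]\<close>, by uniqueness. It remains to rewrite the class of
  \<open>(f xt, v)\<close>, after the real structure when \<open>f \<notin> N\<close>, with first
  coordinate \<open>xt\<close>.\<close>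

lemma fibre_act_cls:
  assumes f: "f \<in> carrier G" and v: "v \<in> E"
  shows "fibre_act (Qcov E \<rho>) f (c E \<rho> (xt, v)) = c E \<rho> (xt, \<rho> f v)"
proof -
  note R = Qcov_real[OF act]
  note fx = piR_in[OF f xt] and fv = group_action_facts(1)[OF act f v]
  have b: "c E \<rho> (xt, v) \<in> fibre (Qcov E \<rho>) x" using bij_betwE[OF base_cls_bij] v by simp
  have "continuous_map Xt (surf_top (cov_surf (Qcov E \<rho>))) (\<lambda>z. c E \<rho> (z, v))"
    unfolding Qcov_simps[OF act] by (rule cls_continuous[OF act v])
  from lift_at_unique[OF R this _ refl fx]
  have "lift_at Xt xt p (Qcov E \<rho>) (c E \<rho> (xt, v)) (f xt) = c E \<rho> (f xt, v)"
    unfolding Qcov_simps[OF act] using Q_map_cls[OF act _ v] by simp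
  then have 1: "fibre_act (Qcov E \<rho>) f (c E \<rho> (xt, v)) = tau (Qcov E \<rho>) f (c E \<rho> (f xt, v))"
    using fibre_act(1)[OF R f b] by simp
  show ?thesis
  proof (cases "f \<in> N")
    case True
    then have "tau (Qcov E \<rho>) f (c E \<rho> (f xt, v)) = c E \<rho> (f xt, v)" by (simp add: tau_of_def)
    also have "\<dots> = c E \<rho> (xt, \<rho> f v)" by (rule cls_eqI[OF act fx xt v True refl refl])
    finally show ?thesis using 1 by simp
  next
    case False
    then have "tau (Qcov E \<rho>) f (c E \<rho> (f xt, v)) = qi E \<rho> (c E \<rho> (f xt, v))"
      unfolding Qcov_simps(2)[OF act, symmetric] by (simp add: tau_of_def)
    \<comment> \<open>The real structure is evaluated with \<open>h = f\<close> itself, whose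
      inverse brings \<open>f xt\<close> back to \<open>xt\<close>.\<close>
    also have "\<dots> = c E \<rho> (xt, \<rho> f v)"
      using Q_inv_cls[OF act fx v f False] piR_inv(3)[OF f xt] by simp
    finally show ?thesis using 1 by simp
  qed
qed

lemma counit_hom:
  "counit (E, \<rho>) \<in> Hom (GSets G) (fibre (Qcov E \<rho>) x, fibre_act (Qcov E \<rho>)) (E, \<rho>)"
  unfolding GSets_simps
proof (intro conjI ballI)
  show "counit (E, \<rho>) \<in> extensional (fibre (Qcov E \<rho>) x)" by (simp add: counit_def)
  fix b assume b: "b \<in> fibre (Qcov E \<rho>) x"
  obtain v where v: "v \<in> E" "b = c E \<rho> (xt, v)" using fibre_QcovE[OF b] .
  show "counit (E, \<rho>) b \<in> E" using counit_cls v by simp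
  fix f assume f: "f \<in> carrier G"
  show "counit (E, \<rho>) (fibre_act (Qcov E \<rho>) f b) = \<rho> f (counit (E, \<rho>) b)"
    unfolding v(2) fibre_act_cls[OF f v(1)] counit_cls[OF v(1)]
    by (rule counit_cls[OF group_action_facts(1)[OF act f v(1)]])
qed

lemma counit_bij: "bij_betw (counit (E, \<rho>)) (fibre (Qcov E \<rho>) x) E"
  using bij_betw_inv_into[OF base_cls_bij] by (simp add: counit_def bij_betw_restrict_eq)

end

lemma counit_natural_iso:
  "naturally_isomorphic (GSets G) (GSets G)
     (comp_functor (Fib X \<sigma> Xt xt p x) (Q code X \<sigma> Xt p)) id_functor"
  unfolding naturally_isomorphic_def comp_functor_def id_functor_def cat_functor.simps Fib_simps
proof (intro exI[of _ counit] conjI ballI, goal_cases)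
  case (1 F)
  obtain E \<rho> where F: "F = (E, \<rho>)" by fastforce
  have act: "group_action G E \<rho>" using 1 unfolding F GSets_simps .
  show ?case
    unfolding F
    by (rule GSets_iso[OF fibre_group_action[OF Qcov_real[OF act]] act counit_hom[OF act] counit_bij[OF act]])
next
  case (2 F F' u)
  obtain E \<rho> E' \<rho>' where F: "F = (E, \<rho>)" "F' = (E', \<rho>')" by (metis surj_pair)
  have act: "group_action G E \<rho>" and act': "group_action G E' \<rho>'"
    using 2(1,2) unfolding F GSets_simps by auto
  note u = 2(3)[unfolded F]
  have uE: "u v \<in> E'" if "v \<in> E" for v using u that by (simp add: GSets_simps)
  show ?case
    unfolding F GSets_simps
  proof (rule extensionalityI[of _ "fibre (Qcov E \<rho>) x"])
    fix b assume b: "b \<in> fibre (Qcov E \<rho>) x"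
    obtain v where v: "v \<in> E" "b = c E \<rho> (xt, v)" using fibre_QcovE[OF act b] .
    show "compose (fibre (Qcov E \<rho>) x) (counit (E', \<rho>'))
        (restrict (on_hom (Q code X \<sigma> Xt p) (E, \<rho>) (E', \<rho>') u) (fibre (Qcov E \<rho>) x)) b =
        compose (fibre (Qcov E \<rho>) x) u (counit (E, \<rho>)) b"
      using b Q_hom_cls[OF act act' u xt v(1)] counit_cls[OF act v(1)] counit_cls[OF act' uE[OF v(1)]] v(2)
      by (simp add: compose_eq)
  qed (simp_all add: compose_def)
qed

theorem Fib_Q_quasi_inverse:
  "quasi_inverse_functors (RealCov X \<sigma>) (GSets G) (Fib X \<sigma> Xt xt p x) (Q code X \<sigma> Xt p)"
  unfolding quasi_inverse_functors_def
  using Fib_functor Q_functor unit_natural_iso counit_natural_iso by blast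

end

text \<open>Equal names come from equal chosen elements, as \<open>enc\<close> is injective, and the
  chosen element lies in both sets.\<close>

lemma rep_code_meet:
  assumes "inj enc" "A \<noteq> {}" "B \<noteq> {}" "rep_code enc A = rep_code enc B"
  shows "A \<inter> B \<noteq> {}"
proof -
  have "(SOME z. z \<in> A) = (SOME z. z \<in> B)"
    using assms(1,4) by (simp add: rep_code_def inj_eq)
  moreover have "(SOME z. z \<in> A) \<in> A" "(SOME z. z \<in> B) \<in> B"
    using assms(2,3) by (simp_all add: some_in_eq)
  ultimately show ?thesis by auto
qed

text \<open>The last two conjuncts supply the quotient group of order two whose induced action is
  the real structure on the quotient.\<close>

theorem theorem2p21:
  fixes X :: "'x surface" and \<sigma> :: "'x \<Rightarrow> 'x" and x :: 'x
    and Xt :: "'t topology" and xt :: 't and p :: "'t \<Rightarrow> 'x"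
    and enc :: "'t \<times> 'u \<Rightarrow> 'u"
  assumes "klein_surface X \<sigma>"
    and "connected_space (surf_top X)"
    and "x \<in> points X"
    and "universal_cover (surf_top X) x Xt xt p"
    and "inj enc"
  shows "equivalent_categories
           (RealCov X \<sigma> :: (('u, 'x) real_cover, 'u \<Rightarrow> 'u) cat)
           (GSets (piR X \<sigma> Xt p) :: (('t \<Rightarrow> 't, 'u) gset, 'u \<Rightarrow> 'u) cat)
       \<and> quasi_inverse_functors
           (RealCov X \<sigma> :: (('u, 'x) real_cover, 'u \<Rightarrow> 'u) cat)
           (GSets (piR X \<sigma> Xt p) :: (('t \<Rightarrow> 't, 'u) gset, 'u \<Rightarrow> 'u) cat)
           (Fib X \<sigma> Xt xt p x)
           (Q (rep_code enc) X \<sigma> Xt p)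
       \<and> pi1 X \<sigma> Xt p \<lhd> piR X \<sigma> Xt p
       \<and> (piR X \<sigma> Xt p Mod pi1 X \<sigma> Xt p) \<cong> integer_mod_group 2"
proof -
  interpret klein_equivalence X \<sigma> x Xt xt p "rep_code enc"
  proof (intro_locales)
    show "klein_universal_cover X \<sigma> x Xt xt p" using assms(1-4) by (rule klein_universal_cover.intro)
    show "klein_quotient_axioms (rep_code enc)"
      using rep_code_meet[OF assms(5)] by (rule klein_quotient_axioms.intro)
  qed
  show ?thesis
    unfolding equivalent_categories_def
    using RealCov_category GSets_category Fib_Q_quasi_inverse pi1_normal pi1_index_two by blast
qed

end
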